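(* Let $(E,\mathcal P)$ be a random locally convex module over $\mathbb R$ with base $(\Omega,\mathcal F,P)$ and $f:E\to\bar L^0(\mathcal F)$ a proper $\mathcal T_{\varepsilon,\lambda}$-lower semicontinuous $L^0$-convex function. Then $f^{**}_{\varepsilon,\lambda}=f$. Here $f^*_{\varepsilon,\lambda}:E^*_{\varepsilon,\lambda}\to\bar L^0(\mathcal F)$ is defined by $f^*_{\varepsilon,\lambda}(g)=\bigvee\{g(x)-f(x):x\in E\}$ for all $g\in E^*_{\varepsilon,\lambda}$, and $f^{**}_{\varepsilon,\lambda}:E\to\bar L^0(\mathcal F)$ by $f^{**}_{\varepsilon,\lambda}(x)=\bigvee\{g(x)-f^*_{\varepsilon,\lambda}(g):g\in E^*_{\varepsilon,\lambda}\}$ for all $x\in E$.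
   Context: $(\Omega,\mathcal F,P)$ is a probability space. $L^0(\mathcal F)$ is the algebra of (a.s.-equality) equivalence classes of real $\mathcal F$-measurable random variables with the a.s. order; $L^0_+(\mathcal F)=\{\xi\in L^0(\mathcal F):\xi\ge0\}$. $\bar L^0(\mathcal F)$ is the complete lattice of classes of $[-\infty,\infty]$-valued $\mathcal F$-measurable functions; $\bigvee$ is the supremum there. Conventions: $0\cdot(\pm\infty)=0$, $+\infty\pm(\pm\infty)=+\infty$. An $L^0$-seminorm on an $L^0(\mathcal F)$-module $E$ is a map $\|\cdot\|:E\to L^0_+(\mathcal F)$ with $\|\xi x\|=|\xi|\|x\|$, $\|x+y\|\le\|x\|+\|y\|$. A random locally convex module over $\mathbb R$ with base $(\Omega,\mathcal F,P)$ is a pair $(E,\mathcal P)$ with $E$ an $L^0(\mathcal F)$-module and $\mathcal P$ a family of $L^0$-seminorms on $E$ with $\bigvee\{\|x\|:\|\cdot\|\in\mathcal P\}=0$ iff $x=\theta$ (the null element). For finite $\mathcal Q\subset\mathcal P$ put $\|x\|_{\mathcal Q}=\bigvee\{\|x\|:\|\cdot\|\in\mathcal Q\}$. The $(\varepsilon,\lambda)$-topology $\mathcal T_{\varepsilon,\lambda}$ is the linear topology with local base at $\theta$ consisting of $\{x\in E:P\{\|x\|_{\mathcal Q}<\varepsilon\}>1-\lambda\}$, $\mathcal Q\subset\mathcal P$ finite, $\varepsilon>0$, $0<\lambda<1$ real; on $L^0(\mathcal F)$ (with $|\cdot|$) it is the topology of convergence in probability. $E^*_{\varepsilon,\lambda}$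 is the $L^0(\mathcal F)$-module of continuous module homomorphisms from $(E,\mathcal T_{\varepsilon,\lambda})$ to $(L^0(\mathcal F),\mathcal T_{\varepsilon,\lambda})$. For $f:E\to\bar L^0(\mathcal F)$: $\mathrm{dom}(f)=\{x:|f(x)|<+\infty\text{ a.s.}\}$; $\mathrm{epi}(f)=\{(x,r)\in E\times L^0(\mathcal F):f(x)\le r\}$; $f$ is proper if $\mathrm{dom}(f)\neq\emptyset$ and $f(x)>-\infty$ a.s. for all $x$; $f$ is $L^0$-convex if $f(\xi x+(1-\xi)y)\le\xi f(x)+(1-\xi)f(y)$ for $x,y\in E$, $\xi\in L^0_+(\mathcal F)$, $0\le\xi\le1$; $f$ is $\mathcal T_{\varepsilon,\lambda}$-lower semicontinuous if $\mathrm{epi}(f)$ is closed in $(E,\mathcal T_{\varepsilon,\lambda})\times(L^0(\mathcal F),\mathcal T_{\varepsilon,\lambda})$. *)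

theory Defs
  imports "HOL-Probability.Probability" "HOL-Algebra.Module" "HOL-Algebra.Complete_Lattice"
begin

section \<open>Classes of random variables\<close>

definition ae_rel :: "'w measure \<Rightarrow> (('w \<Rightarrow> 'b::topological_space) \<times> ('w \<Rightarrow> 'b)) set" where
  "ae_rel M = {(f, g). f \<in> borel_measurable M \<and> g \<in> borel_measurable M \<and> (AE w in M. f w = g w)}"

definition ae_class :: "'w measure \<Rightarrow> ('w \<Rightarrow> 'b::topological_space) \<Rightarrow> ('w \<Rightarrow> 'b) set" where
  "ae_class M f = ae_rel M `` {f}"

definition rep :: "('w \<Rightarrow> 'b) set \<Rightarrow> 'w \<Rightarrow> 'b" where
  "rep X = (SOME f. f \<in> X)"

definition lift1 :: "'w measure \<Rightarrow> ('b \<Rightarrow> 'c::topological_space) \<Rightarrow> ('w \<Rightarrow> 'b) set \<Rightarrow> ('w \<Rightarrow> 'c) set" where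
  "lift1 M h X = ae_class M (\<lambda>w. h (rep X w))"

definition lift2 :: "'w measure \<Rightarrow> ('b \<Rightarrow> 'c \<Rightarrow> 'd::topological_space) \<Rightarrow>
    ('w \<Rightarrow> 'b) set \<Rightarrow> ('w \<Rightarrow> 'c) set \<Rightarrow> ('w \<Rightarrow> 'd) set" where
  "lift2 M h X Y = ae_class M (\<lambda>w. h (rep X w) (rep Y w))"

definition as_le :: "'w measure \<Rightarrow> ('w \<Rightarrow> 'b::ord) set \<Rightarrow> ('w \<Rightarrow> 'b) set \<Rightarrow> bool" where
  "as_le M X Y \<longleftrightarrow> (AE w in M. rep X w \<le> rep Y w)"

text \<open>The algebra of classes of real random variables, as a record that serves both as the
  ring of scalars and as a module over itself.\<close>

definition L0 :: "'w measure \<Rightarrow> (('w \<Rightarrow> real) set, ('w \<Rightarrow> real) set) module" where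
  "L0 M = \<lparr>carrier = borel_measurable M // ae_rel M,
           mult = lift2 M (*), one = ae_class M (\<lambda>_. 1),
           zero = ae_class M (\<lambda>_. 0), add = lift2 M (+), smult = lift2 M (*)\<rparr>"

definition L0_plus :: "'w measure \<Rightarrow> ('w \<Rightarrow> real) set set" where
  "L0_plus M = {X \<in> carrier (L0 M). as_le M (zero (L0 M)) X}"

definition L0_abs :: "'w measure \<Rightarrow> ('w \<Rightarrow> real) set \<Rightarrow> ('w \<Rightarrow> real) set" where
  "L0_abs M = lift1 M abs"

text \<open>The lattice of classes of extended real random variables; suprema are those of
  \<^theory>\<open>HOL-Algebra.Lattice\<close>. The arithmetic lifted from \<^typ>\<open>ereal\<close> satisfies
  \<open>0 * (\<plusminus>\<infinity>) = 0\<close>, \<open>\<infinity> + (-\<infinity>) = \<infinity>\<close> and \<open>\<infinity> - \<infinity> = \<infinity>\<close>.\<close>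

definition Lbar :: "'w measure \<Rightarrow> ('w \<Rightarrow> ereal) set gorder" where
  "Lbar M = \<lparr>carrier = borel_measurable M // ae_rel M, eq = (=), le = as_le M\<rparr>"

abbreviation ext_class :: "'w measure \<Rightarrow> ('w \<Rightarrow> real) set \<Rightarrow> ('w \<Rightarrow> ereal) set" where
  "ext_class M \<equiv> lift1 M ereal"


section \<open>Random locally convex modules\<close>

definition L0_seminorm ::
    "'w measure \<Rightarrow> (('w \<Rightarrow> real) set, 'e, 'm) module_scheme \<Rightarrow> ('e \<Rightarrow> ('w \<Rightarrow> real) set) \<Rightarrow> bool" where
  "L0_seminorm M E p \<longleftrightarrow>
     p \<in> carrier E \<rightarrow> L0_plus M \<and>
     (\<forall>\<xi>\<in>carrier (L0 M). \<forall>x\<in>carrier E. p (\<xi> \<odot>\<^bsub>E\<^esub> x) = L0_abs M \<xi> \<otimes>\<^bsub>L0 M\<^esub> p x) \<and>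
     (\<forall>x\<in>carrier E. \<forall>y\<in>carrier E. as_le M (p (x \<oplus>\<^bsub>E\<^esub> y)) (p x \<oplus>\<^bsub>L0 M\<^esub> p y))"

definition sup_norm ::
    "'w measure \<Rightarrow> ('e \<Rightarrow> ('w \<Rightarrow> real) set) set \<Rightarrow> 'e \<Rightarrow> ('w \<Rightarrow> ereal) set" where
  "sup_norm M Q x = \<Squnion>\<^bsub>Lbar M\<^esub> ((\<lambda>p. ext_class M (p x)) ` Q)"

locale random_locally_convex_module = prob_space M + E: Module.module "L0 M" E
  for M :: "'w measure" and E :: "(('w \<Rightarrow> real) set, 'e, 'm) module_scheme" (structure) +
  fixes P :: "('e \<Rightarrow> ('w \<Rightarrow> real) set) set"
  assumes seminorm: "p \<in> P \<Longrightarrow> L0_seminorm M E p"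
    and separating: "x \<in> carrier E \<Longrightarrow> sup_norm M P x = ae_class M (\<lambda>_. 0) \<longleftrightarrow> x = \<zero>"

text \<open>For \<open>Q = {}\<close> the supremum is the class of \<open>-\<infinity>\<close>, so that the neighbourhood is the whole module.\<close>

definition el_nhd :: "'w measure \<Rightarrow> (('w \<Rightarrow> real) set, 'e, 'm) module_scheme \<Rightarrow>
    ('e \<Rightarrow> ('w \<Rightarrow> real) set) set \<Rightarrow> real \<Rightarrow> real \<Rightarrow> 'e set" where
  "el_nhd M E Q \<epsilon> l =
     {x \<in> carrier E. measure M {w \<in> space M. rep (sup_norm M Q x) w < ereal \<epsilon>} > 1 - l}"

definition el_open :: "'w measure \<Rightarrow> (('w \<Rightarrow> real) set, 'e, 'm) module_scheme \<Rightarrow>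
    ('e \<Rightarrow> ('w \<Rightarrow> real) set) set \<Rightarrow> 'e set \<Rightarrow> bool" where
  "el_open M E P U \<longleftrightarrow> U \<subseteq> carrier E \<and>
     (\<forall>x\<in>U. \<exists>Q \<epsilon> l. finite Q \<and> Q \<subseteq> P \<and> 0 < \<epsilon> \<and> 0 < l \<and> l < 1 \<and>
        (\<lambda>y. x \<oplus>\<^bsub>E\<^esub> y) ` el_nhd M E Q \<epsilon> l \<subseteq> U)"

definition el_topology :: "'w measure \<Rightarrow> (('w \<Rightarrow> real) set, 'e, 'm) module_scheme \<Rightarrow>
    ('e \<Rightarrow> ('w \<Rightarrow> real) set) set \<Rightarrow> 'e topology" where
  "el_topology M E P = topology (el_open M E P)"

abbreviation L0_topology :: "'w measure \<Rightarrow> ('w \<Rightarrow> real) set topology" where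
  "L0_topology M \<equiv> el_topology M (L0 M) {L0_abs M}"

definition el_dual :: "'w measure \<Rightarrow> (('w \<Rightarrow> real) set, 'e, 'm) module_scheme \<Rightarrow>
    ('e \<Rightarrow> ('w \<Rightarrow> real) set) set \<Rightarrow> ('e \<Rightarrow> ('w \<Rightarrow> real) set) set" where
  "el_dual M E P =
     {g \<in> carrier E \<rightarrow>\<^sub>E carrier (L0 M).
        (\<forall>x\<in>carrier E. \<forall>y\<in>carrier E. g (x \<oplus>\<^bsub>E\<^esub> y) = g x \<oplus>\<^bsub>L0 M\<^esub> g y) \<and>
        (\<forall>\<xi>\<in>carrier (L0 M). \<forall>x\<in>carrier E. g (\<xi> \<odot>\<^bsub>E\<^esub> x) = \<xi> \<otimes>\<^bsub>L0 M\<^esub> g x) \<and>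
        continuous_map (el_topology M E P) (L0_topology M) g}"


section \<open>Functions with values in the extended lattice\<close>

definition edom :: "'w measure \<Rightarrow> (('w \<Rightarrow> real) set, 'e, 'm) module_scheme \<Rightarrow>
    ('e \<Rightarrow> ('w \<Rightarrow> ereal) set) \<Rightarrow> 'e set" where
  "edom M E f = {x \<in> carrier E. AE w in M. \<bar>rep (f x) w\<bar> < \<infinity>}"

definition epi :: "'w measure \<Rightarrow> (('w \<Rightarrow> real) set, 'e, 'm) module_scheme \<Rightarrow>
    ('e \<Rightarrow> ('w \<Rightarrow> ereal) set) \<Rightarrow> ('e \<times> ('w \<Rightarrow> real) set) set" where
  "epi M E f = {(x, r) \<in> carrier E \<times> carrier (L0 M). f x \<sqsubseteq>\<^bsub>Lbar M\<^esub> ext_class M r}"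

definition proper :: "'w measure \<Rightarrow> (('w \<Rightarrow> real) set, 'e, 'm) module_scheme \<Rightarrow>
    ('e \<Rightarrow> ('w \<Rightarrow> ereal) set) \<Rightarrow> bool" where
  "proper M E f \<longleftrightarrow> edom M E f \<noteq> {} \<and> (\<forall>x\<in>carrier E. AE w in M. rep (f x) w > -\<infinity>)"

definition L0_convex :: "'w measure \<Rightarrow> (('w \<Rightarrow> real) set, 'e, 'm) module_scheme \<Rightarrow>
    ('e \<Rightarrow> ('w \<Rightarrow> ereal) set) \<Rightarrow> bool" where
  "L0_convex M E f \<longleftrightarrow>
     (\<forall>x\<in>carrier E. \<forall>y\<in>carrier E. \<forall>\<xi>\<in>L0_plus M. as_le M \<xi> \<one>\<^bsub>L0 M\<^esub> \<longrightarrow>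
        f (\<xi> \<odot>\<^bsub>E\<^esub> x \<oplus>\<^bsub>E\<^esub> (\<one>\<^bsub>L0 M\<^esub> \<ominus>\<^bsub>L0 M\<^esub> \<xi>) \<odot>\<^bsub>E\<^esub> y) \<sqsubseteq>\<^bsub>Lbar M\<^esub>
          lift2 M (+) (lift2 M (*) (ext_class M \<xi>) (f x))
                      (lift2 M (*) (ext_class M (\<one>\<^bsub>L0 M\<^esub> \<ominus>\<^bsub>L0 M\<^esub> \<xi>)) (f y)))"

definition el_lsc :: "'w measure \<Rightarrow> (('w \<Rightarrow> real) set, 'e, 'm) module_scheme \<Rightarrow>
    ('e \<Rightarrow> ('w \<Rightarrow> real) set) set \<Rightarrow> ('e \<Rightarrow> ('w \<Rightarrow> ereal) set) \<Rightarrow> bool" where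
  "el_lsc M E P f \<longleftrightarrow> closedin (prod_topology (el_topology M E P) (L0_topology M)) (epi M E f)"

definition conjugate :: "'w measure \<Rightarrow> (('w \<Rightarrow> real) set, 'e, 'm) module_scheme \<Rightarrow>
    ('e \<Rightarrow> ('w \<Rightarrow> ereal) set) \<Rightarrow> ('e \<Rightarrow> ('w \<Rightarrow> real) set) \<Rightarrow> ('w \<Rightarrow> ereal) set" where
  "conjugate M E f g = \<Squnion>\<^bsub>Lbar M\<^esub> ((\<lambda>x. lift2 M (-) (ext_class M (g x)) (f x)) ` carrier E)"

definition biconjugate :: "'w measure \<Rightarrow> (('w \<Rightarrow> real) set, 'e, 'm) module_scheme \<Rightarrow>
    ('e \<Rightarrow> ('w \<Rightarrow> real) set) set \<Rightarrow> ('e \<Rightarrow> ('w \<Rightarrow> ereal) set) \<Rightarrow> 'e \<Rightarrow> ('w \<Rightarrow> ereal) set" where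
  "biconjugate M E P f x =
     \<Squnion>\<^bsub>Lbar M\<^esub> ((\<lambda>g. lift2 M (-) (ext_class M (g x)) (conjugate M E f g)) ` el_dual M E P)"


section \<open>Basic facts\<close>

lemma ae_rel_equiv: "equiv (borel_measurable M) (ae_rel M)"
proof (rule equivI)
  show "ae_rel M \<subseteq> borel_measurable M \<times> borel_measurable M"
    by (auto simp: ae_rel_def)
  show "refl_on (borel_measurable M) (ae_rel M)"
    by (auto simp: ae_rel_def refl_on_def)
  show "sym (ae_rel M)"
    by (auto simp: ae_rel_def sym_def elim: AE_mp)
  show "trans (ae_rel M)"
    by (auto simp: ae_rel_def trans_def)
qed

lemma ae_class_eq_iff:
  assumes "f \<in> borel_measurable M" "g \<in> borel_measurable M"
  shows "ae_class M f = ae_class M g \<longleftrightarrow> (AE w in M. f w = g w)"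
  using eq_equiv_class_iff[OF ae_rel_equiv, of f M g] assms
  by (auto simp: ae_class_def ae_rel_def)

lemma ae_class_carrier:
  "f \<in> borel_measurable M \<Longrightarrow> ae_class M f \<in> borel_measurable M // ae_rel M"
  unfolding ae_class_def by (rule quotientI)

lemma rep_in_class:
  assumes "X \<in> borel_measurable M // ae_rel M"
  shows "rep X \<in> X" "rep X \<in> borel_measurable M" "ae_class M (rep X) = X"
proof -
  have "X \<noteq> {}"
    using assms in_quotient_imp_non_empty[OF ae_rel_equiv] by auto
  then show 1: "rep X \<in> X"
    unfolding rep_def by (simp add: some_in_eq)
  then show "rep X \<in> borel_measurable M"
    using in_quotient_imp_subset[OF ae_rel_equiv assms] by auto
  show "ae_class M (rep X) = X"
    using assms 1 unfolding ae_class_def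
    by (metis Image_singleton_iff ae_rel_equiv equiv_class_eq quotientE)
qed

lemma rep_ae_class:
  assumes "f \<in> borel_measurable M"
  shows "AE w in M. rep (ae_class M f) w = f w"
proof -
  have "rep (ae_class M f) \<in> ae_class M f"
    using rep_in_class(1)[OF ae_class_carrier[OF assms]] .
  then have "AE w in M. f w = rep (ae_class M f) w"
    by (auto simp: ae_class_def ae_rel_def)
  then show ?thesis by (auto elim: AE_mp)
qed

lemma lift1_ae_class:
  assumes "f \<in> borel_measurable M" "(\<lambda>w. h (f w)) \<in> borel_measurable M"
    and "(\<lambda>w. h (rep (ae_class M f) w)) \<in> borel_measurable M"
  shows "lift1 M h (ae_class M f) = ae_class M (\<lambda>w. h (f w))"
  unfolding lift1_def using rep_ae_class[OF assms(1)]
  by (subst ae_class_eq_iff) (auto simp: assms)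

lemma lift2_ae_class:
  assumes "f \<in> borel_measurable M" "g \<in> borel_measurable M"
    and "(\<lambda>w. h (f w) (g w)) \<in> borel_measurable M"
    and "(\<lambda>w. h (rep (ae_class M f) w) (rep (ae_class M g) w)) \<in> borel_measurable M"
  shows "lift2 M h (ae_class M f) (ae_class M g) = ae_class M (\<lambda>w. h (f w) (g w))"
  unfolding lift2_def using rep_ae_class[OF assms(1)] rep_ae_class[OF assms(2)]
  by (subst ae_class_eq_iff) (auto simp: assms)

lemma as_le_ae_class:
  assumes "f \<in> borel_measurable M" "g \<in> borel_measurable M"
  shows "as_le M (ae_class M f) (ae_class M g) \<longleftrightarrow> (AE w in M. f w \<le> g w)"
  unfolding as_le_def using rep_ae_class[OF assms(1)] rep_ae_class[OF assms(2)]
  by (intro iffI; elim AE_mp) auto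

lemma L0_simps [simp]:
  "carrier (L0 M) = borel_measurable M // ae_rel M"
  "mult (L0 M) = lift2 M (*)" "smult (L0 M) = lift2 M (*)" "add (L0 M) = lift2 M (+)"
  "one (L0 M) = ae_class M (\<lambda>_. 1)" "zero (L0 M) = ae_class M (\<lambda>_. 0)"
  by (simp_all add: L0_def)

lemma Lbar_simps [simp]:
  "carrier (Lbar M) = borel_measurable M // ae_rel M" "le (Lbar M) = as_le M" "eq (Lbar M) = (=)"
  by (simp_all add: Lbar_def)

lemma Lbar_partial_order: "partial_order (Lbar M)"
proof
  fix X Y assume "X \<sqsubseteq>\<^bsub>Lbar M\<^esub> Y" "Y \<sqsubseteq>\<^bsub>Lbar M\<^esub> X"
    and XY: "X \<in> carrier (Lbar M)" "Y \<in> carrier (Lbar M)"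
  then have "AE w in M. rep X w = rep Y w"
    by (auto simp: as_le_def elim!: AE_mp)
  then have "ae_class M (rep X) = ae_class M (rep Y)"
    using rep_in_class[of X M] rep_in_class[of Y M] XY by (subst ae_class_eq_iff) auto
  then show "X .=\<^bsub>Lbar M\<^esub> Y"
    using rep_in_class[of X M] rep_in_class[of Y M] XY by auto
qed (auto simp: as_le_def elim!: AE_mp)

lemma Lbar_sup_finite:
  assumes fin: "finite A" and A: "A \<subseteq> carrier (Lbar M)"
  shows "\<Squnion>\<^bsub>Lbar M\<^esub> A = ae_class M (\<lambda>w. SUP X\<in>A. rep X w)"
proof -
  interpret partial_order "Lbar M" by (rule Lbar_partial_order)
  let ?s = "\<lambda>w. SUP X\<in>A. rep X w"
  have [measurable]: "rep X \<in> borel_measurable M" if "X \<in> A" for X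
    using rep_in_class[of X M] that A by auto
  have s: "?s \<in> borel_measurable M"
    using fin by (intro borel_measurable_SUP) (auto intro: countable_finite)
  have r: "AE w in M. rep (ae_class M ?s) w = ?s w" by (rule rep_ae_class[OF s])
  have "least (Lbar M) (ae_class M ?s) (Upper (Lbar M) A)"
    unfolding least_def
  proof (intro conjI ballI)
    show "ae_class M ?s \<in> Upper (Lbar M) A"
      using r by (auto simp: Upper_def as_le_def ae_class_carrier s elim!: AE_mp intro!: SUP_upper)
    fix Y assume Y: "Y \<in> Upper (Lbar M) A"
    then have "\<forall>X\<in>A. AE w in M. rep X w \<le> rep Y w"
      using A by (auto simp: Upper_def as_le_def)
    then have "AE w in M. \<forall>X\<in>A. rep X w \<le> rep Y w"
      by (simp add: AE_finite_all[OF fin])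
    with r have "AE w in M. rep (ae_class M ?s) w \<le> rep Y w"
      by eventually_elim (auto intro!: SUP_least)
    then show "ae_class M ?s \<sqsubseteq>\<^bsub>Lbar M\<^esub> Y"
      by (simp add: as_le_def)
  qed (auto simp: Upper_def)
  then show ?thesis
    unfolding sup_def by (metis (no_types, lifting) least_unique someI_ex)
qed

lemma el_open_istopology:
  assumes P: "\<And>p. p \<in> P \<Longrightarrow> p \<in> carrier E \<rightarrow> carrier (L0 M)" and "prob_space M"
  shows "istopology (el_open M E P)"
proof -
  interpret prob_space M by fact
  have mono: "el_nhd M E Q' \<epsilon>' l' \<subseteq> el_nhd M E Q \<epsilon> l"
    if "finite Q'" "Q \<subseteq> Q'" "Q' \<subseteq> P" "\<epsilon>' \<le> \<epsilon>" "l' \<le> l" for Q Q' \<epsilon> \<epsilon>' l l'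
  proof
    fix x assume x: "x \<in> el_nhd M E Q' \<epsilon>' l'"
    then have xE: "x \<in> carrier E" by (simp add: el_nhd_def)
    let ?A = "\<lambda>Q. (\<lambda>p. ext_class M (p x)) ` Q"
    let ?s = "\<lambda>Q w. SUP X\<in>?A Q. rep X w"
    have c: "?A Q' \<subseteq> carrier (Lbar M)"
    proof safe
      fix p assume "p \<in> Q'"
      then have "rep (p x) \<in> borel_measurable M"
        using P xE that by (intro rep_in_class(2)) auto
      then show "ext_class M (p x) \<in> carrier (Lbar M)"
        by (simp add: lift1_def ae_class_carrier)
    qed
    have rm: "rep X \<in> borel_measurable M" if "X \<in> ?A Q'" for X
      using rep_in_class(2)[of X M] that c by auto
    have fin: "finite Q" using that finite_subset by blast
    have sm: "?s Q' \<in> borel_measurable M" "?s Q \<in> borel_measurable M"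
      using that fin by (auto intro!: borel_measurable_SUP rm intro: countable_finite)
    have n': "sup_norm M Q' x = ae_class M (?s Q')"
      unfolding sup_norm_def using that c by (intro Lbar_sup_finite) auto
    have n: "sup_norm M Q x = ae_class M (?s Q)"
      unfolding sup_norm_def using that c fin by (intro Lbar_sup_finite) auto
    have le: "?s Q w \<le> ?s Q' w" for w
      using that by (intro SUP_subset_mono) auto
    have rn: "rep (sup_norm M Q x) \<in> borel_measurable M" 
      unfolding n by (intro rep_in_class(2) ae_class_carrier sm)
    have "measure M {w \<in> space M. rep (sup_norm M Q' x) w < ereal \<epsilon>'}
        \<le> measure M {w \<in> space M. rep (sup_norm M Q x) w < ereal \<epsilon>}"
    proof (rule finite_measure_mono_AE)
      have *: "u < ereal \<epsilon>" if "u \<le> v" "v < ereal \<epsilon>'" for u v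
        using that \<open>\<epsilon>' \<le> \<epsilon>\<close> by (meson ereal_less_eq(3) le_less_trans less_le_trans)
      show "AE w in M. w \<in> {w \<in> space M. rep (sup_norm M Q' x) w < ereal \<epsilon>'} \<longrightarrow>
         w \<in> {w \<in> space M. rep (sup_norm M Q x) w < ereal \<epsilon>}"
        using rep_ae_class[OF sm(1)] rep_ae_class[OF sm(2)] unfolding n n'
        by eventually_elim (use le * in auto)
      show "{w \<in> space M. rep (sup_norm M Q x) w < ereal \<epsilon>} \<in> events"
        using rn by measurable
    qed
    with x that show "x \<in> el_nhd M E Q \<epsilon> l"
      by (auto simp: el_nhd_def)
  qed
  show ?thesis
    unfolding istopology_def
  proof (intro conjI allI impI)
    fix S T assume ST: "el_open M E P S" "el_open M E P T"
    show "el_open M E P (S \<inter> T)"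
      unfolding el_open_def
    proof (intro conjI ballI)
      show "S \<inter> T \<subseteq> carrier E" using ST by (auto simp: el_open_def)
      fix x assume "x \<in> S \<inter> T"
      then obtain Q1 e1 l1 Q2 e2 l2 where
        1: "finite Q1" "Q1 \<subseteq> P" "0 < e1" "0 < l1" "l1 < 1"
          "(\<lambda>y. x \<oplus>\<^bsub>E\<^esub> y) ` el_nhd M E Q1 e1 l1 \<subseteq> S" and
        2: "finite Q2" "Q2 \<subseteq> P" "0 < e2" "0 < l2" "l2 < 1"
          "(\<lambda>y. x \<oplus>\<^bsub>E\<^esub> y) ` el_nhd M E Q2 e2 l2 \<subseteq> T"
        using ST unfolding el_open_def by (metis IntD1 IntD2)
      have "el_nhd M E (Q1 \<union> Q2) (min e1 e2) (min l1 l2) \<subseteq> el_nhd M E Q1 e1 l1"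
           "el_nhd M E (Q1 \<union> Q2) (min e1 e2) (min l1 l2) \<subseteq> el_nhd M E Q2 e2 l2"
        using 1 2 by - (rule mono; simp)+
      then have "(\<lambda>y. x \<oplus>\<^bsub>E\<^esub> y) ` el_nhd M E (Q1 \<union> Q2) (min e1 e2) (min l1 l2) \<subseteq> S \<inter> T"
        using 1(6) 2(6) by blast
      moreover have "finite (Q1 \<union> Q2)" "Q1 \<union> Q2 \<subseteq> P" "0 < min e1 e2" "0 < min l1 l2" "min l1 l2 < 1"
        using 1 2 by auto
      ultimately show "\<exists>Q \<epsilon> l. finite Q \<and> Q \<subseteq> P \<and> 0 < \<epsilon> \<and> 0 < l \<and> l < 1 \<and>
          (\<lambda>y. x \<oplus>\<^bsub>E\<^esub> y) ` el_nhd M E Q \<epsilon> l \<subseteq> S \<inter> T"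
        by blast
    qed
  next
    fix K assume K: "\<forall>S\<in>K. el_open M E P S"
    show "el_open M E P (\<Union>K)"
      unfolding el_open_def
    proof (intro conjI ballI)
      show "\<Union>K \<subseteq> carrier E" using K by (auto simp: el_open_def)
      fix x assume "x \<in> \<Union>K"
      then obtain S where S: "S \<in> K" "x \<in> S" by auto
      then obtain Q e l where "finite Q \<and> Q \<subseteq> P \<and> 0 < e \<and> 0 < l \<and> l < 1 \<and>
          (\<lambda>y. x \<oplus>\<^bsub>E\<^esub> y) ` el_nhd M E Q e l \<subseteq> S"
        using K unfolding el_open_def by metis
      with S show "\<exists>Q \<epsilon> l. finite Q \<and> Q \<subseteq> P \<and> 0 < \<epsilon> \<and> 0 < l \<and> l < 1 \<and>
          (\<lambda>y. x \<oplus>\<^bsub>E\<^esub> y) ` el_nhd M E Q \<epsilon> l \<subseteq> \<Union>K"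
        by (intro exI[of _ Q] exI[of _ e] exI[of _ l]) auto
    qed
  qed
qed

lemma (in random_locally_convex_module) openin_el_topology:
  "openin (el_topology M E P) = el_open M E P"
proof -
  have "p \<in> carrier E \<rightarrow> carrier (L0 M)" if "p \<in> P" for p
    using seminorm[OF that] by (auto simp: L0_seminorm_def L0_plus_def)
  then show ?thesis
    unfolding el_topology_def
    by (intro topology_inverse' el_open_istopology prob_space_axioms)
qed

lemma L0_random_locally_convex_module:
  assumes "prob_space M"
  shows "random_locally_convex_module M (L0 M) {L0_abs M}"
proof -
  interpret prob_space M by fact
  have cases: "\<exists>f. f \<in> borel_measurable M \<and> X = ae_class M f"
    if "X \<in> borel_measurable M // ae_rel M" for X :: "('a \<Rightarrow> real) set"
    using rep_in_class[OF that] by metis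
  note [measurable] = rep_in_class(2)[OF ae_class_carrier]
  note l = lift2_ae_class lift1_ae_class ae_class_carrier as_le_ae_class
  have cr: "cring (L0 M)"
  proof (rule cringI)
    show "abelian_group (L0 M)"
    proof (rule abelian_groupI)
      fix X assume "X \<in> carrier (L0 M)"
      then obtain f where "f \<in> borel_measurable M" "X = ae_class M f" using cases by auto
      then show "\<exists>Y\<in>carrier (L0 M). Y \<oplus>\<^bsub>L0 M\<^esub> X = \<zero>\<^bsub>L0 M\<^esub>"
        by (intro bexI[of _ "ae_class M (\<lambda>w. - f w)"]) (auto simp: l)
    qed (auto dest!: cases simp: l add_ac)
    show "Group.comm_monoid (L0 M)"
      by (rule comm_monoidI) (auto dest!: cases simp: l mult_ac)
  qed (auto dest!: cases simp: l algebra_simps)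
  have md: "Module.module (L0 M) (L0 M)"
    using cr by (intro moduleI) (auto dest!: cases simp: l algebra_simps cring_def ring_def)
  have sn: "L0_seminorm M (L0 M) (L0_abs M)"
    unfolding L0_seminorm_def L0_plus_def L0_abs_def
    by (auto dest!: cases simp: l abs_mult)
  show ?thesis
  proof (intro random_locally_convex_module.intro random_locally_convex_module_axioms.intro assms md)
    fix X assume "X \<in> carrier (L0 M)"
    then obtain f where f [measurable]: "f \<in> borel_measurable M" and X: "X = ae_class M f"
      using cases by auto
    have e: "ext_class M (L0_abs M X) = ae_class M (\<lambda>w. ereal \<bar>f w\<bar>)"
      by (simp add: X L0_abs_def l)
    have "sup_norm M {L0_abs M} X = ae_class M (\<lambda>w. ereal \<bar>f w\<bar>)"
      unfolding sup_norm_def e using rep_in_class(3)[OF ae_class_carrier, of "\<lambda>w. ereal \<bar>f w\<bar>" M]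
      by (simp add: Lbar_sup_finite ae_class_carrier e)
    then show "sup_norm M {L0_abs M} X = ae_class M (\<lambda>_. 0) \<longleftrightarrow> X = \<zero>\<^bsub>L0 M\<^esub>"
      by (simp add: X ae_class_eq_iff zero_ereal_def)
  qed (use sn in auto)
qed

end

theory Submission
  imports Defs
begin

text \<open>It suffices to contradict \<open>f\<^sup>*\<^sup>* x\<^sub>0 < q < f x\<^sub>0\<close> on an event \<open>A\<close> of positive probability, for a
  constant \<open>q\<close>. Closedness of the epigraph and the possibility of gluing its points along events show
  that for some finite \<open>Q \<subseteq> P\<close> the random distance \<open>d\<close> from \<open>(x\<^sub>0, q)\<close> to the epigraph with respect to
  \<open>\<parallel>\<cdot>\<parallel>\<^sub>Q\<close> is positive on a part of \<open>A\<close>. A Hahn--Banach theorem with values in random variables then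
  yields a \<open>\<parallel>\<cdot>\<parallel>\<^sub>Q\<close>-bounded homomorphism \<open>(x, r) \<mapsto> g x + s r\<close>, \<open>s \<le> 0\<close>, separating \<open>(x\<^sub>0, q)\<close> from the
  epigraph with gap \<open>d\<close>. Where \<open>s < 0\<close>, the affine minorant with slope \<open>- g / s\<close> exceeds \<open>q\<close> at \<open>x\<^sub>0\<close>.
  Where \<open>s = 0\<close>, one first separates a point below the graph over the domain of \<open>f\<close>, which gives an
  affine minorant \<open>h - c\<close>; the minorants with slopes \<open>h + n g\<close> then tend to infinity at \<open>x\<^sub>0\<close>.\<close>

section \<open>Essential infima\<close>

text \<open>A random scalar may vanish on one event and be invertible on another. Hence a step that
  classically divides by a real number is carried out on the event where the division makes sense
  and patched elsewhere, with indicators as scalars. Indicators are also admissible weights in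
  \<open>L0_convex\<close>, which is what lets points of the epigraph be patched together. A second
  obstacle is that every relation holds only off a null set depending on its arguments, so
  uncountable families are reduced to sequences, through essential infima, before values are
  compared pointwise. The contradiction is local for the same reason: the gap \<open>d\<close> is
  positive only on a part of \<open>A\<close>, and a second separation shrinks the event once more.
  This does no harm, because the biconjugate is a supremum in the lattice: an affine function that
  minorizes on an event bounds it from below on that event.\<close>

lemma (in finite_measure) countable_essential_union:
  assumes "\<A> \<subseteq> sets M"
  obtains \<C> where "countable \<C>" "\<C> \<subseteq> \<A>" "\<And>A. A \<in> \<A> \<Longrightarrow> A - \<Union>\<C> \<in> null_sets M"
proof -
  \<comment> \<open>Exhaustion: the union of near-optimal countable families attains the supremum
    \<open>s\<close> of the measures, so adjoining one more member of \<open>\<A>\<close> cannot add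
    measure.\<close>
  define K where "K = {\<C>. countable \<C> \<and> \<C> \<subseteq> \<A>}"
  define s where "s = (SUP \<C>\<in>K. measure M (\<Union>\<C>))"
  have bdd: "bdd_above ((\<lambda>\<C>. measure M (\<Union>\<C>)) ` K)"
    by (intro bdd_aboveI2[of _ _ "measure M (space M)"] bounded_measure)
  have le_s: "measure M (\<Union>\<C>) \<le> s" if "\<C> \<in> K" for \<C>
    unfolding s_def by (rule cSUP_upper[OF that bdd])
  have "{} \<in> K" by (simp add: K_def)
  have "\<exists>\<C>\<in>K. s - 1 / real (Suc n) < measure M (\<Union>\<C>)" for n
    using less_cSUP_iff[THEN iffD1, OF _ bdd, of "s - 1 / real (Suc n)"] \<open>{} \<in> K\<close>
    by (auto simp flip: s_def)
  then obtain D where D: "\<And>n. D n \<in> K" "\<And>n. s - 1 / real (Suc n) < measure M (\<Union>(D n))"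
    by metis
  define \<C> where "\<C> = (\<Union>n. D n)"
  have \<C>: "\<C> \<in> K" using D(1) by (auto simp: \<C>_def K_def)
  have K_sets: "\<Union>\<D> \<in> sets M" if "\<D> \<in> K" for \<D>
    using that assms by (auto simp: K_def intro!: sets.countable_Union)
  have "s - 1 / real (Suc n) < measure M (\<Union>\<C>)" for n
    using D(2)[of n] finite_measure_mono[of "\<Union>(D n)" "\<Union>\<C>"] K_sets[OF \<C>]
    by (force simp: \<C>_def)
  then have "s \<le> measure M (\<Union>\<C>)"
    using LIMSEQ_le_const2[OF tendsto_diff[OF tendsto_const LIMSEQ_Suc[OF lim_1_over_n]]]
    by (metis diff_zero less_imp_le)
  show ?thesis
  proof
    show "countable \<C>" "\<C> \<subseteq> \<A>" using \<C> by (auto simp: K_def)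
    fix A assume A: "A \<in> \<A>"
    have I: "insert A \<C> \<in> K" using \<C> A by (auto simp: K_def)
    have "measure M (\<Union>(insert A \<C>)) = measure M (\<Union>\<C>) + measure M (A - \<Union>\<C>)"
      using finite_measure_Union[of "\<Union>\<C>" "A - \<Union>\<C>"] K_sets[OF \<C>] A assms
      by (auto simp: Un_commute)
    then have "measure M (A - \<Union>\<C>) = 0"
      using le_s[OF I] \<open>s \<le> measure M (\<Union>\<C>)\<close> measure_nonneg[of M "A - \<Union>\<C>"] by linarith
    then show "A - \<Union>\<C> \<in> null_sets M"
      using K_sets[OF \<C>] A assms by (auto simp: null_sets_def emeasure_eq_measure)
  qed
qed

text \<open>For each rational level the superlevel sets are exhausted by countably many of them, and
  for a fixed \<open>f\<close> the countably many levels share one null set. The supremum over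
  \<open>\<C>\<close> is measurable, whereas the pointwise supremum over \<open>\<F>\<close> need
  not be.\<close>

lemma (in finite_measure) countable_essential_sup:
  fixes \<F> :: "('a \<Rightarrow> ereal) set"
  assumes "\<F> \<subseteq> borel_measurable M"
  obtains \<C> where "countable \<C>" "\<C> \<subseteq> \<F>" "\<And>f. f \<in> \<F> \<Longrightarrow> AE w in M. f w \<le> (SUP c\<in>\<C>. c w)"
proof -
  have "\<forall>q. \<exists>\<C>. countable \<C> \<and> \<C> \<subseteq> \<F> \<and>
      (\<forall>f\<in>\<F>. AE w in M. f w > ereal (of_rat q) \<longrightarrow> (\<exists>c\<in>\<C>. c w > ereal (of_rat q)))"
  proof
    fix q :: rat
    define S where "S f = {w\<in>space M. f w > ereal (of_rat q)}" for f :: "'a \<Rightarrow> ereal"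
    have S: "S f \<in> sets M" if "f \<in> \<F>" for f
    proof -
      have [measurable]: "f \<in> borel_measurable M" using that assms by auto
      show ?thesis unfolding S_def by measurable
    qed
    then obtain \<D> where D: "countable \<D>" "\<D> \<subseteq> S ` \<F>" "\<And>A. A \<in> S ` \<F> \<Longrightarrow> A - \<Union>\<D> \<in> null_sets M"
      using countable_essential_union[of "S ` \<F>"] by blast
    then obtain \<C> where C: "countable \<C>" "\<C> \<subseteq> \<F>" "\<D> = S ` \<C>"
      using iffD1[OF countable_subset_image conjI, OF D(1,2)] by blast
    have "AE w in M. f w > ereal (of_rat q) \<longrightarrow> (\<exists>c\<in>\<C>. c w > ereal (of_rat q))" if "f \<in> \<F>" for f
    proof (rule AE_I')
      show "S f - \<Union>\<D> \<in> null_sets M" using D that by auto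
    qed (auto simp: C S_def)
    with C show "\<exists>\<C>. countable \<C> \<and> \<C> \<subseteq> \<F> \<and>
      (\<forall>f\<in>\<F>. AE w in M. f w > ereal (of_rat q) \<longrightarrow> (\<exists>c\<in>\<C>. c w > ereal (of_rat q)))"
      by blast
  qed
  from choice[OF this] obtain \<C> where "\<forall>q. countable (\<C> q) \<and> \<C> q \<subseteq> \<F> \<and>
    (\<forall>f\<in>\<F>. AE w in M. f w > ereal (of_rat q) \<longrightarrow> (\<exists>c\<in>\<C> q. c w > ereal (of_rat q)))"
    by (rule exE)
  then have C: "\<And>q. countable (\<C> q)" "\<And>q. \<C> q \<subseteq> \<F>"
    "\<And>q f. f \<in> \<F> \<Longrightarrow> AE w in M. f w > ereal (of_rat q) \<longrightarrow> (\<exists>c\<in>\<C> q. c w > ereal (of_rat q))"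
    by simp_all
  show ?thesis
  proof
    show "countable (\<Union>q. \<C> q)" "(\<Union>q. \<C> q) \<subseteq> \<F>" using C by auto
    fix f assume "f \<in> \<F>"
    then have "AE w in M. \<forall>q. f w > ereal (of_rat q) \<longrightarrow> (\<exists>c\<in>\<C> q. c w > ereal (of_rat q))"
      using C(3) by (simp add: AE_all_countable)
    then show "AE w in M. f w \<le> (SUP c\<in>\<Union>q. \<C> q. c w)"
    proof eventually_elim
      case (elim w)
      show ?case
      proof (rule ccontr)
        assume "\<not> ?thesis"
        then obtain r where r: "(SUP c\<in>\<Union>q. \<C> q. c w) < ereal r" "ereal r < f w"
          using ereal_dense2[of "SUP c\<in>\<Union>q. \<C> q. c w" "f w"] by (auto simp: not_le)
        \<comment> \<open>Two reals are inserted because the density of the rationals is applied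
          between reals, while the outer bounds may be infinite.\<close>
        then obtain r' where r': "ereal r < ereal r'" "ereal r' < f w"
          using ereal_dense2[OF r(2)] by blast
        then obtain q where q: "r < of_rat q" "of_rat q < r'"
          using of_rat_dense[of r r'] by auto
        then have "f w > ereal (of_rat q)"
          using r'(2) less_trans[of "ereal (of_rat q)" "ereal r'"] by simp
        with elim obtain c where "c \<in> \<C> q" "c w > ereal (of_rat q)" by blast
        then have "ereal (of_rat q) < (SUP c\<in>\<Union>q. \<C> q. c w)"
          by (auto simp: less_SUP_iff)
        then have "ereal (of_rat q) < ereal r" using r(1) by (rule order_less_trans)
        with q show False by simp
      qed
    qed
  qed
qed

text \<open>The infimum is minus the essential supremum of the negatives, and the common lower bound
  \<open>l\<close> keeps it real. Since \<open>S\<close> is not assumed to be directed, the index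
  \<open>n\<close> of an approximating member depends on the point \<open>w\<close>. This
  approximation is what later identifies \<open>m\<close> as the greatest lower bound.\<close>

lemma (in finite_measure) essential_inf:
  fixes S :: "('a \<Rightarrow> real) set"
  assumes S: "S \<subseteq> borel_measurable M" "S \<noteq> {}"
    and l: "\<And>u. u \<in> S \<Longrightarrow> AE w in M. l w \<le> u w"
  obtains m U where "m \<in> borel_measurable M" "\<And>u. u \<in> S \<Longrightarrow> AE w in M. m w \<le> u w"
    "\<And>n. U n \<in> S" "AE w in M. \<forall>e>0. \<exists>n::nat. U n w < m w + e"
proof -
  define T where "T = (\<lambda>u w. - ereal (u w)) ` S"
  have "T \<subseteq> borel_measurable M" using S by (auto simp: T_def)
  then obtain \<C> where C: "countable \<C>" "\<C> \<subseteq> T" "\<And>f. f \<in> T \<Longrightarrow> AE w in M. f w \<le> (SUP c\<in>\<C>. c w)"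
    using countable_essential_sup[of T] by blast
  then obtain S' where S': "countable S'" "S' \<subseteq> S" "\<C> = (\<lambda>u w. - ereal (u w)) ` S'"
    using countable_subset_image[of \<C> "\<lambda>u w. - ereal (u w)" S] unfolding T_def by metis
  obtain u0 where u0: "u0 \<in> S" using S by auto
  \<comment> \<open>Inserting \<open>u0\<close> makes the enumerated set nonempty, so that it is
    exactly the range of \<open>U\<close>.\<close>
  define U where "U = from_nat_into (insert u0 S')"
  have range_U: "range U = insert u0 S'"
    unfolding U_def using S'(1) by (intro range_from_nat_into) auto
  have U: "U n \<in> S" for n using range_U S'(2) u0 by auto
  have [measurable]: "U n \<in> borel_measurable M" for n using U S by auto
  have bdd: "AE w in M. bdd_below (range (\<lambda>n. U n w))"
  proof -
    have "AE w in M. \<forall>n. l w \<le> U n w" using l U by (simp add: AE_all_countable)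
    then show ?thesis by eventually_elim auto
  qed
  define m where "m w = real_of_ereal (INF n. ereal (U n w))" for w
  have m: "AE w in M. (INF n. ereal (U n w)) = ereal (m w)"
    using bdd
  proof eventually_elim
    case (elim w)
    then have *: "ereal (INF n. U n w) = (INF n. ereal (U n w))"
      using ereal_Inf'[of "range (\<lambda>n. U n w)"] by (simp add: image_image)
    then show ?case by (simp add: m_def flip: *)
  qed
  show ?thesis
  proof
    show "m \<in> borel_measurable M" unfolding m_def by measurable
    fix u assume u: "u \<in> S"
    then have "AE w in M. - ereal (u w) \<le> (SUP c\<in>\<C>. c w)"
      using C(3) by (auto simp: T_def)
    then show "AE w in M. m w \<le> u w"
      using m
    proof eventually_elim
      case (elim w)
      have "(SUP c\<in>\<C>. c w) = - (INF v\<in>S'. ereal (v w))"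
        unfolding S'(3) image_image by (rule ereal_SUP_uminus_eq)
      also have "\<dots> \<le> - (INF v\<in>insert u0 S'. ereal (v w))"
        by (simp add: INF_superset_mono subset_insertI)
      also have "(INF v\<in>insert u0 S'. ereal (v w)) = ereal (m w)"
        using elim(2) by (simp flip: range_U add: image_image)
      finally have "- ereal (u w) \<le> - ereal (m w)" using elim(1) by (rule order_trans[rotated])
      then show ?case by simp
    qed
  next
    show "AE w in M. \<forall>e>0. \<exists>n::nat. U n w < m w + e"
      using m
    proof eventually_elim
      case (elim w)
      show ?case
      proof (intro allI impI)
        fix e :: real assume "e > 0"
        then have "(INF n. ereal (U n w)) < ereal (m w + e)" by (simp add: elim)
        then show "\<exists>n. U n w < m w + e" by (auto simp: INF_less_iff)
      qed
    qed
  qed (rule U)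
qed

lemma (in finite_measure) essential_inf_greatest:
  assumes U: "\<And>n::nat. AE w in M. l w \<le> U n w" and m: "AE w in M. \<forall>e>0. \<exists>n. U n w < m w + (e::real)"
  shows "AE w in M. l w \<le> m w"
proof -
  have "AE w in M. \<forall>n. l w \<le> U n w" using U by (simp add: AE_all_countable)
  then show ?thesis using m
  proof eventually_elim
    case (elim w)
    show ?case
      by (rule field_le_epsilon) (metis elim le_less_trans less_imp_le)
  qed
qed

section \<open>Modules over the ring of random variables\<close>

text \<open>Scalars are functions rather than classes, so that inverses, indicators and positive
  parts of scalars are computed pointwise and identities between scalars are plain equations. Only
  relations between values of functionals are stated almost everywhere.\<close>

definition rv_ring :: "'w measure \<Rightarrow> ('w \<Rightarrow> real) ring" where
  "rv_ring M = \<lparr>carrier = borel_measurable M, mult = \<lambda>u v w. u w * v w, one = \<lambda>_. 1,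
     zero = \<lambda>_. 0, add = \<lambda>u v w. u w + v w\<rparr>"

lemma rv_ring_simps [simp]:
  "carrier (rv_ring M) = borel_measurable M" "mult (rv_ring M) = (\<lambda>u v w. u w * v w)"
  "one (rv_ring M) = (\<lambda>_. 1)" "zero (rv_ring M) = (\<lambda>_. 0)" "add (rv_ring M) = (\<lambda>u v w. u w + v w)"
  by (simp_all add: rv_ring_def)

lemma cring_rv_ring: "cring (rv_ring M)"
proof (rule cringI)
  show "abelian_group (rv_ring M)"
  proof (rule abelian_groupI)
    fix u assume "u \<in> carrier (rv_ring M)"
    then show "\<exists>v\<in>carrier (rv_ring M). v \<oplus>\<^bsub>rv_ring M\<^esub> u = \<zero>\<^bsub>rv_ring M\<^esub>"
      by (intro bexI[of _ "\<lambda>w. - u w"]) auto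
  qed (auto simp: add_ac)
  show "Group.comm_monoid (rv_ring M)"
    by (rule comm_monoidI) (auto simp: mult_ac)
qed (auto simp: algebra_simps)

locale rv_module = prob_space M + Module.module "rv_ring M" V
  for M :: "'w measure" and V :: "(('w \<Rightarrow> real), 'v, 'k) module_scheme" (structure)
begin

lemma smult_in_carrier [simp, intro]:
  "u \<in> borel_measurable M \<Longrightarrow> x \<in> carrier V \<Longrightarrow> u \<odot> x \<in> carrier V"
  using smult_closed by simp

lemma smult_smult:
  assumes "u \<in> borel_measurable M" "v \<in> borel_measurable M" "x \<in> carrier V"
  shows "u \<odot> (v \<odot> x) = (\<lambda>w. u w * v w) \<odot> x"
  using smult_assoc1[of u v x] assms by simp

lemma smult_add_left:
  assumes "u \<in> borel_measurable M" "v \<in> borel_measurable M" "x \<in> carrier V"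
  shows "u \<odot> x \<oplus> v \<odot> x = (\<lambda>w. u w + v w) \<odot> x"
  using smult_l_distr[of u v x] assms by simp

lemma smult_add_right:
  assumes "u \<in> borel_measurable M" "x \<in> carrier V" "y \<in> carrier V"
  shows "u \<odot> (x \<oplus> y) = u \<odot> x \<oplus> u \<odot> y"
  using smult_r_distr[of u x y] assms by simp

lemma zero_smult [simp]: "x \<in> carrier V \<Longrightarrow> (\<lambda>_. 0) \<odot> x = \<zero>"
  using smult_l_null[of x] by simp

lemma one_smult [simp]: "x \<in> carrier V \<Longrightarrow> (\<lambda>_. 1) \<odot> x = x"
  using smult_one[of x] by simp

lemma smult_zero [simp]: "u \<in> borel_measurable M \<Longrightarrow> u \<odot> \<zero> = \<zero>"
  using smult_r_null[of u] by simp

lemma add_neg_smult [simp]: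
  assumes "x \<in> carrier V"
  shows "x \<oplus> (\<lambda>_. -1) \<odot> x = \<zero>"
  using smult_add_left[of "\<lambda>_. 1" "\<lambda>_. -1" x] assms by simp

lemma add_neg_cancel [simp]:
  assumes "x \<in> carrier V" "y \<in> carrier V"
  shows "x \<oplus> ((\<lambda>_. -1) \<odot> x \<oplus> y) = y"
  using assms by (simp add: M.a_assoc[symmetric])

end

section \<open>Sublinear functionals with random values and the extension of dominated
  graphs\<close>

locale rv_sublinear = rv_module M V
  for M :: "'w measure" and V :: "(('w \<Rightarrow> real), 'v, 'k) module_scheme" (structure) +
  fixes p :: "'v \<Rightarrow> 'w \<Rightarrow> real"
  assumes measurable_p [measurable]: "x \<in> carrier V \<Longrightarrow> p x \<in> borel_measurable M"
    and p_add: "x \<in> carrier V \<Longrightarrow> y \<in> carrier V \<Longrightarrow> AE w in M. p (x \<oplus> y) w \<le> p x w + p y w"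
    and p_smult_le: "u \<in> borel_measurable M \<Longrightarrow> (\<And>w. 0 \<le> u w) \<Longrightarrow> x \<in> carrier V \<Longrightarrow>
      AE w in M. p (u \<odot> x) w \<le> u w * p x w"
begin

lemma p_zero: "AE w in M. p \<zero> w = 0"
  using p_smult_le[of "\<lambda>_. 0" \<zero>] p_add[of \<zero> \<zero>] by auto

text \<open>Splitting \<open>x\<close> into \<open>b \<odot> x\<close> and its complementary part
  gives \<open>p x\<close> at most the sum of two terms, each bounded by the corresponding part of
  \<open>p x\<close>. The bounds add up to \<open>p x\<close>, so both are equalities. This locality
  permits arguments event by event.\<close>

lemma p_local:
  assumes [measurable]: "b \<in> borel_measurable M" and b: "\<And>w. b w = 0 \<or> b w = 1" and x: "x \<in> carrier V"
  shows "AE w in M. p (b \<odot> x) w = b w * p x w"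
proof -
  have b0: "0 \<le> b w" "0 \<le> 1 - b w" for w using b[of w] by auto
  have "b \<odot> x \<oplus> (\<lambda>w. 1 - b w) \<odot> x = x"
    using x by (simp add: smult_add_left)
  then have "AE w in M. p x w \<le> p (b \<odot> x) w + p ((\<lambda>w. 1 - b w) \<odot> x) w"
    using p_add[of "b \<odot> x" "(\<lambda>w. 1 - b w) \<odot> x"] x by simp
  moreover have "AE w in M. p (b \<odot> x) w \<le> b w * p x w"
    using b0 x by (intro p_smult_le) auto
  moreover have "AE w in M. p ((\<lambda>w. 1 - b w) \<odot> x) w \<le> (1 - b w) * p x w"
    using b0 x by (intro p_smult_le) auto
  ultimately show ?thesis
    by eventually_elim (auto simp: algebra_simps)
qed

text \<open>The reverse inequality comes from the assumed one, applied to \<open>u \<odot> x\<close>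
  with the scalar \<open>inverse u\<close>. Because \<open>inverse 0 = 0\<close>, the product of the
  two scalars is the indicator \<open>b\<close> of the event where \<open>u\<close> is positive, and
  locality handles it. On the complementary event the local part of \<open>u \<odot> x\<close> is
  \<open>\<zero>\<close>, where \<open>p\<close> vanishes.\<close>

lemma p_smult:
  assumes [measurable]: "u \<in> borel_measurable M" and u: "\<And>w. 0 \<le> u w" and x: "x \<in> carrier V"
  shows "AE w in M. p (u \<odot> x) w = u w * p x w"
proof -
  define b where "b w = (if 0 < u w then 1 else 0 :: real)" for w
  define b' where "b' w = (if 0 < u w then 0 else 1 :: real)" for w
  have [measurable]: "b \<in> borel_measurable M" "b' \<in> borel_measurable M"
    unfolding b_def b'_def by measurable
  have "(\<lambda>w. inverse (u w) * u w) = b"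
    using u by (auto simp: b_def fun_eq_iff not_less intro: antisym)
  then have "(\<lambda>w. inverse (u w)) \<odot> (u \<odot> x) = b \<odot> x"
    using x by (simp add: smult_smult)
  moreover have "AE w in M. p ((\<lambda>w. inverse (u w)) \<odot> (u \<odot> x)) w \<le> inverse (u w) * p (u \<odot> x) w"
    using x u by (intro p_smult_le) auto
  ultimately have 1: "AE w in M. p (b \<odot> x) w \<le> inverse (u w) * p (u \<odot> x) w" by simp
  have 2: "AE w in M. p (b \<odot> x) w = b w * p x w"
    using x by (intro p_local) (auto simp: b_def)
  have 3: "AE w in M. p (u \<odot> x) w \<le> u w * p x w"
    using x u by (intro p_smult_le) auto
  have "(\<lambda>w. b' w * u w) = (\<lambda>_. 0)"
    using u by (auto simp: b'_def fun_eq_iff not_less intro: antisym)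
  then have "b' \<odot> (u \<odot> x) = \<zero>" using x by (simp add: smult_smult)
  moreover have "AE w in M. p (b' \<odot> (u \<odot> x)) w = b' w * p (u \<odot> x) w"
    using x by (intro p_local) (auto simp: b'_def)
  ultimately have "AE w in M. p \<zero> w = b' w * p (u \<odot> x) w" by simp
  with p_zero 1 2 3 show ?thesis
  proof eventually_elim
    case (elim w)
    then show ?case
      using u[of w] by (cases "0 < u w") (auto simp: b_def b'_def field_simps)
  qed
qed

definition dominated :: "('v \<times> ('w \<Rightarrow> real)) set \<Rightarrow> bool" where
  "dominated \<Gamma> \<longleftrightarrow> \<Gamma> \<subseteq> carrier V \<times> borel_measurable M \<and> (\<zero>, \<lambda>_. 0) \<in> \<Gamma> \<and>
    (\<forall>x u y v. (x, u) \<in> \<Gamma> \<longrightarrow> (y, v) \<in> \<Gamma> \<longrightarrow> (x \<oplus> y, \<lambda>w. u w + v w) \<in> \<Gamma>) \<and>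
    (\<forall>c x u. c \<in> borel_measurable M \<longrightarrow> (x, u) \<in> \<Gamma> \<longrightarrow> (c \<odot> x, \<lambda>w. c w * u w) \<in> \<Gamma>) \<and>
    (\<forall>x u. (x, u) \<in> \<Gamma> \<longrightarrow> (AE w in M. u w \<le> p x w))"

lemma dominatedD:
  assumes "dominated \<Gamma>"
  shows "(x, u) \<in> \<Gamma> \<Longrightarrow> x \<in> carrier V" "(x, u) \<in> \<Gamma> \<Longrightarrow> u \<in> borel_measurable M"
    "(\<zero>, \<lambda>_. 0) \<in> \<Gamma>"
    "(x, u) \<in> \<Gamma> \<Longrightarrow> (y, v) \<in> \<Gamma> \<Longrightarrow> (x \<oplus> y, \<lambda>w. u w + v w) \<in> \<Gamma>"
    "c \<in> borel_measurable M \<Longrightarrow> (x, u) \<in> \<Gamma> \<Longrightarrow> (c \<odot> x, \<lambda>w. c w * u w) \<in> \<Gamma>"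
    "(x, u) \<in> \<Gamma> \<Longrightarrow> AE w in M. u w \<le> p x w"
  using assms unfolding dominated_def by auto

lemma dominated_Union:
  assumes \<C>: "\<C> \<noteq> {}" "subset.chain (Collect dominated) \<C>"
  shows "dominated (\<Union>\<C>)"
proof -
  have dom: "dominated \<Gamma>" if "\<Gamma> \<in> \<C>" for \<Gamma>
    using that \<C>(2) by (auto simp: subset.chain_def)
  note D = dominatedD[OF dom]
  show ?thesis
    unfolding dominated_def
  proof (intro conjI allI impI)
    show "\<Union>\<C> \<subseteq> carrier V \<times> borel_measurable M" using D(1,2) by auto
    show "(\<zero>, \<lambda>_. 0) \<in> \<Union>\<C>" using \<C>(1) D(3) by auto
    show "(x \<oplus> y, \<lambda>w. u w + v w) \<in> \<Union>\<C>" if "(x, u) \<in> \<Union>\<C>" "(y, v) \<in> \<Union>\<C>" for x u y v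
    proof -
      obtain \<Gamma> \<Delta> where 1: "\<Gamma> \<in> \<C>" "(x, u) \<in> \<Gamma>" "\<Delta> \<in> \<C>" "(y, v) \<in> \<Delta>"
        using \<open>(x, u) \<in> \<Union>\<C>\<close> \<open>(y, v) \<in> \<Union>\<C>\<close> by auto
      then have "\<Gamma> \<subseteq> \<Delta> \<or> \<Delta> \<subseteq> \<Gamma>"
        using \<C>(2) by (auto simp: subset.chain_def)
      then show ?thesis
        using 1 D(4)[of \<Gamma> x u y v] D(4)[of \<Delta> x u y v] by blast
    qed
    show "(c \<odot> x, \<lambda>w. c w * u w) \<in> \<Union>\<C>" if "c \<in> borel_measurable M" "(x, u) \<in> \<Union>\<C>" for c x u
      using that D(5) by blast
    show "AE w in M. u w \<le> p x w" if "(x, u) \<in> \<Union>\<C>" for x u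
      using that D(6) by blast
  qed
qed

text \<open>A positive coefficient is reduced to the coefficient one: the hypothesis is used for
  \<open>x\<close> divided by \<open>\<xi>\<close> and then multiplied by \<open>\<xi>\<close>. Both
  operations are cut off where \<open>\<xi>\<close> is not positive, and locality removes the
  cut-off on the remaining event. Keeping \<open>\<beta>\<close> abstract lets the lemma serve both
  \<open>y\<close> and its negative.\<close>

lemma dominated_add_smult_pos:
  assumes \<Gamma>: "dominated \<Gamma>" and y: "y \<in> carrier V"
    and \<beta>: "\<And>x u. (x, u) \<in> \<Gamma> \<Longrightarrow> AE w in M. u w + \<beta> w \<le> p (x \<oplus> y) w"
    and xu: "(x, u) \<in> \<Gamma>" and \<xi> [measurable]: "\<xi> \<in> borel_measurable M"
  shows "AE w in M. 0 < \<xi> w \<longrightarrow> u w + \<xi> w * \<beta> w \<le> p (x \<oplus> \<xi> \<odot> y) w"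
proof -
  note D = dominatedD[OF \<Gamma>]
  have x [simp]: "x \<in> carrier V" and [measurable]: "u \<in> borel_measurable M" using D(1,2) xu by auto
  define q where "q w = max 0 (\<xi> w)" for w
  define b where "b w = (if 0 < \<xi> w then 1 else 0 :: real)" for w
  define z where "z w = inverse (q w)" for w
  have [measurable]: "q \<in> borel_measurable M" "b \<in> borel_measurable M" "z \<in> borel_measurable M"
    unfolding q_def b_def z_def by measurable
  have "(\<lambda>w. q w * z w) = b" "(\<lambda>w. b w * \<xi> w) = q"
    by (auto simp: q_def b_def z_def fun_eq_iff)
  then have eq: "q \<odot> (z \<odot> x \<oplus> y) = b \<odot> (x \<oplus> \<xi> \<odot> y)"
    using y by (simp add: smult_add_right smult_smult)
  have "AE w in M. z w * u w + \<beta> w \<le> p (z \<odot> x \<oplus> y) w"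
    using \<beta>[OF D(5)[OF _ xu, of z]] by simp
  moreover have "AE w in M. p (q \<odot> (z \<odot> x \<oplus> y)) w = q w * p (z \<odot> x \<oplus> y) w"
    using y by (intro p_smult) (auto simp: q_def)
  moreover have "AE w in M. p (q \<odot> (z \<odot> x \<oplus> y)) w = b w * p (x \<oplus> \<xi> \<odot> y) w"
    unfolding eq using y by (intro p_local) (auto simp: b_def)
  ultimately show ?thesis
    by eventually_elim (auto simp: q_def b_def z_def field_simps)
qed

text \<open>By subadditivity every upper candidate \<open>p (x \<oplus> y) - u\<close> lies above
  every lower candidate \<open>u' - p (x' \<oplus> y')\<close>, where \<open>y'\<close> is the
  negative of \<open>y\<close>. The essential infimum \<open>\<alpha>\<close> of the upper
  candidates is therefore admissible on both sides. No distinction is made as to whether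
  \<open>y\<close>, or a part of it on some event, is already covered by \<open>\<Gamma>\<close>,
  since graphs rather than functions are extended.\<close>

lemma dominated_extend:
  assumes \<Gamma>: "dominated \<Gamma>" and y: "y \<in> carrier V"
  obtains \<Delta> \<alpha> where "dominated \<Delta>" "\<Gamma> \<subseteq> \<Delta>" "(y, \<alpha>) \<in> \<Delta>"
proof -
  note D = dominatedD[OF \<Gamma>]
  define y' where "y' = (\<lambda>_. -1) \<odot> y"
  have y' [simp]: "y' \<in> carrier V" using y by (simp add: y'_def)
  define S where "S = (\<lambda>(x, u) w. p (x \<oplus> y) w - u w) ` \<Gamma>"
  have S: "S \<subseteq> borel_measurable M" "S \<noteq> {}"
    using D(1,2,3) y by (auto simp: S_def)
  have low: "AE w in M. u' w - p (x' \<oplus> y') w \<le> s w" if s: "s \<in> S" and x': "(x', u') \<in> \<Gamma>" for s x' u'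
  proof -
    obtain x u where xu: "(x, u) \<in> \<Gamma>" "s = (\<lambda>w. p (x \<oplus> y) w - u w)" using s by (auto simp: S_def)
    have [simp]: "x \<in> carrier V" "x' \<in> carrier V" using D(1) xu x' by auto
    have "(x \<oplus> y) \<oplus> (x' \<oplus> y') = x \<oplus> x' \<oplus> (y \<oplus> y')"
      using y by (simp add: M.a_ac)
    also have "\<dots> = x \<oplus> x'" using y by (simp add: y'_def)
    finally have "AE w in M. p (x \<oplus> x') w \<le> p (x \<oplus> y) w + p (x' \<oplus> y') w"
      using p_add[of "x \<oplus> y" "x' \<oplus> y'"] y by simp
    moreover have "AE w in M. u w + u' w \<le> p (x \<oplus> x') w"
      using D(6)[OF D(4)[OF xu(1) x']] by simp
    ultimately show ?thesis
      by eventually_elim (auto simp: xu(2))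
  qed
  \<comment> \<open>The pair over \<open>\<zero>\<close> supplies the fixed lower bound that keeps
    the infimum real.\<close>
  from essential_inf[OF S low[OF _ D(3)]]
  obtain \<alpha> U where \<alpha>: "\<alpha> \<in> borel_measurable M" "\<And>s. s \<in> S \<Longrightarrow> AE w in M. \<alpha> w \<le> s w"
      "\<And>n. U n \<in> S" "AE w in M. \<forall>e>0. \<exists>n::nat. U n w < \<alpha> w + e"
    by blast
  have [measurable]: "\<alpha> \<in> borel_measurable M" by fact
  have up: "AE w in M. u w + \<alpha> w \<le> p (x \<oplus> y) w" if "(x, u) \<in> \<Gamma>" for x u
  proof -
    have "(\<lambda>w. p (x \<oplus> y) w - u w) \<in> S" using that by (force simp: S_def)
    from \<alpha>(2)[OF this] show ?thesis by eventually_elim auto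
  qed
  have dn: "AE w in M. u w + - \<alpha> w \<le> p (x \<oplus> y') w" if "(x, u) \<in> \<Gamma>" for x u
  proof -
    have "AE w in M. u w - p (x \<oplus> y') w \<le> \<alpha> w"
      by (rule essential_inf_greatest[OF _ \<alpha>(4)]) (rule low[OF \<alpha>(3) that])
    then show ?thesis by eventually_elim auto
  qed
  define \<Delta> where "\<Delta> = {(x \<oplus> \<xi> \<odot> y, \<lambda>w. u w + \<xi> w * \<alpha> w) | x u \<xi>. (x, u) \<in> \<Gamma> \<and> \<xi> \<in> borel_measurable M}"
  have \<Delta>I: "(x \<oplus> \<xi> \<odot> y, \<lambda>w. u w + \<xi> w * \<alpha> w) \<in> \<Delta>" if "(x, u) \<in> \<Gamma>" "\<xi> \<in> borel_measurable M" for x u \<xi>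
    using that by (auto simp: \<Delta>_def)
  have "dominated \<Delta>"
    unfolding dominated_def
  proof (intro conjI allI impI)
    show "\<Delta> \<subseteq> carrier V \<times> borel_measurable M"
      using D(1,2) y by (auto simp: \<Delta>_def)
    show "(\<zero>, \<lambda>_. 0) \<in> \<Delta>"
      using \<Delta>I[OF D(3), of "\<lambda>_. 0"] y by simp
  next
    fix x1 u1 x2 u2 assume "(x1, u1) \<in> \<Delta>" "(x2, u2) \<in> \<Delta>"
    then obtain a1 v1 \<xi>1 a2 v2 \<xi>2 where 1: "(a1, v1) \<in> \<Gamma>" "\<xi>1 \<in> borel_measurable M"
      "x1 = a1 \<oplus> \<xi>1 \<odot> y" "u1 = (\<lambda>w. v1 w + \<xi>1 w * \<alpha> w)" and
      2: "(a2, v2) \<in> \<Gamma>" "\<xi>2 \<in> borel_measurable M"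
      "x2 = a2 \<oplus> \<xi>2 \<odot> y" "u2 = (\<lambda>w. v2 w + \<xi>2 w * \<alpha> w)"
      unfolding \<Delta>_def by blast
    have [simp]: "a1 \<in> carrier V" "a2 \<in> carrier V" using D(1) 1 2 by auto
    have "x1 \<oplus> x2 = a1 \<oplus> a2 \<oplus> (\<xi>1 \<odot> y \<oplus> \<xi>2 \<odot> y)"
      using y 1 2 by (simp add: M.a_ac)
    then have e: "x1 \<oplus> x2 = a1 \<oplus> a2 \<oplus> (\<lambda>w. \<xi>1 w + \<xi>2 w) \<odot> y"
      using y 1 2 by (simp add: smult_add_left)
    show "(x1 \<oplus> x2, \<lambda>w. u1 w + u2 w) \<in> \<Delta>"
      using \<Delta>I[OF D(4)[OF 1(1) 2(1)], of "\<lambda>w. \<xi>1 w + \<xi>2 w"] 1(2) 2(2)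
      unfolding e by (simp add: 1(4) 2(4) algebra_simps)
  next
    fix c :: "'w \<Rightarrow> real" and x u assume c [measurable]: "c \<in> borel_measurable M" and "(x, u) \<in> \<Delta>"
    then obtain a v \<xi> where 1: "(a, v) \<in> \<Gamma>" "\<xi> \<in> borel_measurable M"
      "x = a \<oplus> \<xi> \<odot> y" "u = (\<lambda>w. v w + \<xi> w * \<alpha> w)"
      unfolding \<Delta>_def by blast
    have [simp]: "a \<in> carrier V" using D(1) 1 by auto
    have e: "c \<odot> x = c \<odot> a \<oplus> (\<lambda>w. c w * \<xi> w) \<odot> y"
      using y 1 by (simp add: smult_add_right smult_smult)
    show "(c \<odot> x, \<lambda>w. c w * u w) \<in> \<Delta>"
      using \<Delta>I[OF D(5)[OF c 1(1)], of "\<lambda>w. c w * \<xi> w"] 1(2)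
      unfolding e by (simp add: 1(4) algebra_simps)
  next
    fix x u assume "(x, u) \<in> \<Delta>"
    then obtain a v \<xi> where 1: "(a, v) \<in> \<Gamma>" "\<xi> \<in> borel_measurable M"
      "x = a \<oplus> \<xi> \<odot> y" "u = (\<lambda>w. v w + \<xi> w * \<alpha> w)"
      unfolding \<Delta>_def by blast
    have [simp]: "a \<in> carrier V" using D(1) 1 by auto
    note [measurable] = 1(2)
    \<comment> \<open>The coefficient \<open>\<xi>\<close> may have all three signs on different
      events. Where it vanishes, \<open>x\<close> and \<open>a\<close> have the same local part, so
      the bound for \<open>a\<close> carries over. Where it is negative, the positive case is
      applied to \<open>y'\<close> with \<open>- \<alpha>\<close>.\<close>
    define b where "b w = (if \<xi> w = 0 then 1 else 0 :: real)" for w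
    have [measurable]: "b \<in> borel_measurable M" unfolding b_def by measurable
    have "(\<lambda>w. b w * \<xi> w) = (\<lambda>_. 0)" by (auto simp: b_def)
    then have eq: "b \<odot> x = b \<odot> a"
      using y by (simp add: 1(3) smult_add_right smult_smult)
    have "AE w in M. p (b \<odot> x) w = b w * p x w"
      using y by (intro p_local) (auto simp: b_def 1(3))
    moreover have "AE w in M. p (b \<odot> x) w = b w * p a w"
      unfolding eq by (intro p_local) (auto simp: b_def)
    moreover have "AE w in M. 0 < \<xi> w \<longrightarrow> v w + \<xi> w * \<alpha> w \<le> p x w"
      unfolding 1(3) using up y 1(1,2) by (intro dominated_add_smult_pos[OF \<Gamma>])
    moreover have "AE w in M. 0 < - \<xi> w \<longrightarrow> v w + - \<xi> w * - \<alpha> w \<le> p x w"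
    proof -
      have "x = a \<oplus> (\<lambda>w. - \<xi> w) \<odot> y'"
        using y by (simp add: y'_def smult_smult 1(3))
      then show ?thesis
        using dominated_add_smult_pos[OF \<Gamma> y' dn 1(1), of "\<lambda>w. - \<xi> w"] by simp
    qed
    moreover have "AE w in M. v w \<le> p a w" by (rule D(6)[OF 1(1)])
    ultimately show "AE w in M. u w \<le> p x w"
    proof eventually_elim
      case (elim w)
      then show ?case
        by (cases "\<xi> w" "0::real" rule: linorder_cases) (auto simp: b_def 1(4))
    qed
  qed
  moreover have "\<Gamma> \<subseteq> \<Delta>"
    using \<Delta>I[of _ _ "\<lambda>_. 0"] y D(1) by force
  moreover have "(y, \<alpha>) \<in> \<Delta>"
    using \<Delta>I[OF D(3), of "\<lambda>_. 1"] y by simp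
  ultimately show ?thesis by (rule that)
qed

text \<open>Zorn's lemma is applied to graphs rather than to partial functions: a dominated submodule of
  \<open>V \<times> L\<^sup>0\<close> is automatically single valued almost everywhere, because its fibre over zero is
  squeezed between \<open>p \<zero> = 0\<close> and its negative.\<close>

theorem hahn_banach:
  obtains G where "\<And>x. x \<in> carrier V \<Longrightarrow> G x \<in> borel_measurable M"
    "\<And>x y. x \<in> carrier V \<Longrightarrow> y \<in> carrier V \<Longrightarrow> AE w in M. G (x \<oplus> y) w = G x w + G y w"
    "\<And>c x. c \<in> borel_measurable M \<Longrightarrow> x \<in> carrier V \<Longrightarrow> AE w in M. G (c \<odot> x) w = c w * G x w"
    "\<And>x. x \<in> carrier V \<Longrightarrow> AE w in M. G x w \<le> p x w"
proof -
  have "dominated {(\<zero>, \<lambda>_. 0)}"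
    unfolding dominated_def using p_zero by auto
  then have "\<exists>\<Gamma>\<in>Collect dominated. \<forall>\<Delta>\<in>Collect dominated. \<Gamma> \<subseteq> \<Delta> \<longrightarrow> \<Delta> = \<Gamma>"
    using dominated_Union by (intro subset_Zorn_nonempty) auto
  then obtain \<Gamma> where \<Gamma>: "dominated \<Gamma>" and max: "\<And>\<Delta>. dominated \<Delta> \<Longrightarrow> \<Gamma> \<subseteq> \<Delta> \<Longrightarrow> \<Delta> = \<Gamma>"
    by auto
  note D = dominatedD[OF \<Gamma>]
  have "\<exists>u. (y, u) \<in> \<Gamma>" if y: "y \<in> carrier V" for y
  proof -
    obtain \<Delta> \<alpha> where "dominated \<Delta>" "\<Gamma> \<subseteq> \<Delta>" "(y, \<alpha>) \<in> \<Delta>"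
      by (rule dominated_extend[OF \<Gamma> y])
    then show ?thesis using max by blast
  qed
  \<comment> \<open>Among almost everywhere equal values the choice is arbitrary, so additivity and
    homogeneity of \<open>G\<close> hold almost everywhere, with a null set depending on the
    arguments.\<close>
  then obtain G where G: "\<And>y. y \<in> carrier V \<Longrightarrow> (y, G y) \<in> \<Gamma>" by metis
  have single: "AE w in M. u w = v w" if u: "(x, u) \<in> \<Gamma>" and v: "(x, v) \<in> \<Gamma>" for x u v
  proof -
    have le: "AE w in M. u w \<le> v w" if u: "(x, u) \<in> \<Gamma>" and v: "(x, v) \<in> \<Gamma>" for u v
    proof -
      have "(x \<oplus> (\<lambda>_. -1) \<odot> x, \<lambda>w. u w + -1 * v w) \<in> \<Gamma>"
        by (rule D(4)[OF u D(5)[OF _ v]]) simp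
      then have "AE w in M. u w - v w \<le> p \<zero> w"
        using D(6) D(1)[OF u] by fastforce
      then show ?thesis using p_zero by eventually_elim auto
    qed
    from le[OF u v] le[OF v u] show ?thesis by eventually_elim auto
  qed
  show ?thesis
  proof
    fix x y assume "x \<in> carrier V" "y \<in> carrier V"
    then show "AE w in M. G (x \<oplus> y) w = G x w + G y w"
      by (intro single[OF G D(4)[OF G G]]) auto
  next
    fix c :: "'w \<Rightarrow> real" and x assume "c \<in> borel_measurable M" "x \<in> carrier V"
    then show "AE w in M. G (c \<odot> x) w = c w * G x w"
      by (intro single[OF G D(5)[OF _ G]]) auto
  qed (use D(2,6) G in auto)
qed

end

text \<open>The sublinear functional to which the Hahn--Banach theorem is applied is
  \<open>v \<mapsto> inf {N (v - t (c - z)) - t d | c \<in> C, t \<ge> 0}\<close>: it is dominated by \<open>N\<close> and at most \<open>-d\<close> at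
  the points \<open>c - z\<close>.\<close>

theorem (in rv_module) separation:
  fixes N :: "'v \<Rightarrow> 'w \<Rightarrow> real"
  assumes N_meas: "\<And>x. x \<in> carrier V \<Longrightarrow> N x \<in> borel_measurable M"
    and N_add: "\<And>x y. x \<in> carrier V \<Longrightarrow> y \<in> carrier V \<Longrightarrow> AE w in M. N (x \<oplus> y) w \<le> N x w + N y w"
    and N_smult: "\<And>u x. u \<in> borel_measurable M \<Longrightarrow> x \<in> carrier V \<Longrightarrow>
      AE w in M. N (u \<odot> x) w = \<bar>u w\<bar> * N x w"
    and C: "C \<subseteq> carrier V" "C \<noteq> {}"
    and convex: "\<And>\<theta> c c'. \<theta> \<in> borel_measurable M \<Longrightarrow> (\<And>w. 0 \<le> \<theta> w \<and> \<theta> w \<le> 1) \<Longrightarrow> c \<in> C \<Longrightarrow> c' \<in> C \<Longrightarrow>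
      \<theta> \<odot> c \<oplus> (\<lambda>w. 1 - \<theta> w) \<odot> c' \<in> C"
    and z: "z \<in> carrier V" and d: "d \<in> borel_measurable M"
    and dist: "\<And>c. c \<in> C \<Longrightarrow> AE w in M. d w \<le> N (c \<oplus> (\<lambda>_. -1) \<odot> z) w"
  obtains G where "\<And>x. x \<in> carrier V \<Longrightarrow> G x \<in> borel_measurable M"
    "\<And>x y. x \<in> carrier V \<Longrightarrow> y \<in> carrier V \<Longrightarrow> AE w in M. G (x \<oplus> y) w = G x w + G y w"
    "\<And>c x. c \<in> borel_measurable M \<Longrightarrow> x \<in> carrier V \<Longrightarrow> AE w in M. G (c \<odot> x) w = c w * G x w"
    "\<And>x. x \<in> carrier V \<Longrightarrow> AE w in M. G x w \<le> N x w"
    "\<And>c. c \<in> C \<Longrightarrow> AE w in M. G c w + d w \<le> G z w"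
proof -
  note [measurable] = N_meas d
  define D where "D c = c \<oplus> (\<lambda>_. -1) \<odot> z" for c
  have D [simp]: "D c \<in> carrier V" if "c \<in> C" for c
    using that C z by (auto simp: D_def)
  have C' [simp]: "c \<in> carrier V" if "c \<in> C" for c using that C by auto
  define F where "F v c t w = N (v \<oplus> (\<lambda>w. - t w) \<odot> D c) w - t w * d w" for v c t w
  define R where "R = {t \<in> borel_measurable M. \<forall>w. 0 \<le> (t w :: real)}"
  define T where "T v = (\<lambda>(c, t). F v c t) ` (C \<times> R)" for v
  have R_meas: "t \<in> borel_measurable M" if "t \<in> R" for t using that unfolding R_def by blast
  have F_meas: "F v c t \<in> borel_measurable M" if "v \<in> carrier V" "c \<in> C" "t \<in> R" for v c t
    using that d R_meas[OF that(3)] unfolding F_def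
    by (intro borel_measurable_diff borel_measurable_times N_meas) auto
  have N_zero: "AE w in M. N \<zero> w = 0"
    using N_smult[of "\<lambda>_. 0" \<zero>] by simp
  \<comment> \<open>This is where \<open>dist\<close> enters: \<open>t \<odot> D c\<close> is the
    difference of \<open>v\<close> and \<open>y\<close>, and its norm is at least
    \<open>t * d\<close>. Hence the infimum over all \<open>c\<close> and \<open>t\<close> stays
    real.\<close>
  have low: "AE w in M. - N v w \<le> F v c t w" if v: "v \<in> carrier V" and c: "c \<in> C" and t: "t \<in> R" for v c t
  proof -
    have [measurable]: "t \<in> borel_measurable M" using t by (rule R_meas)
    define y where "y = v \<oplus> (\<lambda>w. - t w) \<odot> D c"
    have y: "y \<in> carrier V" unfolding y_def using v c t by simp
    have "v \<oplus> (\<lambda>_. -1) \<odot> y = t \<odot> D c"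
      unfolding y_def using v c t by (simp add: smult_add_right smult_smult)
    then have "AE w in M. N (t \<odot> D c) w \<le> N v w + N ((\<lambda>_. -1) \<odot> y) w"
      using N_add[of v "(\<lambda>_. -1) \<odot> y"] v y by simp
    moreover have "AE w in M. N ((\<lambda>_. -1) \<odot> y) w = N y w"
      using N_smult[of "\<lambda>_. -1" y] y by simp
    moreover have "AE w in M. N (t \<odot> D c) w = \<bar>t w\<bar> * N (D c) w"
      using N_smult[of t "D c"] c t by simp
    moreover have "AE w in M. d w \<le> N (D c) w" using dist[OF c] by (simp add: D_def)
    ultimately show ?thesis unfolding F_def y_def[symmetric]
    proof eventually_elim
      case (elim w)
      have t0: "0 \<le> t w" using t unfolding R_def by blast
      have "t w * d w \<le> t w * N (D c) w"
        by (rule mult_left_mono[OF elim(4) t0])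
      then show ?case using elim(1-3) unfolding abs_of_nonneg[OF t0] by linarith
    qed
  qed
  have "\<exists>m. m \<in> borel_measurable M \<and> (\<forall>s\<in>T v. AE w in M. m w \<le> s w) \<and>
     (\<forall>l. (\<forall>s\<in>T v. AE w in M. l w \<le> s w) \<longrightarrow> (AE w in M. l w \<le> m w))" if v: "v \<in> carrier V" for v
  proof -
    have "(\<lambda>_. 0) \<in> R" by (simp add: R_def)
    then have "C \<times> R \<noteq> {}" using C(2) by blast
    then have T: "T v \<subseteq> borel_measurable M" "T v \<noteq> {}"
      using F_meas[OF v] by (auto simp: T_def)
    have "AE w in M. - N v w \<le> s w" if "s \<in> T v" for s
      using that low[OF v] by (auto simp: T_def)
    from essential_inf[OF T this] obtain m U where m: "m \<in> borel_measurable M"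
      "\<And>s. s \<in> T v \<Longrightarrow> AE w in M. m w \<le> s w" "\<And>n. U n \<in> T v"
      "AE w in M. \<forall>e>0. \<exists>n::nat. U n w < m w + e" by blast
    have "AE w in M. l w \<le> m w" if "\<forall>s\<in>T v. AE w in M. l w \<le> s w" for l
      using that m(3) by (intro essential_inf_greatest[OF _ m(4)]) auto
    with m(1,2) show ?thesis by (intro exI[of _ m]) simp
  qed
  then have "\<forall>v\<in>carrier V. \<exists>m. m \<in> borel_measurable M \<and> (\<forall>s\<in>T v. AE w in M. m w \<le> s w) \<and>
     (\<forall>l. (\<forall>s\<in>T v. AE w in M. l w \<le> s w) \<longrightarrow> (AE w in M. l w \<le> m w))" by blast
  from bchoice[OF this] obtain p where p: "\<forall>v\<in>carrier V. p v \<in> borel_measurable M \<and>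
     (\<forall>s\<in>T v. AE w in M. p v w \<le> s w) \<and>
     (\<forall>l. (\<forall>s\<in>T v. AE w in M. l w \<le> s w) \<longrightarrow> (AE w in M. l w \<le> p v w))" by (rule exE)
  then have p_meas: "\<And>v. v \<in> carrier V \<Longrightarrow> p v \<in> borel_measurable M"
    and p_T: "\<And>v s. v \<in> carrier V \<Longrightarrow> s \<in> T v \<Longrightarrow> AE w in M. p v w \<le> s w"
    and p_greatest_T: "\<And>v l. v \<in> carrier V \<Longrightarrow> (\<And>s. s \<in> T v \<Longrightarrow> AE w in M. l w \<le> s w) \<Longrightarrow>
      AE w in M. l w \<le> p v w"
    by simp_all
  have p_le: "AE w in M. p v w \<le> F v c t w" if "v \<in> carrier V" "c \<in> C" "t \<in> R" for v c t
    using that by (intro p_T) (auto simp: T_def)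
  have p_greatest: "AE w in M. l w \<le> p v w"
    if "v \<in> carrier V" "\<And>c t. c \<in> C \<Longrightarrow> t \<in> R \<Longrightarrow> AE w in M. l w \<le> F v c t w" for v l
    by (rule p_greatest_T[OF that(1)]) (use that(2) in \<open>auto simp: T_def\<close>)
  note [measurable] = p_meas
  have p_N: "AE w in M. p v w \<le> N v w" if v: "v \<in> carrier V" for v
  proof -
    obtain c where c: "c \<in> C" using C(2) by auto
    show ?thesis
      using p_le[OF v c, of "\<lambda>_. 0"] v c by (simp add: F_def R_def)
  qed
  \<comment> \<open>The multiplier \<open>t = 1\<close> at the vector \<open>D c\<close> leaves
    \<open>N \<zero> - d\<close>.\<close>
  have p_D: "AE w in M. p (D c) w \<le> - d w" if c: "c \<in> C" for c
    using p_le[OF D[OF c] c, of "\<lambda>_. 1"] N_zero c by (auto simp: F_def R_def)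
  interpret p: rv_sublinear M V p
  proof (intro rv_sublinear.intro rv_sublinear_axioms.intro rv_module_axioms p_meas)
    fix v1 v2 assume v: "v1 \<in> carrier V" "v2 \<in> carrier V"
    have *: "AE w in M. p (v1 \<oplus> v2) w \<le> F v1 c1 t1 w + F v2 c2 t2 w"
      if c: "c1 \<in> C" "c2 \<in> C" and t: "t1 \<in> R" "t2 \<in> R" for c1 c2 t1 t2
    proof -
      define t where "t w = t1 w + t2 w" for w
      \<comment> \<open>The weight is chosen so that \<open>t \<odot> c\<close> equals
        \<open>t1 \<odot> c1 \<oplus> t2 \<odot> c2\<close>. Where \<open>t\<close> vanishes,
        division by zero gives the weight 0, which is correct there because \<open>t1\<close> and
        \<open>t2\<close> vanish as well.\<close>
      define \<theta> where "\<theta> w = t1 w / t w" for w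
      have t0: "0 \<le> t1 w" "0 \<le> t2 w" for w using t by (auto simp: R_def)
      have [measurable]: "t1 \<in> borel_measurable M" "t2 \<in> borel_measurable M" using t by (auto intro: R_meas)
      have [measurable]: "t \<in> borel_measurable M" "\<theta> \<in> borel_measurable M"
        unfolding \<theta>_def t_def by measurable
      have \<theta>: "0 \<le> \<theta> w" "\<theta> w \<le> 1" for w
        using t0[of w] by (auto simp: \<theta>_def t_def divide_le_eq_1)
      have t\<theta>': "t w * \<theta> w = t1 w" for w
        using t0[of w] by (cases "t w = 0") (auto simp: \<theta>_def t_def add_nonneg_eq_0_iff)
      have t\<theta>: "(\<lambda>w. - (t w * \<theta> w)) = (\<lambda>w. - t1 w)" "(\<lambda>w. - (t w * (1 - \<theta> w))) = (\<lambda>w. - t2 w)"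
        by (simp_all add: t\<theta>' right_diff_distrib) (simp add: t_def)
      define c where "c = \<theta> \<odot> c1 \<oplus> (\<lambda>w. 1 - \<theta> w) \<odot> c2"
      have cC: "c \<in> C" unfolding c_def using \<theta> c by (intro convex) auto
      have "(\<lambda>w. - t w) \<odot> D c = (\<lambda>w. - t1 w) \<odot> c1 \<oplus> (\<lambda>w. - t2 w) \<odot> c2 \<oplus> t \<odot> z"
        unfolding D_def c_def using c z by (simp add: smult_add_right smult_smult t\<theta>)
      moreover have "t \<odot> z = t1 \<odot> z \<oplus> t2 \<odot> z"
        unfolding t_def using z by (simp add: smult_add_left)
      moreover have "(\<lambda>w. - t1 w) \<odot> D c1 = (\<lambda>w. - t1 w) \<odot> c1 \<oplus> t1 \<odot> z"
        "(\<lambda>w. - t2 w) \<odot> D c2 = (\<lambda>w. - t2 w) \<odot> c2 \<oplus> t2 \<odot> z"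
        unfolding D_def using c z by (simp_all add: smult_add_right smult_smult)
      ultimately have e: "v1 \<oplus> v2 \<oplus> (\<lambda>w. - t w) \<odot> D c =
          (v1 \<oplus> (\<lambda>w. - t1 w) \<odot> D c1) \<oplus> (v2 \<oplus> (\<lambda>w. - t2 w) \<odot> D c2)"
        using v c z by (simp add: M.a_ac)
      have "AE w in M. p (v1 \<oplus> v2) w \<le> F (v1 \<oplus> v2) c t w"
        using v cC t0 by (intro p_le) (auto simp: R_def t_def)
      moreover have "AE w in M. N (v1 \<oplus> v2 \<oplus> (\<lambda>w. - t w) \<odot> D c) w \<le>
          N (v1 \<oplus> (\<lambda>w. - t1 w) \<odot> D c1) w + N (v2 \<oplus> (\<lambda>w. - t2 w) \<odot> D c2) w"
        unfolding e using v c by (intro N_add) auto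
      ultimately show ?thesis
        by eventually_elim (auto simp: F_def t_def algebra_simps)
    qed
    \<comment> \<open>The two infima are taken one after the other, since the null set in the
      preceding inequality depends on all of \<open>c1\<close>, \<open>t1\<close>,
      \<open>c2\<close>, \<open>t2\<close>.\<close>
    have "AE w in M. p (v1 \<oplus> v2) w - p v1 w \<le> p v2 w"
    proof (rule p_greatest[OF v(2)])
      fix c2 t2 assume 2: "c2 \<in> C" "t2 \<in> R"
      have "AE w in M. p (v1 \<oplus> v2) w - F v2 c2 t2 w \<le> p v1 w"
      proof (rule p_greatest[OF v(1)])
        fix c1 t1 assume 1: "c1 \<in> C" "t1 \<in> R"
        from *[OF 1(1) 2(1) 1(2) 2(2)]
        show "AE w in M. p (v1 \<oplus> v2) w - F v2 c2 t2 w \<le> F v1 c1 t1 w"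
          by eventually_elim auto
      qed
      then show "AE w in M. p (v1 \<oplus> v2) w - p v1 w \<le> F v2 c2 t2 w"
        by eventually_elim auto
    qed
    then show "AE w in M. p (v1 \<oplus> v2) w \<le> p v1 w + p v2 w"
      by eventually_elim auto
  next
    fix u :: "'w \<Rightarrow> real" and v assume u [measurable]: "u \<in> borel_measurable M" and u0: "\<And>w. 0 \<le> u w"
      and v: "v \<in> carrier V"
    have *: "AE w in M. p (u \<odot> v) w \<le> u w * F v c t w" if c: "c \<in> C" and t: "t \<in> R" for c t
    proof -
      have [measurable]: "t \<in> borel_measurable M" using t by (rule R_meas)
      have e: "u \<odot> v \<oplus> (\<lambda>w. - (u w * t w)) \<odot> D c = u \<odot> (v \<oplus> (\<lambda>w. - t w) \<odot> D c)"
        using v c by (simp add: smult_add_right smult_smult)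
      have "AE w in M. p (u \<odot> v) w \<le> F (u \<odot> v) c (\<lambda>w. u w * t w) w"
        using v c t u0 by (intro p_le) (auto simp: R_def)
      then have "AE w in M. p (u \<odot> v) w \<le> N (u \<odot> (v \<oplus> (\<lambda>w. - t w) \<odot> D c)) w - u w * t w * d w"
        unfolding F_def e .
      moreover have "AE w in M. N (u \<odot> (v \<oplus> (\<lambda>w. - t w) \<odot> D c)) w = \<bar>u w\<bar> * N (v \<oplus> (\<lambda>w. - t w) \<odot> D c) w"
        using v c by (intro N_smult) auto
      ultimately show ?thesis
        by eventually_elim (auto simp: F_def u0 algebra_simps)
    qed
    \<comment> \<open>Division by \<open>u\<close> is possible only on the event where it is
      positive. Elsewhere \<open>p v\<close> itself serves as the lower bound, and the claim for
      \<open>u = 0\<close> follows from \<open>p\<close> being dominated by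
      \<open>N\<close>.\<close>
    define l where "l w = (if 0 < u w then p (u \<odot> v) w / u w else p v w)" for w
    have "AE w in M. l w \<le> p v w"
    proof (rule p_greatest[OF v])
      fix c t assume ct: "c \<in> C" "t \<in> R"
      from *[OF ct] p_le[OF v ct] show "AE w in M. l w \<le> F v c t w"
        by eventually_elim (auto simp: l_def field_simps)
    qed
    moreover have "AE w in M. p (u \<odot> v) w \<le> N (u \<odot> v) w" using v by (intro p_N) auto
    moreover have "AE w in M. N (u \<odot> v) w = \<bar>u w\<bar> * N v w" using v by (intro N_smult) auto
    ultimately show "AE w in M. p (u \<odot> v) w \<le> u w * p v w"
    proof eventually_elim
      case (elim w)
      then show ?case using u0[of w] by (cases "0 < u w") (auto simp: l_def field_simps)
    qed
  qed
  obtain G where G: "\<And>x. x \<in> carrier V \<Longrightarrow> G x \<in> borel_measurable M"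
    "\<And>x y. x \<in> carrier V \<Longrightarrow> y \<in> carrier V \<Longrightarrow> AE w in M. G (x \<oplus> y) w = G x w + G y w"
    "\<And>c x. c \<in> borel_measurable M \<Longrightarrow> x \<in> carrier V \<Longrightarrow> AE w in M. G (c \<odot> x) w = c w * G x w"
    "\<And>x. x \<in> carrier V \<Longrightarrow> AE w in M. G x w \<le> p x w"
    by (rule p.hahn_banach) (rule that)
  show ?thesis
  proof (rule that[OF G(1-3)])
    fix x assume "x \<in> carrier V"
    from G(4)[OF this] p_N[OF this] show "AE w in M. G x w \<le> N x w" by eventually_elim auto
  next
    fix c assume c: "c \<in> C"
    from G(4)[OF D[OF c]] p_D[OF c] G(2)[of c "(\<lambda>_. -1) \<odot> z"] G(3)[of "\<lambda>_. -1" z]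
    show "AE w in M. G c w + d w \<le> G z w"
      using c z by (auto simp: D_def)
  qed
qed

section \<open>Scalars and seminorms\<close>

lemma measurable_rep_ae_class [measurable]:
  "f \<in> borel_measurable M \<Longrightarrow> rep (ae_class M f) \<in> borel_measurable M"
  by (intro rep_in_class(2) ae_class_carrier)

lemma lift2_add_ae_class:
  fixes u v :: "'w \<Rightarrow> real"
  assumes [measurable]: "u \<in> borel_measurable M" "v \<in> borel_measurable M"
  shows "lift2 M (+) (ae_class M u) (ae_class M v) = ae_class M (\<lambda>w. u w + v w)"
  by (rule lift2_ae_class) measurable

lemma lift2_mult_ae_class:
  fixes u v :: "'w \<Rightarrow> real"
  assumes [measurable]: "u \<in> borel_measurable M" "v \<in> borel_measurable M"
  shows "lift2 M (*) (ae_class M u) (ae_class M v) = ae_class M (\<lambda>w. u w * v w)"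
  by (rule lift2_ae_class) measurable

lemma L0_abs_ae_class:
  assumes [measurable]: "u \<in> borel_measurable M"
  shows "L0_abs M (ae_class M u) = ae_class M (\<lambda>w. \<bar>u w\<bar>)"
  unfolding L0_abs_def by (rule lift1_ae_class) measurable

lemma L0_one_minus_ae_class:
  assumes "prob_space M" and [measurable]: "u \<in> borel_measurable M"
  shows "\<one>\<^bsub>L0 M\<^esub> \<ominus>\<^bsub>L0 M\<^esub> ae_class M u = ae_class M (\<lambda>w. 1 - u w)"
proof -
  interpret L: random_locally_convex_module M "L0 M" "{L0_abs M}"
    by (rule L0_random_locally_convex_module) fact
  have c: "ae_class M v \<in> carrier (L0 M)" if "v \<in> borel_measurable M" for v :: "'a \<Rightarrow> real"
    using that by (simp add: ae_class_carrier)
  have "ae_class M (\<lambda>w. - u w) \<oplus>\<^bsub>L0 M\<^esub> ae_class M u = \<zero>\<^bsub>L0 M\<^esub>"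
    by (simp add: lift2_add_ae_class)
  then have "\<ominus>\<^bsub>L0 M\<^esub> ae_class M u = ae_class M (\<lambda>w. - u w)"
    by (intro L.E.R.minus_equality c) auto
  then show ?thesis
    by (simp add: a_minus_def lift2_add_ae_class)
qed

text \<open>The ambient module of the epigraph. The first coordinate is acted on through classes,
  the second consists of functions, so pointwise identities between scalars are valid in both
  coordinates.\<close>

definition pair_module ::
    "'w measure \<Rightarrow> (('w \<Rightarrow> real) set, 'e, 'm) module_scheme \<Rightarrow> ('w \<Rightarrow> real, 'e \<times> ('w \<Rightarrow> real)) module" where
  "pair_module M E = \<lparr>carrier = carrier E \<times> borel_measurable M, mult = undefined, one = undefined,
     zero = (\<zero>\<^bsub>E\<^esub>, \<lambda>_. 0), add = \<lambda>(x, r) (y, s). (x \<oplus>\<^bsub>E\<^esub> y, \<lambda>w. r w + s w),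
     smult = \<lambda>u (x, r). (ae_class M u \<odot>\<^bsub>E\<^esub> x, \<lambda>w. u w * r w)\<rparr>"

lemma pair_module_simps [simp]:
  "carrier (pair_module M E) = carrier E \<times> borel_measurable M"
  "zero (pair_module M E) = (\<zero>\<^bsub>E\<^esub>, \<lambda>_. 0)"
  "(x, r) \<oplus>\<^bsub>pair_module M E\<^esub> (y, s) = (x \<oplus>\<^bsub>E\<^esub> y, \<lambda>w. r w + s w)"
  "u \<odot>\<^bsub>pair_module M E\<^esub> (x, r) = (ae_class M u \<odot>\<^bsub>E\<^esub> x, \<lambda>w. u w * r w)"
  by (simp_all add: pair_module_def)

text \<open>For finite \<open>Q\<close> the sum replaces the supremum of the seminorms. The two
  differ by a factor of at most the number of seminorms, so they define the same neighbourhoods; the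
  sum is additive in its terms and real valued, with value 0 instead of \<open>-\<infinity>\<close>
  for empty \<open>Q\<close>.\<close>

definition sum_norm :: "('e \<Rightarrow> ('w \<Rightarrow> real) set) set \<Rightarrow> 'e \<Rightarrow> 'w \<Rightarrow> real" where
  "sum_norm Q x w = (\<Sum>p\<in>Q. rep (p x) w)"

context random_locally_convex_module
begin

lemma scalar_closed [simp]:
  "u \<in> borel_measurable M \<Longrightarrow> x \<in> carrier E \<Longrightarrow> ae_class M u \<odot> x \<in> carrier E"
  using E.smult_closed[of "ae_class M u" x] by (simp add: ae_class_carrier)

lemma scalar_assoc:
  assumes "u \<in> borel_measurable M" "v \<in> borel_measurable M" "x \<in> carrier E"
  shows "ae_class M u \<odot> (ae_class M v \<odot> x) = ae_class M (\<lambda>w. u w * v w) \<odot> x"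
  using E.smult_assoc1[of "ae_class M u" "ae_class M v" x] assms
  by (simp add: ae_class_carrier lift2_mult_ae_class)

lemma scalar_add_left:
  assumes "u \<in> borel_measurable M" "v \<in> borel_measurable M" "x \<in> carrier E"
  shows "ae_class M u \<odot> x \<oplus> ae_class M v \<odot> x = ae_class M (\<lambda>w. u w + v w) \<odot> x"
  using E.smult_l_distr[of "ae_class M u" "ae_class M v" x] assms
  by (simp add: ae_class_carrier lift2_add_ae_class)

lemma scalar_add_right:
  assumes "u \<in> borel_measurable M" "x \<in> carrier E" "y \<in> carrier E"
  shows "ae_class M u \<odot> (x \<oplus> y) = ae_class M u \<odot> x \<oplus> ae_class M u \<odot> y"
  using E.smult_r_distr[of "ae_class M u" x y] assms by (simp add: ae_class_carrier)

lemma scalar_one [simp]: "x \<in> carrier E \<Longrightarrow> ae_class M (\<lambda>_. 1) \<odot> x = x"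
  using E.smult_one[of x] by simp

lemma scalar_zero [simp]: "x \<in> carrier E \<Longrightarrow> ae_class M (\<lambda>_. 0) \<odot> x = \<zero>"
  using E.smult_l_null[of x] by simp

lemma rv_module_pair_module: "rv_module M (pair_module M E)"
proof (intro rv_module.intro prob_space_axioms moduleI cring_rv_ring abelian_groupI)
  fix x assume "x \<in> carrier (pair_module M E)"
  then show "\<exists>y\<in>carrier (pair_module M E). y \<oplus>\<^bsub>pair_module M E\<^esub> x = \<zero>\<^bsub>pair_module M E\<^esub>"
    by (intro bexI[of _ "(ae_class M (\<lambda>_. -1) \<odot> fst x, \<lambda>w. - snd x w)"])
      (use scalar_add_left[of "\<lambda>_. -1" "\<lambda>_. 1" "fst x"] in \<open>auto\<close>)
qed (auto simp: E.M.a_ac scalar_assoc scalar_add_left scalar_add_right algebra_simps)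

section \<open>Almost sure calculus of the seminorms and of their finite sums\<close>

lemma seminorm_carrier:
  assumes "p \<in> P" "x \<in> carrier E"
  shows "p x \<in> borel_measurable M // ae_rel M" "AE w in M. 0 \<le> rep (p x) w"
proof -
  have *: "p x \<in> L0_plus M" using seminorm[OF assms(1)] assms(2) by (auto simp: L0_seminorm_def)
  then show "p x \<in> borel_measurable M // ae_rel M" by (simp add: L0_plus_def)
  have "AE w in M. rep (ae_class M (\<lambda>_. 0 :: real)) w \<le> rep (p x) w"
    using * by (simp add: L0_plus_def as_le_def)
  then show "AE w in M. 0 \<le> rep (p x) w"
    using rep_ae_class[of "\<lambda>_. 0 :: real" M] by auto
qed

lemma measurable_seminorm:
  "p \<in> P \<Longrightarrow> x \<in> carrier E \<Longrightarrow> rep (p x) \<in> borel_measurable M"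
  by (intro rep_in_class(2) seminorm_carrier(1))

lemma seminorm_add:
  assumes p: "p \<in> P" and x: "x \<in> carrier E" "y \<in> carrier E"
  shows "AE w in M. rep (p (x \<oplus> y)) w \<le> rep (p x) w + rep (p y) w"
proof -
  note [measurable] = measurable_seminorm[OF p x(1)] measurable_seminorm[OF p x(2)]
  have "as_le M (p (x \<oplus> y)) (lift2 M (+) (p x) (p y))"
    using seminorm[OF p] x by (simp add: L0_seminorm_def)
  then show ?thesis
    using rep_ae_class[of "\<lambda>w. rep (p x) w + rep (p y) w" M] by (auto simp: as_le_def lift2_def)
qed

lemma seminorm_smult:
  assumes p: "p \<in> P" and x: "x \<in> carrier E" and [measurable]: "u \<in> borel_measurable M"
  shows "AE w in M. rep (p (ae_class M u \<odot> x)) w = \<bar>u w\<bar> * rep (p x) w"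
proof -
  note [measurable] = measurable_seminorm[OF p x]
  have "p (ae_class M u \<odot> x) = lift2 M (*) (L0_abs M (ae_class M u)) (p x)"
    using seminorm[OF p] x by (simp add: L0_seminorm_def ae_class_carrier)
  also have "\<dots> = ae_class M (\<lambda>w. \<bar>u w\<bar> * rep (p x) w)"
    using lift2_mult_ae_class[of "\<lambda>w. \<bar>u w\<bar>" M "rep (p x)"]
    by (simp add: L0_abs_ae_class rep_in_class(3)[OF seminorm_carrier(1)[OF p x]])
  finally show ?thesis using rep_ae_class[of "\<lambda>w. \<bar>u w\<bar> * rep (p x) w" M] by simp
qed

lemma measurable_sum_norm [measurable (raw)]:
  "Q \<subseteq> P \<Longrightarrow> x \<in> carrier E \<Longrightarrow> sum_norm Q x \<in> borel_measurable M"
  unfolding sum_norm_def by (intro borel_measurable_sum measurable_seminorm) auto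

lemma sum_norm_nonneg:
  assumes "finite Q" "Q \<subseteq> P" "x \<in> carrier E"
  shows "AE w in M. 0 \<le> sum_norm Q x w"
proof -
  have "AE w in M. \<forall>p\<in>Q. 0 \<le> rep (p x) w"
    using assms seminorm_carrier(2) by (simp add: AE_finite_all subset_iff)
  then show ?thesis by eventually_elim (auto simp: sum_norm_def intro: sum_nonneg)
qed

lemma sum_norm_add:
  assumes "finite Q" "Q \<subseteq> P" "x \<in> carrier E" "y \<in> carrier E"
  shows "AE w in M. sum_norm Q (x \<oplus> y) w \<le> sum_norm Q x w + sum_norm Q y w"
proof -
  have "AE w in M. \<forall>p\<in>Q. rep (p (x \<oplus> y)) w \<le> rep (p x) w + rep (p y) w"
    using assms seminorm_add by (simp add: AE_finite_all subset_iff)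
  then show ?thesis
    by eventually_elim (auto simp: sum_norm_def sum.distrib[symmetric] intro: sum_mono)
qed

lemma sum_norm_smult:
  assumes "finite Q" "Q \<subseteq> P" "x \<in> carrier E" "u \<in> borel_measurable M"
  shows "AE w in M. sum_norm Q (ae_class M u \<odot> x) w = \<bar>u w\<bar> * sum_norm Q x w"
proof -
  have "AE w in M. \<forall>p\<in>Q. rep (p (ae_class M u \<odot> x)) w = \<bar>u w\<bar> * rep (p x) w"
    using assms seminorm_smult by (simp add: AE_finite_all subset_iff)
  then show ?thesis
    by eventually_elim (auto simp: sum_norm_def sum_distrib_left)
qed

lemma sum_norm_mono:
  assumes "finite Q'" "Q \<subseteq> Q'" "Q' \<subseteq> P" "x \<in> carrier E"
  shows "AE w in M. sum_norm Q x w \<le> sum_norm Q' x w"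
proof -
  have "AE w in M. \<forall>p\<in>Q'. 0 \<le> rep (p x) w"
    using assms seminorm_carrier(2) by (simp add: AE_finite_all subset_iff)
  then show ?thesis
    by eventually_elim (use assms in \<open>auto simp: sum_norm_def intro!: sum_mono2\<close>)
qed

section \<open>Neighbourhoods and the dual module\<close>

lemma rep_sup_norm:
  assumes Q: "finite Q" "Q \<subseteq> P" and x: "x \<in> carrier E"
  shows "rep (sup_norm M Q x) \<in> borel_measurable M"
    "AE w in M. rep (sup_norm M Q x) w = (SUP p\<in>Q. ereal (rep (p x) w))"
proof -
  let ?e = "\<lambda>p. ext_class M (p x)"
  have m: "(\<lambda>w. ereal (rep (p x) w)) \<in> borel_measurable M" if "p \<in> Q" for p
    using measurable_seminorm[of p x] that Q x by auto
  have e: "?e p = ae_class M (\<lambda>w. ereal (rep (p x) w))" for p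
    by (simp add: lift1_def)
  have c: "?e ` Q \<subseteq> carrier (Lbar M)"
    using m by (auto simp: e ae_class_carrier)
  have s: "sup_norm M Q x = ae_class M (\<lambda>w. SUP X\<in>?e ` Q. rep X w)"
    unfolding sup_norm_def using Q c by (intro Lbar_sup_finite) auto
  have sm: "(\<lambda>w. SUP X\<in>?e ` Q. rep X w) \<in> borel_measurable M"
    using Q c by (intro borel_measurable_SUP rep_in_class(2)) (auto intro: countable_finite)
  show "rep (sup_norm M Q x) \<in> borel_measurable M"
    unfolding s using sm by (rule measurable_rep_ae_class)
  have "AE w in M. \<forall>p\<in>Q. rep (?e p) w = ereal (rep (p x) w)"
    unfolding e using Q m rep_ae_class by (auto simp: AE_finite_all)
  then show "AE w in M. rep (sup_norm M Q x) w = (SUP p\<in>Q. ereal (rep (p x) w))"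
    using rep_ae_class[OF sm] unfolding s
    by eventually_elim (simp add: image_image)
qed

text \<open>The terms are nonnegative almost surely, so the sum dominates each of them and hence the
  supremum; for empty \<open>Q\<close> the supremum is \<open>-\<infinity>\<close>.\<close>

lemma el_nhdI:
  assumes Q: "finite Q" "Q \<subseteq> P" and x: "x \<in> carrier E" and "0 < \<epsilon>"
    and l: "prob {w \<in> space M. sum_norm Q x w < \<epsilon>} > 1 - l"
  shows "x \<in> el_nhd M E Q \<epsilon> l"
proof -
  note [measurable] = rep_sup_norm(1)[OF Q x] measurable_sum_norm[OF Q(2) x]
  have "AE w in M. \<forall>p\<in>Q. 0 \<le> rep (p x) w"
    using assms seminorm_carrier(2) by (simp add: AE_finite_all subset_iff)
  then have "AE w in M. w \<in> {w \<in> space M. sum_norm Q x w < \<epsilon>} \<longrightarrow>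
      w \<in> {w \<in> space M. rep (sup_norm M Q x) w < ereal \<epsilon>}"
    using rep_sup_norm(2)[OF Q x]
  proof eventually_elim
    case (elim w)
    have "(SUP p\<in>Q. ereal (rep (p x) w)) \<le> ereal (sum_norm Q x w)"
      using Q(1) elim(1) by (auto simp: sum_norm_def intro!: SUP_least member_le_sum)
    then show ?case using elim(2) by (auto intro: le_less_trans)
  qed
  then have "prob {w \<in> space M. sum_norm Q x w < \<epsilon>} \<le>
      prob {w \<in> space M. rep (sup_norm M Q x) w < ereal \<epsilon>}"
    by (intro finite_measure_mono_AE) auto
  with l x show ?thesis by (auto simp: el_nhd_def)
qed

text \<open>A supremum below \<open>\<epsilon>\<close> bounds the sum by
  \<open>card Q * \<epsilon>\<close>. The additional summand 1 keeps the inequality strict, also for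
  empty \<open>Q\<close>.\<close>

lemma el_nhdD:
  assumes Q: "finite Q" "Q \<subseteq> P" and x: "x \<in> el_nhd M E Q \<epsilon> l" and \<epsilon>: "0 < \<epsilon>"
  shows "prob {w \<in> space M. sum_norm Q x w < (real (card Q) + 1) * \<epsilon>} > 1 - l"
proof -
  have xE: "x \<in> carrier E" using x by (simp add: el_nhd_def)
  note [measurable] = rep_sup_norm(1)[OF Q xE] measurable_sum_norm[OF Q(2) xE]
  have "AE w in M. w \<in> {w \<in> space M. rep (sup_norm M Q x) w < ereal \<epsilon>} \<longrightarrow>
      w \<in> {w \<in> space M. sum_norm Q x w < (real (card Q) + 1) * \<epsilon>}"
    using rep_sup_norm(2)[OF Q xE]
  proof eventually_elim
    case (elim w)
    have "sum_norm Q x w < (real (card Q) + 1) * \<epsilon>" if "(SUP p\<in>Q. ereal (rep (p x) w)) < ereal \<epsilon>"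
    proof -
      have "rep (p x) w \<le> \<epsilon>" if "p \<in> Q" for p
        using le_less_trans[OF SUP_upper[OF that, of "\<lambda>p. ereal (rep (p x) w)"] \<open>_ < ereal \<epsilon>\<close>]
        by simp
      then have "sum_norm Q x w \<le> (\<Sum>p\<in>Q. \<epsilon>)"
        unfolding sum_norm_def by (rule sum_mono)
      then show ?thesis using \<epsilon> by (simp add: algebra_simps)
    qed
    then show ?case using elim by auto
  qed
  then have "prob {w \<in> space M. rep (sup_norm M Q x) w < ereal \<epsilon>} \<le>
      prob {w \<in> space M. sum_norm Q x w < (real (card Q) + 1) * \<epsilon>}"
    by (intro finite_measure_mono_AE) auto
  with x show ?thesis by (auto simp: el_nhd_def)
qed

lemma topspace_el_topology: "topspace (el_topology M E P) = carrier E"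
proof
  have "el_open M E P (carrier E)"
    by (auto simp: el_open_def el_nhd_def intro!: exI[of _ "{}"] exI[of _ "1::real"] exI[of _ "1/2::real"])
  then show "carrier E \<subseteq> topspace (el_topology M E P)"
    by (intro openin_subset) (simp add: openin_el_topology)
  show "topspace (el_topology M E P) \<subseteq> carrier E"
    using openin_topspace[of "el_topology M E P"] unfolding openin_el_topology el_open_def by blast
qed

end

text \<open>The set \<open>Q\<close> is empty or consists of the absolute value alone. In the empty
  case the sum is 0, which lies below the positive \<open>\<epsilon>\<close>.\<close>

lemma L0_el_nhdI:
  assumes "prob_space M" and Q: "Q \<subseteq> {L0_abs M}" and t [measurable]: "t \<in> borel_measurable M" and \<epsilon>: "0 < \<epsilon>"
    and l: "measure M {w \<in> space M. \<bar>t w\<bar> < \<epsilon>} > 1 - l"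
  shows "ae_class M t \<in> el_nhd M (L0 M) Q \<epsilon> l"
proof -
  interpret L: random_locally_convex_module M "L0 M" "{L0_abs M}"
    by (rule L0_random_locally_convex_module) fact
  have Q': "finite Q" using Q finite_subset by blast
  have c: "ae_class M t \<in> carrier (L0 M)" by (simp add: ae_class_carrier)
  note [measurable] = L.measurable_sum_norm[OF Q c]
  have "AE w in M. rep (L0_abs M (ae_class M t)) w = \<bar>t w\<bar>"
    unfolding L0_abs_ae_class[OF t] by (rule rep_ae_class) measurable
  then have "AE w in M. w \<in> {w \<in> space M. \<bar>t w\<bar> < \<epsilon>} \<longrightarrow>
      w \<in> {w \<in> space M. sum_norm Q (ae_class M t) w < \<epsilon>}"
    by eventually_elim (use Q \<epsilon> in \<open>auto simp: sum_norm_def subset_singleton_iff\<close>)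
  then have "measure M {w \<in> space M. \<bar>t w\<bar> < \<epsilon>} \<le>
      measure M {w \<in> space M. sum_norm Q (ae_class M t) w < \<epsilon>}"
    by (intro L.finite_measure_mono_AE) auto
  with l show ?thesis by (intro L.el_nhdI Q Q' c \<epsilon>) auto
qed

section \<open>Continuity from random bounds, and neighbourhoods missing the epigraph\<close>

context random_locally_convex_module
begin

text \<open>The bound \<open>\<zeta>\<close> is random and possibly unbounded, but smallness in
  probability tolerates an exceptional event. The events \<open>real n < \<zeta>\<close> decrease to
  the empty set, so off an event of probability below \<open>l / 2\<close> the bound is a constant;
  the other \<open>l / 2\<close> is spent on the neighbourhood of the argument.\<close>

lemma el_dualI:
  assumes G: "\<And>x. x \<in> carrier E \<Longrightarrow> G x \<in> borel_measurable M"
    and add: "\<And>x y. x \<in> carrier E \<Longrightarrow> y \<in> carrier E \<Longrightarrow> AE w in M. G (x \<oplus> y) w = G x w + G y w"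
    and smult: "\<And>u x. u \<in> borel_measurable M \<Longrightarrow> x \<in> carrier E \<Longrightarrow>
      AE w in M. G (ae_class M u \<odot> x) w = u w * G x w"
    and Q: "finite Q" "Q \<subseteq> P" and \<zeta> [measurable]: "\<zeta> \<in> borel_measurable M"
    and bound: "\<And>x. x \<in> carrier E \<Longrightarrow> AE w in M. \<bar>G x w\<bar> \<le> \<zeta> w * sum_norm Q x w"
  shows "(\<lambda>x\<in>carrier E. ae_class M (G x)) \<in> el_dual M E P"
proof -
  interpret L: random_locally_convex_module M "L0 M" "{L0_abs M}"
    by (rule L0_random_locally_convex_module) (rule prob_space_axioms)
  let ?g = "\<lambda>x\<in>carrier E. ae_class M (G x)"
  have g_add: "?g (x \<oplus> y) = ?g x \<oplus>\<^bsub>L0 M\<^esub> ?g y" if "x \<in> carrier E" "y \<in> carrier E" for x y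
    using that G add[OF that] by (simp add: lift2_add_ae_class ae_class_eq_iff)
  have g_smult: "?g (\<xi> \<odot> x) = \<xi> \<otimes>\<^bsub>L0 M\<^esub> ?g x" if "\<xi> \<in> carrier (L0 M)" "x \<in> carrier E" for \<xi> x
  proof -
    define u where "u = rep \<xi>"
    have u: "u \<in> borel_measurable M" "\<xi> = ae_class M u"
      using rep_in_class[of \<xi> M] that by (auto simp: u_def)
    show ?thesis
      using that G u smult[of u x] by (simp add: lift2_mult_ae_class ae_class_eq_iff)
  qed
  have "continuous_map (el_topology M E P) (L0_topology M) ?g"
    unfolding continuous_map topspace_el_topology L.topspace_el_topology
      openin_el_topology L.openin_el_topology
  proof (intro conjI allI impI)
    show "?g ` carrier E \<subseteq> carrier (L0 M)" using G by (auto simp: ae_class_carrier)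
    fix W assume W: "el_open M (L0 M) {L0_abs M} W"
    show "el_open M E P {x \<in> carrier E. ?g x \<in> W}"
      unfolding el_open_def
    proof (intro conjI ballI)
      fix x assume "x \<in> {x \<in> carrier E. ?g x \<in> W}"
      then have x: "x \<in> carrier E" "?g x \<in> W" by auto
      then obtain Q0 \<epsilon> l where 0: "Q0 \<subseteq> {L0_abs M}" "0 < \<epsilon>" "0 < l" "l < 1"
        "(\<lambda>y. ?g x \<oplus>\<^bsub>L0 M\<^esub> y) ` el_nhd M (L0 M) Q0 \<epsilon> l \<subseteq> W"
        using W unfolding el_open_def by metis
      have "(\<lambda>n. prob {w \<in> space M. real n < \<zeta> w}) \<longlonglongrightarrow> prob (\<Inter>n. {w \<in> space M. real n < \<zeta> w})"
        by (intro finite_Lim_measure_decseq) (auto simp: decseq_def intro: order_le_less_trans[rotated])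
      also have "(\<Inter>n. {w \<in> space M. real n < \<zeta> w}) = {}"
        by auto (meson reals_Archimedean2 less_asym)
      finally have "(\<lambda>n. prob {w \<in> space M. real n < \<zeta> w}) \<longlonglongrightarrow> 0" by simp
      then have "\<forall>\<^sub>F n in sequentially. prob {w \<in> space M. real n < \<zeta> w} < l / 2"
        using \<open>0 < l\<close> by (intro order_tendstoD) auto
      then obtain n where n: "prob {w \<in> space M. real n < \<zeta> w} < l / 2"
        by (auto simp: eventually_sequentially)
      \<comment> \<open>The first factor is the loss in passing from the supremum of the seminorms
        to their sum, the second a positive constant above \<open>\<zeta>\<close> off the
        exceptional event.\<close>
      define k where "k = (real (card Q) + 1) * (real n + 1)"
      have k: "0 < k" by (simp add: k_def add_nonneg_pos)
      have nhd: "?g y \<in> el_nhd M (L0 M) Q0 \<epsilon> l" if y: "y \<in> el_nhd M E Q (\<epsilon> / k) (l / 2)" for y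
      proof -
        have yE: "y \<in> carrier E" using y by (simp add: el_nhd_def)
        note [measurable] = measurable_sum_norm[OF Q(2) yE] G[OF yE]
        have eq: "(real (card Q) + 1) * (\<epsilon> / k) = \<epsilon> / (real n + 1)"
          by (simp add: k_def add_nonneg_eq_0_iff)
        let ?A = "{w \<in> space M. sum_norm Q y w < \<epsilon> / (real n + 1)}"
        let ?B = "{w \<in> space M. real n < \<zeta> w}"
        have A: "prob ?A > 1 - l / 2"
          using el_nhdD[OF Q y] k \<open>0 < \<epsilon>\<close> unfolding eq by simp
        have "prob ?A \<le> prob (?A - ?B) + prob ?B"
          using measure_Un_le[of "?A - ?B" M ?B] finite_measure_mono[of ?A "(?A - ?B) \<union> ?B"]
          by (auto intro: order_trans)
        moreover have "prob (?A - ?B) \<le> prob {w \<in> space M. \<bar>G y w\<bar> < \<epsilon>}"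
        proof (intro finite_measure_mono_AE)
          show "AE w in M. w \<in> ?A - ?B \<longrightarrow> w \<in> {w \<in> space M. \<bar>G y w\<bar> < \<epsilon>}"
            using bound[OF yE] sum_norm_nonneg[OF Q yE]
          proof eventually_elim
            case (elim w)
            show ?case
            proof
              assume w: "w \<in> ?A - ?B"
              then have "\<zeta> w \<le> real n + 1" by auto
              from mult_right_mono[OF this elim(2)]
              have "\<bar>G y w\<bar> \<le> (real n + 1) * sum_norm Q y w" using elim(1) by linarith
              also have "\<dots> < \<epsilon>" using w by (auto simp: field_simps)
              finally show "w \<in> {w \<in> space M. \<bar>G y w\<bar> < \<epsilon>}" using w by simp
            qed
          qed
        qed measurable
        ultimately have "prob {w \<in> space M. \<bar>G y w\<bar> < \<epsilon>} > 1 - l" using A n by linarith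
        then show ?thesis
          using L0_el_nhdI[OF prob_space_axioms 0(1) G[OF yE] 0(2)] yE by simp
      qed
      have "(\<lambda>y. x \<oplus> y) ` el_nhd M E Q (\<epsilon> / k) (l / 2) \<subseteq> {x \<in> carrier E. ?g x \<in> W}"
      proof (rule image_subsetI)
        fix y assume y: "y \<in> el_nhd M E Q (\<epsilon> / k) (l / 2)"
        then have yE: "y \<in> carrier E" by (simp add: el_nhd_def)
        have "?g (x \<oplus> y) \<in> W"
          unfolding g_add[OF x(1) yE] using 0(5) nhd[OF y] by blast
        then show "x \<oplus> y \<in> {x \<in> carrier E. ?g x \<in> W}" using x(1) yE by simp
      qed
      moreover have "0 < \<epsilon> / k" "0 < l / 2" "l / 2 < 1" using 0 k by auto
      ultimately show "\<exists>Q \<epsilon> l. finite Q \<and> Q \<subseteq> P \<and> 0 < \<epsilon> \<and> 0 < l \<and> l < 1 \<and>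
          (\<lambda>y. x \<oplus> y) ` el_nhd M E Q \<epsilon> l \<subseteq> {x \<in> carrier E. ?g x \<in> W}"
        using Q by blast
    qed auto
  qed
  with g_add g_smult G show ?thesis
    unfolding el_dual_def by (auto simp: ae_class_carrier)
qed

text \<open>Closedness in the product topology becomes one condition on one event: smallness of the
  sum of both norms forces each of them to be small, so the minima of the two radii and of the two
  probability bounds suffice.\<close>

lemma closed_epi_nhd:
  assumes f: "el_lsc M E P f" and x: "x \<in> carrier E" and r: "r \<in> borel_measurable M"
    and notin: "(x, ae_class M r) \<notin> epi M E f"
  obtains Q \<epsilon> l where "finite Q" "Q \<subseteq> P" "0 < \<epsilon>" "0 < l"
    "\<And>y t. y \<in> carrier E \<Longrightarrow> t \<in> borel_measurable M \<Longrightarrow>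
      prob {w \<in> space M. sum_norm Q y w + \<bar>t w\<bar> < \<epsilon>} > 1 - l \<Longrightarrow>
      (x \<oplus> y, ae_class M (\<lambda>w. r w + t w)) \<notin> epi M E f"
proof -
  interpret L: random_locally_convex_module M "L0 M" "{L0_abs M}"
    by (rule L0_random_locally_convex_module) (rule prob_space_axioms)
  let ?T = "prod_topology (el_topology M E P) (L0_topology M)"
  have o: "openin ?T (topspace ?T - epi M E f)"
    using f unfolding el_lsc_def closedin_def by auto
  have m: "(x, ae_class M r) \<in> topspace ?T - epi M E f"
    using notin x r by (simp add: topspace_el_topology L.topspace_el_topology ae_class_carrier)
  obtain U W where UW: "openin (el_topology M E P) U" "openin (L0_topology M) W"
      "x \<in> U" "ae_class M r \<in> W" "U \<times> W \<subseteq> topspace ?T - epi M E f"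
    using openin_prod_topology_alt[THEN iffD1, rule_format, OF o m] by (elim exE conjE) (rule that)
  obtain Q1 e1 l1 where 1: "finite Q1" "Q1 \<subseteq> P" "0 < e1" "0 < l1"
      "(\<lambda>y. x \<oplus> y) ` el_nhd M E Q1 e1 l1 \<subseteq> U"
    using UW(1,3) unfolding openin_el_topology el_open_def by metis
  obtain Q2 e2 l2 where 2: "Q2 \<subseteq> {L0_abs M}" "0 < e2" "0 < l2"
      "(\<lambda>y. ae_class M r \<oplus>\<^bsub>L0 M\<^esub> y) ` el_nhd M (L0 M) Q2 e2 l2 \<subseteq> W"
    using UW(2,4) unfolding L.openin_el_topology el_open_def by metis
  show ?thesis
  proof (rule that[of Q1 "min e1 e2" "min l1 l2"])
    fix y t assume y: "y \<in> carrier E" and t: "t \<in> borel_measurable M"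
      and pr: "prob {w \<in> space M. sum_norm Q1 y w + \<bar>t w\<bar> < min e1 e2} > 1 - min l1 l2"
    note [measurable] = measurable_sum_norm[OF 1(2) y] t
    have "prob {w \<in> space M. sum_norm Q1 y w + \<bar>t w\<bar> < min e1 e2} \<le> prob {w \<in> space M. sum_norm Q1 y w < e1}"
      by (rule finite_measure_mono) auto
    moreover have "prob {w \<in> space M. sum_norm Q1 y w + \<bar>t w\<bar> < min e1 e2} \<le> prob {w \<in> space M. \<bar>t w\<bar> < e2}"
      using sum_norm_nonneg[OF 1(1,2) y] by (intro finite_measure_mono_AE) auto
    ultimately have "y \<in> el_nhd M E Q1 e1 l1" "ae_class M t \<in> el_nhd M (L0 M) Q2 e2 l2"
      using pr 1 2 y t by (auto intro!: el_nhdI L0_el_nhdI prob_space_axioms)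
    then have "(x \<oplus> y, ae_class M r \<oplus>\<^bsub>L0 M\<^esub> ae_class M t) \<in> U \<times> W"
      using 1(5) 2(4) by blast
    with UW(5) show "(x \<oplus> y, ae_class M (\<lambda>w. r w + t w)) \<notin> epi M E f"
      using r t by (auto simp: lift2_add_ae_class)
  qed (use 1 2 in auto)
qed

end

section \<open>Closed convex functions\<close>

locale lsc_convex_function = random_locally_convex_module M E P
  for M :: "'w measure" and E :: "(('w \<Rightarrow> real) set, 'e, 'm) module_scheme" (structure)
    and P :: "('e \<Rightarrow> ('w \<Rightarrow> real) set) set" +
  fixes f :: "'e \<Rightarrow> ('w \<Rightarrow> ereal) set"
  assumes f_carrier: "f \<in> carrier E \<rightarrow> carrier (Lbar M)"
    and f_proper: "proper M E f"
    and f_lsc: "el_lsc M E P f"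
    and f_convex: "L0_convex M E f"
begin

sublocale V: rv_module M "pair_module M E"
  by (rule rv_module_pair_module)

abbreviation F :: "'e \<Rightarrow> 'w \<Rightarrow> ereal" where "F x \<equiv> rep (f x)"

lemma measurable_F [measurable (raw)]: "x \<in> carrier E \<Longrightarrow> F x \<in> borel_measurable M"
  using f_carrier by (intro rep_in_class(2)) auto

lemma f_eq: "x \<in> carrier E \<Longrightarrow> f x = ae_class M (F x)"
  using f_carrier by (intro rep_in_class(3)[symmetric]) auto

lemma F_not_MInf: "x \<in> carrier E \<Longrightarrow> AE w in M. - \<infinity> < F x w"
  using f_proper by (simp add: proper_def)

lemma F_convex:
  assumes x: "x \<in> carrier E" "y \<in> carrier E"
    and \<theta> [measurable]: "\<theta> \<in> borel_measurable M" and \<theta>01: "\<And>w. 0 \<le> \<theta> w \<and> \<theta> w \<le> 1"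
  shows "AE w in M. F (ae_class M \<theta> \<odot> x \<oplus> ae_class M (\<lambda>w. 1 - \<theta> w) \<odot> y) w \<le>
    ereal (\<theta> w) * F x w + ereal (1 - \<theta> w) * F y w"
proof -
  note [measurable] = measurable_F[OF x(1)] measurable_F[OF x(2)]
  have "ae_class M \<theta> \<in> L0_plus M" "as_le M (ae_class M \<theta>) \<one>\<^bsub>L0 M\<^esub>"
    using \<theta>01 by (auto simp: L0_plus_def ae_class_carrier as_le_ae_class)
  then have "f (ae_class M \<theta> \<odot> x \<oplus> ae_class M (\<lambda>w. 1 - \<theta> w) \<odot> y) \<sqsubseteq>\<^bsub>Lbar M\<^esub>
      lift2 M (+) (lift2 M (*) (ext_class M (ae_class M \<theta>)) (f x))
        (lift2 M (*) (ext_class M (ae_class M (\<lambda>w. 1 - \<theta> w))) (f y))"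
    using f_convex x unfolding L0_convex_def
    by (metis L0_one_minus_ae_class[OF prob_space_axioms \<theta>])
  moreover have "lift2 M (*) (ext_class M (ae_class M u)) (f z) = ae_class M (\<lambda>w. ereal (u w) * F z w)"
    if [measurable]: "u \<in> borel_measurable M" and z: "z \<in> carrier E" for u z
  proof -
    note [measurable] = measurable_F[OF z]
    have "ext_class M (ae_class M u) = ae_class M (\<lambda>w. ereal (u w))"
      by (rule lift1_ae_class) measurable
    then show ?thesis
      by (subst f_eq[OF z]) (simp, rule lift2_ae_class, measurable)
  qed
  moreover have "lift2 M (+) (ae_class M (\<lambda>w. ereal (\<theta> w) * F x w)) (ae_class M (\<lambda>w. ereal (1 - \<theta> w) * F y w))
      = ae_class M (\<lambda>w. ereal (\<theta> w) * F x w + ereal (1 - \<theta> w) * F y w)"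
    by (rule lift2_ae_class) measurable
  ultimately have "as_le M (f (ae_class M \<theta> \<odot> x \<oplus> ae_class M (\<lambda>w. 1 - \<theta> w) \<odot> y))
      (ae_class M (\<lambda>w. ereal (\<theta> w) * F x w + ereal (1 - \<theta> w) * F y w))"
    using x by simp
  moreover have "AE w in M. rep (ae_class M (\<lambda>w. ereal (\<theta> w) * F x w + ereal (1 - \<theta> w) * F y w)) w =
      ereal (\<theta> w) * F x w + ereal (1 - \<theta> w) * F y w"
    by (rule rep_ae_class) measurable
  ultimately show ?thesis
    unfolding as_le_def by eventually_elim simp
qed

text \<open>The epigraph with functions as second coordinates, as a subset of
  \<open>pair_module M E\<close>, where the separation theorem applies.\<close>

definition epi_fun :: "('e \<times> ('w \<Rightarrow> real)) set" where
  "epi_fun = {(x, r). x \<in> carrier E \<and> r \<in> borel_measurable M \<and> (AE w in M. F x w \<le> ereal (r w))}"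

lemma epi_fun_iff:
  assumes x: "x \<in> carrier E" and r [measurable]: "r \<in> borel_measurable M"
  shows "(x, r) \<in> epi_fun \<longleftrightarrow> (x, ae_class M r) \<in> epi M E f"
proof -
  note [measurable] = measurable_F[OF x]
  have "ext_class M (ae_class M r) = ae_class M (\<lambda>w. ereal (r w))"
    by (rule lift1_ae_class) measurable
  then have "as_le M (f x) (ext_class M (ae_class M r)) \<longleftrightarrow> (AE w in M. F x w \<le> ereal (r w))"
    using as_le_ae_class[of "F x" M "\<lambda>w. ereal (r w)"] by (simp add: f_eq[OF x, symmetric])
  with x show ?thesis by (simp add: epi_fun_def epi_def ae_class_carrier)
qed

lemma epi_fun_convex:
  assumes c: "c \<in> epi_fun" "c' \<in> epi_fun"
    and \<theta> [measurable]: "\<theta> \<in> borel_measurable M" and \<theta>01: "\<And>w. 0 \<le> \<theta> w \<and> \<theta> w \<le> 1"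
  shows "\<theta> \<odot>\<^bsub>pair_module M E\<^esub> c \<oplus>\<^bsub>pair_module M E\<^esub> (\<lambda>w. 1 - \<theta> w) \<odot>\<^bsub>pair_module M E\<^esub> c' \<in> epi_fun"
proof -
  obtain x r y s where [simp]: "c = (x, r)" "c' = (y, s)" by (cases c, cases c')
  have x: "x \<in> carrier E" "y \<in> carrier E" and [measurable]: "r \<in> borel_measurable M" "s \<in> borel_measurable M"
    and le: "AE w in M. F x w \<le> ereal (r w)" "AE w in M. F y w \<le> ereal (s w)"
    using c by (auto simp: epi_fun_def)
  have "AE w in M. F (ae_class M \<theta> \<odot> x \<oplus> ae_class M (\<lambda>w. 1 - \<theta> w) \<odot> y) w \<le>
      ereal (\<theta> w * r w + (1 - \<theta> w) * s w)"
    using F_convex[OF x \<theta> \<theta>01] le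
  proof eventually_elim
    case (elim w)
    have "ereal (\<theta> w) * F x w \<le> ereal (\<theta> w) * ereal (r w)"
      using \<theta>01[of w] elim by (intro ereal_mult_left_mono) auto
    moreover have "ereal (1 - \<theta> w) * F y w \<le> ereal (1 - \<theta> w) * ereal (s w)"
      using \<theta>01[of w] elim by (intro ereal_mult_left_mono) auto
    ultimately have "ereal (\<theta> w) * F x w + ereal (1 - \<theta> w) * F y w \<le>
        ereal (\<theta> w) * ereal (r w) + ereal (1 - \<theta> w) * ereal (s w)"
      by (rule add_mono)
    with elim(1) show ?case by (auto intro: order_trans)
  qed
  with x show ?thesis by (simp add: epi_fun_def)
qed

text \<open>Such a point serves as a filler: a point of the epigraph known only on an event is
  continued by it elsewhere. It is also the point under which the second separation takes place when
  the first one is vertical.\<close>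

lemma dom_point:
  obtains x r where "x \<in> carrier E" "r \<in> borel_measurable M" "AE w in M. F x w = ereal (r w)"
proof -
  obtain x where x: "x \<in> carrier E" "AE w in M. \<bar>F x w\<bar> < \<infinity>"
    using f_proper by (auto simp: proper_def edom_def)
  note [measurable] = measurable_F[OF x(1)]
  show ?thesis
  proof (rule that[OF x(1)])
    show "(\<lambda>w. real_of_ereal (F x w)) \<in> borel_measurable M" by measurable
    show "AE w in M. F x w = ereal (real_of_ereal (F x w))"
      using x(2) by eventually_elim (auto simp: ereal_real)
  qed
qed

section \<open>Random norm and distance on pairs\<close>

definition pair_norm :: "('e \<Rightarrow> ('w \<Rightarrow> real) set) set \<Rightarrow> 'e \<times> ('w \<Rightarrow> real) \<Rightarrow> 'w \<Rightarrow> real" where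
  "pair_norm Q v w = sum_norm Q (fst v) w + \<bar>snd v w\<bar>"

lemma measurable_pair_norm:
  assumes "Q \<subseteq> P" "v \<in> carrier (pair_module M E)"
  shows "pair_norm Q v \<in> borel_measurable M"
proof -
  have [measurable]: "snd v \<in> borel_measurable M" "sum_norm Q (fst v) \<in> borel_measurable M"
    using assms measurable_sum_norm[of Q "fst v"] by auto
  show ?thesis unfolding pair_norm_def by measurable
qed

lemma pair_norm_nonneg:
  assumes "finite Q" "Q \<subseteq> P" "v \<in> carrier (pair_module M E)"
  shows "AE w in M. 0 \<le> pair_norm Q v w"
proof -
  have "AE w in M. 0 \<le> sum_norm Q (fst v) w" using assms by (intro sum_norm_nonneg) auto
  then show ?thesis by eventually_elim (auto simp: pair_norm_def)
qed

lemma pair_norm_add: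
  assumes "finite Q" "Q \<subseteq> P" "u \<in> carrier (pair_module M E)" "v \<in> carrier (pair_module M E)"
  shows "AE w in M. pair_norm Q (u \<oplus>\<^bsub>pair_module M E\<^esub> v) w \<le> pair_norm Q u w + pair_norm Q v w"
proof -
  have "AE w in M. sum_norm Q (fst u \<oplus> fst v) w \<le> sum_norm Q (fst u) w + sum_norm Q (fst v) w"
    using assms by (intro sum_norm_add) auto
  then show ?thesis
    by eventually_elim (cases u; cases v; auto simp: pair_norm_def)
qed

lemma pair_norm_smult:
  assumes "finite Q" "Q \<subseteq> P" "u \<in> borel_measurable M" "v \<in> carrier (pair_module M E)"
  shows "AE w in M. pair_norm Q (u \<odot>\<^bsub>pair_module M E\<^esub> v) w = \<bar>u w\<bar> * pair_norm Q v w"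
proof -
  have "AE w in M. sum_norm Q (ae_class M u \<odot> fst v) w = \<bar>u w\<bar> * sum_norm Q (fst v) w"
    using assms by (intro sum_norm_smult) auto
  then show ?thesis
    by eventually_elim (cases v; auto simp: pair_norm_def abs_mult distrib_left)
qed

definition dist_norm :: "('e \<Rightarrow> ('w \<Rightarrow> real) set) set \<Rightarrow> 'e \<times> ('w \<Rightarrow> real) \<Rightarrow> 'e \<times> ('w \<Rightarrow> real) \<Rightarrow> 'w \<Rightarrow> real" where
  "dist_norm Q c z = pair_norm Q (c \<oplus>\<^bsub>pair_module M E\<^esub> (\<lambda>_. -1) \<odot>\<^bsub>pair_module M E\<^esub> z)"

lemma epi_fun_carrier: "c \<in> epi_fun \<Longrightarrow> c \<in> carrier (pair_module M E)"
  by (auto simp: epi_fun_def)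

lemma measurable_dist_norm:
  assumes "Q \<subseteq> P" "c \<in> carrier (pair_module M E)" "z \<in> carrier (pair_module M E)"
  shows "dist_norm Q c z \<in> borel_measurable M"
  unfolding dist_norm_def using assms
  by (intro measurable_pair_norm V.M.a_closed V.smult_in_carrier) auto

lemma dist_norm_convex:
  assumes Q: "finite Q" "Q \<subseteq> P" and c: "c \<in> carrier (pair_module M E)" "c' \<in> carrier (pair_module M E)"
    and z: "z \<in> carrier (pair_module M E)"
    and \<theta> [measurable]: "\<theta> \<in> borel_measurable M" and \<theta>01: "\<And>w. 0 \<le> \<theta> w \<and> \<theta> w \<le> 1"
  shows "AE w in M. dist_norm Q (\<theta> \<odot>\<^bsub>pair_module M E\<^esub> c \<oplus>\<^bsub>pair_module M E\<^esub>
      (\<lambda>w. 1 - \<theta> w) \<odot>\<^bsub>pair_module M E\<^esub> c') z w \<le> \<theta> w * dist_norm Q c z w + (1 - \<theta> w) * dist_norm Q c' z w"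
proof -
  let ?V = "pair_module M E"
  define m where "m = (\<lambda>_. -1) \<odot>\<^bsub>?V\<^esub> z"
  have m: "m \<in> carrier ?V" unfolding m_def by (rule V.smult_in_carrier) (use z in auto)
  define a b where "a = c \<oplus>\<^bsub>?V\<^esub> m" and "b = c' \<oplus>\<^bsub>?V\<^esub> m"
  have ab: "a \<in> carrier ?V" "b \<in> carrier ?V"
    unfolding a_def b_def by (intro V.M.a_closed c m)+
  let ?\<theta>' = "\<lambda>w. 1 - \<theta> w"
  have \<theta>' [measurable]: "?\<theta>' \<in> borel_measurable M" by measurable
  \<comment> \<open>A fixed vector is a convex combination of itself, so the translation by the
    negative of \<open>z\<close> commutes with convex combinations.\<close>
  have "\<theta> \<odot>\<^bsub>?V\<^esub> m \<oplus>\<^bsub>?V\<^esub> ?\<theta>' \<odot>\<^bsub>?V\<^esub> m = m"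
    using V.smult_add_left[OF \<theta> \<theta>' m] V.one_smult[OF m] by simp
  moreover have "\<theta> \<odot>\<^bsub>?V\<^esub> a \<oplus>\<^bsub>?V\<^esub> ?\<theta>' \<odot>\<^bsub>?V\<^esub> b =
      (\<theta> \<odot>\<^bsub>?V\<^esub> c \<oplus>\<^bsub>?V\<^esub> ?\<theta>' \<odot>\<^bsub>?V\<^esub> c') \<oplus>\<^bsub>?V\<^esub> (\<theta> \<odot>\<^bsub>?V\<^esub> m \<oplus>\<^bsub>?V\<^esub> ?\<theta>' \<odot>\<^bsub>?V\<^esub> m)"
    unfolding a_def b_def V.smult_add_right[OF \<theta> c(1) m] V.smult_add_right[OF \<theta>' c(2) m]
    using V.smult_in_carrier[OF \<theta> c(1)] V.smult_in_carrier[OF \<theta>' c(2)]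
      V.smult_in_carrier[OF \<theta> m] V.smult_in_carrier[OF \<theta>' m]
    by (simp only: V.M.a_ac V.M.a_closed)
  ultimately have e: "(\<theta> \<odot>\<^bsub>?V\<^esub> c \<oplus>\<^bsub>?V\<^esub> ?\<theta>' \<odot>\<^bsub>?V\<^esub> c') \<oplus>\<^bsub>?V\<^esub> m = \<theta> \<odot>\<^bsub>?V\<^esub> a \<oplus>\<^bsub>?V\<^esub> ?\<theta>' \<odot>\<^bsub>?V\<^esub> b"
    by simp
  have "AE w in M. pair_norm Q (\<theta> \<odot>\<^bsub>?V\<^esub> a \<oplus>\<^bsub>?V\<^esub> ?\<theta>' \<odot>\<^bsub>?V\<^esub> b) w \<le>
      pair_norm Q (\<theta> \<odot>\<^bsub>?V\<^esub> a) w + pair_norm Q (?\<theta>' \<odot>\<^bsub>?V\<^esub> b) w"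
    by (intro pair_norm_add Q V.smult_in_carrier ab \<theta> \<theta>')
  with pair_norm_smult[OF Q \<theta> ab(1)] pair_norm_smult[OF Q \<theta>' ab(2)]
  show ?thesis
    unfolding dist_norm_def m_def[symmetric] e a_def[symmetric] b_def[symmetric]
  proof eventually_elim
    case (elim w)
    then show ?case using \<theta>01[of w] by simp
  qed
qed

text \<open>Two points are glued along the event where the first is the closer one: the weight
  \<open>\<theta>\<close> is the indicator of that event, so the combination has at most the smaller
  distance at every point and stays in the epigraph by convexity. The distances are thus directed
  downwards.\<close>

lemma dist_norm_directed:
  assumes Q: "finite Q" "Q \<subseteq> P" and z: "z \<in> carrier (pair_module M E)" and c: "\<And>i::nat. c i \<in> epi_fun"
  shows "\<exists>b\<in>epi_fun. AE w in M. \<forall>i\<le>n. dist_norm Q b z w \<le> dist_norm Q (c i) z w"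
proof (induction n)
  case 0
  show ?case using c[of 0] by (intro bexI[of _ "c 0"]) auto
next
  case (Suc n)
  then obtain b where b: "b \<in> epi_fun" "AE w in M. \<forall>i\<le>n. dist_norm Q b z w \<le> dist_norm Q (c i) z w"
    by auto
  define \<theta> where "\<theta> w = (if dist_norm Q b z w \<le> dist_norm Q (c (Suc n)) z w then 1 else 0 :: real)" for w
  note carr = epi_fun_carrier[OF b(1)] epi_fun_carrier[OF c[of "Suc n"]]
  note [measurable] = measurable_dist_norm[OF Q(2) carr(1) z] measurable_dist_norm[OF Q(2) carr(2) z]
  have \<theta>: "\<theta> \<in> borel_measurable M" "\<And>w. 0 \<le> \<theta> w \<and> \<theta> w \<le> 1"
    unfolding \<theta>_def by (measurable; fail) auto
  show ?case
  proof (rule bexI[OF _ epi_fun_convex[OF b(1) c[of "Suc n"] \<theta>]])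
    show "AE w in M. \<forall>i\<le>Suc n. dist_norm Q (\<theta> \<odot>\<^bsub>pair_module M E\<^esub> b \<oplus>\<^bsub>pair_module M E\<^esub>
      (\<lambda>w. 1 - \<theta> w) \<odot>\<^bsub>pair_module M E\<^esub> c (Suc n)) z w \<le> dist_norm Q (c i) z w"
      using dist_norm_convex[OF Q carr z \<theta>] b(2)
    proof eventually_elim
      case (elim w)
      show ?case
      proof (intro allI impI)
        fix i assume "i \<le> Suc n"
        then have "i \<le> n \<or> i = Suc n" by auto
        then have "\<theta> w * dist_norm Q b z w + (1 - \<theta> w) * dist_norm Q (c (Suc n)) z w \<le> dist_norm Q (c i) z w"
          using elim(2) by (fastforce simp: \<theta>_def)
        with elim(1) show "dist_norm Q (\<theta> \<odot>\<^bsub>pair_module M E\<^esub> b \<oplus>\<^bsub>pair_module M E\<^esub>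
          (\<lambda>w. 1 - \<theta> w) \<odot>\<^bsub>pair_module M E\<^esub> c (Suc n)) z w \<le> dist_norm Q (c i) z w"
          by (rule order_trans)
      qed
    qed
  qed
qed

text \<open>If the essential infimum of the distances were zero on \<open>A\<close>, finitely many
  points of the epigraph would have some distance below \<open>\<epsilon>\<close> on
  \<open>A\<close>, up to an event of small probability. Gluing them gives one point close to
  \<open>(x0, r)\<close> on most of \<open>A\<close>, and completing it by the filler off
  \<open>A\<close> gives a point inside a neighbourhood that misses the epigraph.\<close>

lemma epi_fun_distance:
  assumes x0: "x0 \<in> carrier E" and r [measurable]: "r \<in> borel_measurable M" and A [measurable]: "A \<in> events"
    and pos: "0 < prob A" and below: "AE w in M. w \<in> A \<longrightarrow> ereal (r w) < F x0 w"
  obtains Q d where "finite Q" "Q \<subseteq> P" "d \<in> borel_measurable M"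
    "\<And>c. c \<in> epi_fun \<Longrightarrow> AE w in M. d w \<le> dist_norm Q c (x0, r) w"
    "0 < prob {w \<in> A. 0 < d w}"
proof (rule ccontr)
  assume "\<not> thesis"
  with that have contra: "\<not> 0 < prob {w \<in> A. 0 < d w}" if "finite Q" "Q \<subseteq> P" "d \<in> borel_measurable M"
    "\<And>c. c \<in> epi_fun \<Longrightarrow> AE w in M. d w \<le> dist_norm Q c (x0, r) w" for Q d
    using that by blast
  let ?V = "pair_module M E"
  have z: "(x0, r) \<in> carrier ?V" using x0 by simp
  obtain x1 r1 where x1: "x1 \<in> carrier E" and r1 [measurable]: "r1 \<in> borel_measurable M"
    and F1: "AE w in M. F x1 w = ereal (r1 w)" by (rule dom_point)
  have c1: "(x1, r1) \<in> epi_fun"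
    using x1 F1 by (auto simp: epi_fun_def)
  define \<kappa> where "\<kappa> w = (if w \<in> A then 1 else 0 :: real)" for w
  have \<kappa> [measurable]: "\<kappa> \<in> borel_measurable M" unfolding \<kappa>_def by measurable
  have \<kappa>01: "0 \<le> \<kappa> w \<and> \<kappa> w \<le> 1" for w by (simp add: \<kappa>_def)
  \<comment> \<open>Off \<open>A\<close> nothing brings the epigraph near \<open>(x0, r)\<close>,
    while neighbourhoods are measured on the whole space. The base point is therefore replaced off
    \<open>A\<close> by the filler, which the approximating point can match exactly there.\<close>
  define x' where "x' = ae_class M \<kappa> \<odot> x0 \<oplus> ae_class M (\<lambda>w. 1 - \<kappa> w) \<odot> x1"
  define r' where "r' w = \<kappa> w * r w + (1 - \<kappa> w) * r1 w" for w
  have x': "x' \<in> carrier E" unfolding x'_def using x0 x1 by simp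
  have r' [measurable]: "r' \<in> borel_measurable M" unfolding r'_def by measurable
  have "(x', r') \<notin> epi_fun"
  proof
    assume "(x', r') \<in> epi_fun"
    then have "AE w in M. F x' w \<le> ereal (r' w)" by (simp add: epi_fun_def)
    \<comment> \<open>Writing \<open>x0\<close> as \<open>x'\<close> on \<open>A\<close> and
      \<open>x0\<close> elsewhere makes convexity yield \<open>F x0 \<le> F x'\<close> on
      \<open>A\<close>, which contradicts \<open>below\<close>.\<close>
    moreover have "ae_class M \<kappa> \<odot> x' \<oplus> ae_class M (\<lambda>w. 1 - \<kappa> w) \<odot> x0 = x0"
    proof -
      have "(\<lambda>w. \<kappa> w * \<kappa> w) = \<kappa>" "(\<lambda>w. \<kappa> w * (1 - \<kappa> w)) = (\<lambda>_. 0)"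
        by (auto simp: \<kappa>_def)
      then have "ae_class M \<kappa> \<odot> x' = ae_class M \<kappa> \<odot> x0"
        unfolding x'_def using x0 x1 by (simp add: scalar_add_right scalar_assoc)
      then show ?thesis using x0 by (simp add: scalar_add_left)
    qed
    then have "AE w in M. F x0 w \<le> ereal (\<kappa> w) * F x' w + ereal (1 - \<kappa> w) * F x0 w"
      using F_convex[OF x' x0 \<kappa> \<kappa>01] by simp
    ultimately have "AE w in M. w \<notin> A"
      using below
    proof eventually_elim
      case (elim w)
      show ?case
      proof
        assume w: "w \<in> A"
        then have "F x0 w \<le> F x' w" using elim(2) by (simp add: \<kappa>_def flip: one_ereal_def zero_ereal_def)
        also have "\<dots> \<le> ereal (r w)" using elim(1) w by (simp add: \<kappa>_def r'_def)
        finally show False using elim(3) w by simp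
      qed
    qed
    then have "A \<in> null_sets M" by (simp add: AE_iff_null_sets)
    with pos show False by (simp add: measure_eq_0_null_sets)
  qed
  then have "(x', ae_class M r') \<notin> epi M E f" by (simp add: epi_fun_iff[OF x' r'])
  from closed_epi_nhd[OF f_lsc x' r' this]
  obtain Q \<epsilon> l where Q: "finite Q" "Q \<subseteq> P" and \<epsilon>: "0 < \<epsilon>" and l: "0 < l"
    and far: "\<And>y t. y \<in> carrier E \<Longrightarrow> t \<in> borel_measurable M \<Longrightarrow>
      prob {w \<in> space M. sum_norm Q y w + \<bar>t w\<bar> < \<epsilon>} > 1 - l \<Longrightarrow>
      (x' \<oplus> y, ae_class M (\<lambda>w. r' w + t w)) \<notin> epi M E f" by blast
  define S where "S = (\<lambda>c. dist_norm Q c (x0, r)) ` epi_fun"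
  have S: "S \<subseteq> borel_measurable M" "S \<noteq> {}"
    using measurable_dist_norm[OF Q(2) epi_fun_carrier z] c1 by (auto simp: S_def)
  have S0: "AE w in M. 0 \<le> s w" if s: "s \<in> S" for s
  proof -
    obtain c where c: "c \<in> epi_fun" "s = dist_norm Q c (x0, r)" using s unfolding S_def by blast
    show ?thesis
      unfolding c(2) dist_norm_def
      by (intro pair_norm_nonneg Q V.M.a_closed V.smult_in_carrier epi_fun_carrier c z) simp
  qed
  obtain m U where m [measurable]: "m \<in> borel_measurable M" and m_le: "\<And>s. s \<in> S \<Longrightarrow> AE w in M. m w \<le> s w"
    and U: "\<And>n. U n \<in> S" and mU: "AE w in M. \<forall>e>0. \<exists>n::nat. U n w < m w + e"
    using essential_inf[OF S S0] by blast
  have U_meas [measurable]: "U n \<in> borel_measurable M" for n using U S(1) by auto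
  \<comment> \<open>The essential infimum is itself an admissible \<open>d\<close>, so the assumed
    failure of the lemma applies to it.\<close>
  have "\<not> 0 < prob {w \<in> A. 0 < m w}"
    using m_le by (intro contra[OF Q]) (auto simp: S_def)
  then have "prob {w \<in> A. 0 < m w} = 0" using measure_nonneg[of M "{w \<in> A. 0 < m w}"] by linarith
  then have "AE w in M. w \<notin> {w \<in> A. 0 < m w}"
    by (intro AE_not_in) (simp add: null_sets_def emeasure_eq_measure)
  then have m0: "AE w in M. w \<in> A \<longrightarrow> (\<exists>n. U n w < \<epsilon>)"
    using mU
  proof eventually_elim
    case (elim w)
    show ?case
    proof
      assume "w \<in> A"
      then have "m w \<le> 0" using elim(1) by auto
      moreover obtain n where "U n w < m w + \<epsilon>" using elim(2) \<epsilon> by auto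
      ultimately show "\<exists>n. U n w < \<epsilon>" by (intro exI[of _ n]) linarith
    qed
  qed
  \<comment> \<open>The part of \<open>A\<close> on which none of the first \<open>n + 1\<close>
    distances is below \<open>\<epsilon>\<close>. These events decrease to a null set.\<close>
  define B where "B n = {w \<in> A. \<forall>i\<le>n. \<epsilon> \<le> U i w}" for n
  have A_sub: "A \<subseteq> space M" using A by (rule sets.sets_into_space)
  have B_eq: "B n = A \<inter> {w \<in> space M. \<forall>i\<le>n. \<epsilon> \<le> U i w}" for n using A_sub by (auto simp: B_def)
  have B [measurable]: "B n \<in> events" for n unfolding B_eq by measurable
  have "(\<lambda>n. prob (B n)) \<longlonglongrightarrow> prob (\<Inter>n. B n)"
    using B by (intro finite_Lim_measure_decseq) (auto simp: decseq_def B_def)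
  moreover have "prob (\<Inter>n. B n) = 0"
  proof -
    have "AE w in M. w \<notin> (\<Inter>n. B n)"
      using m0 by eventually_elim (auto simp: B_def not_le)
    moreover have "(\<Inter>n. B n) \<in> events" by measurable
    ultimately have "(\<Inter>n. B n) \<in> null_sets M" by (simp add: AE_iff_null_sets)
    then show ?thesis by (simp add: measure_eq_0_null_sets)
  qed
  ultimately have "\<forall>\<^sub>F n in sequentially. prob (B n) < l"
    using l by (intro order_tendstoD) auto
  then obtain n where n: "prob (B n) < l" by (auto simp: eventually_sequentially)
  have "\<forall>i. \<exists>c. c \<in> epi_fun \<and> U i = dist_norm Q c (x0, r)" using U unfolding S_def by blast
  then obtain c where c: "\<And>i. c i \<in> epi_fun" "\<And>i. U i = dist_norm Q (c i) (x0, r)" by metis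
  have "\<exists>b\<in>epi_fun. AE w in M. \<forall>i\<le>n. dist_norm Q b (x0, r) w \<le> U i w"
    unfolding c(2) by (rule dist_norm_directed[OF Q z c(1)])
  then obtain b where b: "b \<in> epi_fun"
    "AE w in M. \<forall>i\<le>n. dist_norm Q b (x0, r) w \<le> U i w" by blast
  obtain y t where yt: "b = (y, t)" by (cases b)
  have y: "y \<in> carrier E" and t [measurable]: "t \<in> borel_measurable M"
    using b(1) by (auto simp: yt epi_fun_def)
  \<comment> \<open>\<open>v\<close> and \<open>\<tau>\<close> form the displacement from
    \<open>(x', r')\<close> to the point equal to \<open>b\<close> on \<open>A\<close> and to the
    filler elsewhere. It vanishes off \<open>A\<close>, and on \<open>A\<close> its norm is the
    distance of \<open>b\<close> from \<open>(x0, r)\<close>.\<close>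
  define v where "v = ae_class M \<kappa> \<odot> (y \<oplus> ae_class M (\<lambda>_. -1) \<odot> x0)"
  define \<tau> where "\<tau> w = \<kappa> w * (t w + - 1 * r w)" for w
  have v: "v \<in> carrier E" unfolding v_def using y x0 by simp
  have \<tau> [measurable]: "\<tau> \<in> borel_measurable M" unfolding \<tau>_def by measurable
  note [measurable] = measurable_sum_norm[OF Q(2) v]
  have "AE w in M. sum_norm Q v w = \<bar>\<kappa> w\<bar> * sum_norm Q (y \<oplus> ae_class M (\<lambda>_. -1) \<odot> x0) w"
    unfolding v_def using x0 y by (intro sum_norm_smult Q) auto
  then have "AE w in M. w \<in> space M - {w \<in> space M. sum_norm Q v w + \<bar>\<tau> w\<bar> < \<epsilon>} \<longrightarrow> w \<in> B n"
    using b(2)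
  proof eventually_elim
    case (elim w)
    show ?case
    proof
      assume w: "w \<in> space M - {w \<in> space M. sum_norm Q v w + \<bar>\<tau> w\<bar> < \<epsilon>}"
      have wA: "w \<in> A" using w elim(1) \<epsilon> by (cases "w \<in> A") (auto simp: \<tau>_def \<kappa>_def)
      have "sum_norm Q v w + \<bar>\<tau> w\<bar> = dist_norm Q b (x0, r) w"
        using elim(1) wA by (simp add: \<tau>_def \<kappa>_def dist_norm_def pair_norm_def yt)
      then show "w \<in> B n" using w wA elim(2) by (auto simp: B_def)
    qed
  qed
  then have "prob (space M - {w \<in> space M. sum_norm Q v w + \<bar>\<tau> w\<bar> < \<epsilon>}) \<le> prob (B n)"
    by (intro finite_measure_mono_AE) auto
  moreover have "prob (space M - {w \<in> space M. sum_norm Q v w + \<bar>\<tau> w\<bar> < \<epsilon>}) =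
      1 - prob {w \<in> space M. sum_norm Q v w + \<bar>\<tau> w\<bar> < \<epsilon>}"
    by (rule prob_compl) measurable
  ultimately have "prob {w \<in> space M. sum_norm Q v w + \<bar>\<tau> w\<bar> < \<epsilon>} > 1 - l"
    using n by linarith
  from far[OF v \<tau> this] have "(x' \<oplus> v, \<lambda>w. r' w + \<tau> w) \<notin> epi_fun"
    using x' v by (simp add: epi_fun_iff)
  moreover have "x' \<oplus> v = ae_class M \<kappa> \<odot> y \<oplus> ae_class M (\<lambda>w. 1 - \<kappa> w) \<odot> x1"
  proof -
    have "x' \<oplus> v = (ae_class M \<kappa> \<odot> x0 \<oplus> ae_class M (\<lambda>w. - \<kappa> w) \<odot> x0) \<oplus>
        (ae_class M \<kappa> \<odot> y \<oplus> ae_class M (\<lambda>w. 1 - \<kappa> w) \<odot> x1)"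
      unfolding x'_def v_def using x0 x1 y by (simp add: scalar_add_right scalar_assoc E.M.a_ac)
    also have "ae_class M \<kappa> \<odot> x0 \<oplus> ae_class M (\<lambda>w. - \<kappa> w) \<odot> x0 = \<zero>"
      using x0 by (simp add: scalar_add_left)
    finally show ?thesis using x1 y by simp
  qed
  moreover have "(\<lambda>w. r' w + \<tau> w) = (\<lambda>w. \<kappa> w * t w + (1 - \<kappa> w) * r1 w)"
    by (auto simp: r'_def \<tau>_def algebra_simps)
  ultimately show False
    using epi_fun_convex[OF b(1) c1 \<kappa> \<kappa>01] by (simp add: yt)
qed

text \<open>A homomorphism on pairs is determined by its restriction \<open>g\<close> to the pairs
  \<open>(x, 0)\<close> and its value \<open>s\<close> at \<open>(\<zero>, 1)\<close>. The bound on
  \<open>g\<close> is two-sided because the negative of \<open>x\<close> is tested too. The last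
  conclusion carries the proviso \<open>F x w < \<infinity>\<close> pointwise, as a value of
  \<open>f\<close> may be infinite on an event only.\<close>

lemma epi_separation:
  assumes x0: "x0 \<in> carrier E" and r [measurable]: "r \<in> borel_measurable M" and A [measurable]: "A \<in> events"
    and pos: "0 < prob A" and below: "AE w in M. w \<in> A \<longrightarrow> ereal (r w) < F x0 w"
  obtains Q g s d where "finite Q" "Q \<subseteq> P" "\<And>x. x \<in> carrier E \<Longrightarrow> g x \<in> borel_measurable M"
    "\<And>x y. x \<in> carrier E \<Longrightarrow> y \<in> carrier E \<Longrightarrow> AE w in M. g (x \<oplus> y) w = g x w + g y w"
    "\<And>u x. u \<in> borel_measurable M \<Longrightarrow> x \<in> carrier E \<Longrightarrow>
      AE w in M. g (ae_class M u \<odot> x) w = u w * g x w"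
    "\<And>x. x \<in> carrier E \<Longrightarrow> AE w in M. \<bar>g x w\<bar> \<le> sum_norm Q x w"
    "s \<in> borel_measurable M" "AE w in M. s w \<le> 0" "d \<in> borel_measurable M" "0 < prob {w \<in> A. 0 < d w}"
    "\<And>x. x \<in> carrier E \<Longrightarrow> AE w in M. F x w < \<infinity> \<longrightarrow>
      g x w + s w * real_of_ereal (F x w) + d w \<le> g x0 w + s w * r w"
proof -
  let ?V = "pair_module M E"
  have z: "(x0, r) \<in> carrier ?V" using x0 by simp
  from epi_fun_distance[OF x0 r A pos below]
  obtain Q d where Q: "finite Q" "Q \<subseteq> P" and d: "d \<in> borel_measurable M"
    and dist: "\<And>c. c \<in> epi_fun \<Longrightarrow> AE w in M. d w \<le> dist_norm Q c (x0, r) w"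
    and d_pos: "0 < prob {w \<in> A. 0 < d w}"
    by blast
  obtain x1 r1 where x1: "x1 \<in> carrier E" and r1 [measurable]: "r1 \<in> borel_measurable M"
    and F1: "AE w in M. F x1 w = ereal (r1 w)" by (rule dom_point)
  have epi_sub: "epi_fun \<subseteq> carrier ?V" using epi_fun_carrier by auto
  have "(x1, r1) \<in> epi_fun" using x1 F1 by (auto simp: epi_fun_def)
  then have epi_ne: "epi_fun \<noteq> {}" by blast
  from V.separation[OF measurable_pair_norm[OF Q(2)] pair_norm_add[OF Q] pair_norm_smult[OF Q]
      epi_sub epi_ne epi_fun_convex z d dist[unfolded dist_norm_def]]
  obtain G where G: "\<And>v. v \<in> carrier ?V \<Longrightarrow> G v \<in> borel_measurable M"
    and G_add: "\<And>u v. u \<in> carrier ?V \<Longrightarrow> v \<in> carrier ?V \<Longrightarrow> AE w in M. G (u \<oplus>\<^bsub>?V\<^esub> v) w = G u w + G v w"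
    and G_smult: "\<And>c v. c \<in> borel_measurable M \<Longrightarrow> v \<in> carrier ?V \<Longrightarrow> AE w in M. G (c \<odot>\<^bsub>?V\<^esub> v) w = c w * G v w"
    and G_le: "\<And>v. v \<in> carrier ?V \<Longrightarrow> AE w in M. G v w \<le> pair_norm Q v w"
    and G_sep: "\<And>c. c \<in> epi_fun \<Longrightarrow> AE w in M. G c w + d w \<le> G (x0, r) w"
    by blast
  define g where "g x = G (x, \<lambda>_. 0)" for x
  define s where "s = G (\<zero>, \<lambda>_. 1)"
  have g: "g x \<in> borel_measurable M" if "x \<in> carrier E" for x
    unfolding g_def using that by (intro G) auto
  have s [measurable]: "s \<in> borel_measurable M" unfolding s_def by (intro G) auto
  have g_add: "AE w in M. g (x \<oplus> y) w = g x w + g y w" if "x \<in> carrier E" "y \<in> carrier E" for x y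
    using G_add[of "(x, \<lambda>_. 0)" "(y, \<lambda>_. 0)"] that by (simp add: g_def)
  have g_smult: "AE w in M. g (ae_class M u \<odot> x) w = u w * g x w"
    if "u \<in> borel_measurable M" "x \<in> carrier E" for u x
    using G_smult[of u "(x, \<lambda>_. 0)"] that by (simp add: g_def)
  have G_split: "AE w in M. G (x, t) w = g x w + s w * t w"
    if x: "x \<in> carrier E" and t: "t \<in> borel_measurable M" for x t
  proof -
    have "ae_class M t \<odot> \<zero> = \<zero>"
      using E.smult_r_null[of "ae_class M t"] t by (simp add: ae_class_carrier)
    then have "(x, \<lambda>_. 0) \<oplus>\<^bsub>?V\<^esub> t \<odot>\<^bsub>?V\<^esub> (\<zero>, \<lambda>_. 1) = (x, t)" "t \<odot>\<^bsub>?V\<^esub> (\<zero>, \<lambda>_. 1) = (\<zero>, t)"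
      using x by simp_all
    then show ?thesis
      using G_add[of "(x, \<lambda>_. 0)" "(\<zero>, t)"] G_smult[OF t, of "(\<zero>, \<lambda>_. 1)"] x t
      by (auto simp: g_def s_def mult.commute)
  qed
  have g_abs: "AE w in M. \<bar>g x w\<bar> \<le> sum_norm Q x w" if x: "x \<in> carrier E" for x
  proof -
    have *: "AE w in M. g y w \<le> sum_norm Q y w" if "y \<in> carrier E" for y
      using G_le[of "(y, \<lambda>_. 0)"] that by (simp add: g_def pair_norm_def)
    have "AE w in M. g (ae_class M (\<lambda>_. -1) \<odot> x) w = -1 * g x w"
      using x by (intro g_smult) auto
    moreover have "AE w in M. sum_norm Q (ae_class M (\<lambda>_. -1) \<odot> x) w = \<bar>-1\<bar> * sum_norm Q x w"
      using x by (intro sum_norm_smult Q) auto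
    moreover have "AE w in M. g (ae_class M (\<lambda>_. -1) \<odot> x) w \<le> sum_norm Q (ae_class M (\<lambda>_. -1) \<odot> x) w"
      using x by (intro *) auto
    ultimately show ?thesis using *[OF x] by eventually_elim auto
  qed
  have sep: "AE w in M. g y w + s w * t w + d w \<le> g x0 w + s w * r w" if "(y, t) \<in> epi_fun" for y t
  proof -
    have "y \<in> carrier E" "t \<in> borel_measurable M" using that by (auto simp: epi_fun_def)
    then show ?thesis
      using G_sep[OF that] G_split[of y t] G_split[OF x0 r] by auto
  qed
  have "AE w in M. s w \<le> 0"
  proof -
    \<comment> \<open>The epigraph is unbounded upwards over \<open>x1\<close>; a positive
      \<open>s w\<close> would violate the separation for large \<open>n\<close>.\<close>
    have "AE w in M. g x1 w + s w * (r1 w + real n) + d w \<le> g x0 w + s w * r w" for n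
      using F1 x1 by (intro sep) (auto simp: epi_fun_def)
    then have "AE w in M. \<forall>n. g x1 w + s w * (r1 w + real n) + d w \<le> g x0 w + s w * r w"
      by (simp add: AE_all_countable)
    then show ?thesis
    proof eventually_elim
      case (elim w)
      show ?case
      proof (rule ccontr)
        assume "\<not> s w \<le> 0"
        then obtain n where "g x0 w + s w * r w - g x1 w - s w * r1 w - d w < real n * s w"
          using reals_Archimedean3[of "s w"] by auto
        with elim[rule_format, of n] show False by (simp add: algebra_simps)
      qed
    qed
  qed
  moreover have "AE w in M. F x w < \<infinity> \<longrightarrow>
      g x w + s w * real_of_ereal (F x w) + d w \<le> g x0 w + s w * r w" if x: "x \<in> carrier E" for x
  proof -
    note [measurable] = measurable_F[OF x]
    \<comment> \<open>Where \<open>F x\<close> is infinite, \<open>x\<close> is replaced by the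
      filler \<open>x1\<close>. The patched point lies over the domain, and on the event of interest
      the separation at it is the separation at \<open>x\<close>.\<close>
    define \<theta> where "\<theta> w = (if F x w < \<infinity> then 1 else 0 :: real)" for w
    define t where "t w = (if F x w < \<infinity> then real_of_ereal (F x w) else r1 w)" for w
    define y where "y = ae_class M \<theta> \<odot> x \<oplus> ae_class M (\<lambda>w. 1 - \<theta> w) \<odot> x1"
    have \<theta> [measurable]: "\<theta> \<in> borel_measurable M" and t [measurable]: "t \<in> borel_measurable M"
      unfolding \<theta>_def t_def by measurable
    have \<theta>01: "0 \<le> \<theta> w \<and> \<theta> w \<le> 1" for w by (simp add: \<theta>_def)
    have y: "y \<in> carrier E" unfolding y_def using x x1 by simp
    have "AE w in M. F y w \<le> ereal (t w)"
      using F_convex[OF x x1 \<theta> \<theta>01] F1 F_not_MInf[OF x] unfolding y_def[symmetric]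
    proof eventually_elim
      case (elim w)
      then show ?case
        by (cases "F x w") (auto simp: \<theta>_def t_def simp flip: one_ereal_def zero_ereal_def)
    qed
    then have "(y, t) \<in> epi_fun" using y by (simp add: epi_fun_def)
    from sep[OF this] have "AE w in M. g y w + s w * t w + d w \<le> g x0 w + s w * r w" .
    moreover have "AE w in M. g y w = g (ae_class M \<theta> \<odot> x) w + g (ae_class M (\<lambda>w. 1 - \<theta> w) \<odot> x1) w"
      unfolding y_def using x x1 by (intro g_add) auto
    moreover have "AE w in M. g (ae_class M \<theta> \<odot> x) w = \<theta> w * g x w"
      using x by (intro g_smult) auto
    moreover have "AE w in M. g (ae_class M (\<lambda>w. 1 - \<theta> w) \<odot> x1) w = (1 - \<theta> w) * g x1 w"
      using x1 by (intro g_smult) auto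
    ultimately show ?thesis
      by eventually_elim (auto simp: \<theta>_def t_def)
  qed
  ultimately show ?thesis
    using that[OF Q g g_add g_smult g_abs s _ d d_pos] by blast
qed

end

section \<open>Suprema and biconjugates\<close>

text \<open>A countable subfamily already has the essential supremum as its pointwise supremum. An
  upper bound dominates these countably many members off a single null set, so the class of that
  supremum is least, and the supremum operator selects a least upper bound.\<close>

lemma Lbar_sup_least:
  assumes "prob_space M" and A: "A \<subseteq> carrier (Lbar M)"
  shows "least (Lbar M) (\<Squnion>\<^bsub>Lbar M\<^esub> A) (Upper (Lbar M) A)"
proof -
  interpret prob_space M by fact
  have "rep ` A \<subseteq> borel_measurable M" using A rep_in_class(2) by fastforce
  then obtain \<C> where C: "countable \<C>" "\<C> \<subseteq> rep ` A"
      "\<And>g. g \<in> rep ` A \<Longrightarrow> AE w in M. g w \<le> (SUP c\<in>\<C>. c w)"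
    using countable_essential_sup[of "rep ` A"] by blast
  let ?s = "\<lambda>w. SUP c\<in>\<C>. c w"
  have s: "?s \<in> borel_measurable M"
    using C(1,2) A rep_in_class(2) by (intro borel_measurable_SUP) fastforce+
  have r: "AE w in M. rep (ae_class M ?s) w = ?s w" by (rule rep_ae_class[OF s])
  have "least (Lbar M) (ae_class M ?s) (Upper (Lbar M) A)"
    unfolding least_def
  proof (intro conjI ballI)
    have "as_le M X (ae_class M ?s)" if "X \<in> A" for X
      unfolding as_le_def using C(3)[OF imageI[OF that]] r by eventually_elim simp
    then show "ae_class M ?s \<in> Upper (Lbar M) A"
      by (auto simp: Upper_def ae_class_carrier s)
    fix Y assume Y: "Y \<in> Upper (Lbar M) A"
    then have "AE w in M. c w \<le> rep Y w" if "c \<in> \<C>" for c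
      using A C(2) that by (auto simp: Upper_def as_le_def)
    then have "AE w in M. \<forall>c\<in>\<C>. c w \<le> rep Y w"
      by (simp add: AE_ball_countable C(1))
    with r have "AE w in M. rep (ae_class M ?s) w \<le> rep Y w"
      by eventually_elim (auto intro!: SUP_least)
    then show "ae_class M ?s \<sqsubseteq>\<^bsub>Lbar M\<^esub> Y"
      by (simp add: as_le_def)
  qed (auto simp: Upper_def)
  then show ?thesis
    unfolding sup_def by (metis (no_types, lifting) someI_ex)
qed

lemma Lbar_sup:
  assumes "prob_space M" and A: "A \<subseteq> carrier (Lbar M)"
  shows "\<Squnion>\<^bsub>Lbar M\<^esub> A \<in> carrier (Lbar M)"
    "X \<in> A \<Longrightarrow> AE w in M. rep X w \<le> rep (\<Squnion>\<^bsub>Lbar M\<^esub> A) w"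
    "u \<in> borel_measurable M \<Longrightarrow> (\<And>X. X \<in> A \<Longrightarrow> AE w in M. rep X w \<le> u w) \<Longrightarrow>
      AE w in M. rep (\<Squnion>\<^bsub>Lbar M\<^esub> A) w \<le> u w"
proof -
  let ?S = "\<Squnion>\<^bsub>Lbar M\<^esub> A"
  have l: "?S \<in> Upper (Lbar M) A" "\<And>Y. Y \<in> Upper (Lbar M) A \<Longrightarrow> as_le M ?S Y"
    using Lbar_sup_least[OF assms] by (auto simp: least_def)
  then show "?S \<in> carrier (Lbar M)" "X \<in> A \<Longrightarrow> AE w in M. rep X w \<le> rep ?S w"
    using A by (auto simp: Upper_def as_le_def)
  assume u: "u \<in> borel_measurable M" and le: "\<And>X. X \<in> A \<Longrightarrow> AE w in M. rep X w \<le> u w"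
  note r = rep_ae_class[OF u]
  have "AE w in M. rep X w \<le> rep (ae_class M u) w" if "X \<in> A" for X
    using le[OF that] r by eventually_elim simp
  then have "ae_class M u \<in> Upper (Lbar M) A"
    using u by (auto simp: Upper_def as_le_def ae_class_carrier)
  then have "AE w in M. rep ?S w \<le> rep (ae_class M u) w" using l(2) by (simp add: as_le_def)
  then show "AE w in M. rep ?S w \<le> u w" using r by eventually_elim simp
qed

lemma lift2_minus_ext_class:
  assumes g: "g \<in> borel_measurable M" and Y: "Y \<in> carrier (Lbar M)"
  shows "lift2 M (-) (ext_class M (ae_class M g)) Y \<in> carrier (Lbar M)"
    "AE w in M. rep (lift2 M (-) (ext_class M (ae_class M g)) Y) w = ereal (g w) - rep Y w"
proof -
  have [measurable]: "rep Y \<in> borel_measurable M" "g \<in> borel_measurable M"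
    using rep_in_class(2)[of Y M] Y g by auto
  have "ext_class M (ae_class M g) = ae_class M (\<lambda>w. ereal (g w))"
    by (rule lift1_ae_class) measurable
  moreover have "lift2 M (-) (ae_class M (\<lambda>w. ereal (g w))) (ae_class M (rep Y)) =
      ae_class M (\<lambda>w. ereal (g w) - rep Y w)"
    by (rule lift2_ae_class) measurable
  ultimately have *: "lift2 M (-) (ext_class M (ae_class M g)) Y = ae_class M (\<lambda>w. ereal (g w) - rep Y w)"
    using rep_in_class(3)[of Y M] Y by simp
  show "lift2 M (-) (ext_class M (ae_class M g)) Y \<in> carrier (Lbar M)"
    unfolding * by (simp add: ae_class_carrier)
  show "AE w in M. rep (lift2 M (-) (ext_class M (ae_class M g)) Y) w = ereal (g w) - rep Y w"
    unfolding * by (rule rep_ae_class) measurable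
qed

section \<open>Representatives of bounded module homomorphisms\<close>

context random_locally_convex_module
begin

text \<open>Elements of the dual given by representatives, with boundedness by a random multiple of
  finitely many seminorms in place of continuity. Allowing a random bound makes the class stable
  under multiplication by arbitrary random variables, as the slope \<open>- g / s\<close>
  requires.\<close>

definition dual_fun :: "('e \<Rightarrow> 'w \<Rightarrow> real) \<Rightarrow> bool" where
  "dual_fun g \<longleftrightarrow> (\<forall>x\<in>carrier E. g x \<in> borel_measurable M) \<and>
    (\<forall>x\<in>carrier E. \<forall>y\<in>carrier E. AE w in M. g (x \<oplus> y) w = g x w + g y w) \<and>
    (\<forall>u\<in>borel_measurable M. \<forall>x\<in>carrier E. AE w in M. g (ae_class M u \<odot> x) w = u w * g x w) \<and>
    (\<exists>Q \<zeta>. finite Q \<and> Q \<subseteq> P \<and> \<zeta> \<in> borel_measurable M \<and>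
      (\<forall>x\<in>carrier E. AE w in M. \<bar>g x w\<bar> \<le> \<zeta> w * sum_norm Q x w))"

lemma measurable_dual_fun: "dual_fun g \<Longrightarrow> x \<in> carrier E \<Longrightarrow> g x \<in> borel_measurable M"
  by (simp add: dual_fun_def)

lemma dual_fun_el_dual:
  assumes g: "dual_fun g"
  shows "(\<lambda>x\<in>carrier E. ae_class M (g x)) \<in> el_dual M E P"
proof -
  obtain Q \<zeta> where "finite Q" "Q \<subseteq> P" "\<zeta> \<in> borel_measurable M"
    "\<And>x. x \<in> carrier E \<Longrightarrow> AE w in M. \<bar>g x w\<bar> \<le> \<zeta> w * sum_norm Q x w"
    using g unfolding dual_fun_def by blast
  then show ?thesis
    using g by (intro el_dualI[of g Q \<zeta>]) (auto simp: dual_fun_def)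
qed

lemma dual_fun_scale:
  assumes g: "dual_fun g" and \<zeta> [measurable]: "\<zeta> \<in> borel_measurable M"
  shows "dual_fun (\<lambda>x w. \<zeta> w * g x w)"
proof -
  obtain Q \<xi> where Q: "finite Q" "Q \<subseteq> P" and \<xi> [measurable]: "\<xi> \<in> borel_measurable M"
    and b: "\<And>x. x \<in> carrier E \<Longrightarrow> AE w in M. \<bar>g x w\<bar> \<le> \<xi> w * sum_norm Q x w"
    using g unfolding dual_fun_def by blast
  have "AE w in M. \<bar>\<zeta> w * g x w\<bar> \<le> (\<bar>\<zeta> w\<bar> * \<xi> w) * sum_norm Q x w" if "x \<in> carrier E" for x
    using b[OF that] by eventually_elim (simp add: abs_mult mult.assoc mult_left_mono)
  moreover have "AE w in M. \<zeta> w * g (x \<oplus> y) w = \<zeta> w * g x w + \<zeta> w * g y w"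
    if "x \<in> carrier E" "y \<in> carrier E" for x y
  proof -
    have "AE w in M. g (x \<oplus> y) w = g x w + g y w" using g that by (simp add: dual_fun_def)
    then show ?thesis by eventually_elim (simp add: distrib_left)
  qed
  moreover have "AE w in M. \<zeta> w * g (ae_class M u \<odot> x) w = u w * (\<zeta> w * g x w)"
    if "u \<in> borel_measurable M" "x \<in> carrier E" for u x
  proof -
    have "AE w in M. g (ae_class M u \<odot> x) w = u w * g x w" using g that by (simp add: dual_fun_def)
    then show ?thesis by eventually_elim simp
  qed
  moreover have "(\<lambda>w. \<bar>\<zeta> w\<bar> * \<xi> w) \<in> borel_measurable M" by measurable
  moreover have "(\<lambda>w. \<zeta> w * g x w) \<in> borel_measurable M" if "x \<in> carrier E" for x
    using measurable_dual_fun[OF g that] by measurable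
  ultimately show ?thesis
    unfolding dual_fun_def using Q by (intro conjI ballI exI[of _ Q] exI[of _ "\<lambda>w. \<bar>\<zeta> w\<bar> * \<xi> w"])
qed

lemma dual_fun_add:
  assumes g: "dual_fun g" "dual_fun h"
  shows "dual_fun (\<lambda>x w. g x w + h x w)"
proof -
  obtain Q \<xi> where Q: "finite Q" "Q \<subseteq> P" and \<xi> [measurable]: "\<xi> \<in> borel_measurable M"
    and b: "\<And>x. x \<in> carrier E \<Longrightarrow> AE w in M. \<bar>g x w\<bar> \<le> \<xi> w * sum_norm Q x w"
    using g(1) unfolding dual_fun_def by blast
  obtain Q' \<xi>' where Q': "finite Q'" "Q' \<subseteq> P" and \<xi>' [measurable]: "\<xi>' \<in> borel_measurable M"
    and b': "\<And>x. x \<in> carrier E \<Longrightarrow> AE w in M. \<bar>h x w\<bar> \<le> \<xi>' w * sum_norm Q' x w"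
    using g(2) unfolding dual_fun_def by blast
  \<comment> \<open>The bounds have no prescribed sign, so absolute values are taken before
    enlarging the set of seminorms.\<close>
  have "AE w in M. \<bar>g x w + h x w\<bar> \<le> (\<bar>\<xi> w\<bar> + \<bar>\<xi>' w\<bar>) * sum_norm (Q \<union> Q') x w" if x: "x \<in> carrier E" for x
  proof -
    have "AE w in M. sum_norm Q x w \<le> sum_norm (Q \<union> Q') x w"
      "AE w in M. sum_norm Q' x w \<le> sum_norm (Q \<union> Q') x w"
      using Q Q' x by (auto intro!: sum_norm_mono)
    then show ?thesis
      using b[OF x] b'[OF x] sum_norm_nonneg[OF Q x] sum_norm_nonneg[OF Q' x]
    proof eventually_elim
      case (elim w)
      have "\<xi> w * sum_norm Q x w \<le> \<bar>\<xi> w\<bar> * sum_norm (Q \<union> Q') x w"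
        "\<xi>' w * sum_norm Q' x w \<le> \<bar>\<xi>' w\<bar> * sum_norm (Q \<union> Q') x w"
        using elim by (auto intro!: mult_mono)
      then show ?case using elim(3,4) unfolding distrib_right by linarith
    qed
  qed
  moreover have "AE w in M. g (x \<oplus> y) w + h (x \<oplus> y) w = (g x w + h x w) + (g y w + h y w)"
    if "x \<in> carrier E" "y \<in> carrier E" for x y
  proof -
    have "AE w in M. g (x \<oplus> y) w = g x w + g y w" "AE w in M. h (x \<oplus> y) w = h x w + h y w"
      using g that by (simp_all add: dual_fun_def)
    then show ?thesis by eventually_elim simp
  qed
  moreover have "AE w in M. g (ae_class M u \<odot> x) w + h (ae_class M u \<odot> x) w = u w * (g x w + h x w)"
    if "u \<in> borel_measurable M" "x \<in> carrier E" for u x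
  proof -
    have "AE w in M. g (ae_class M u \<odot> x) w = u w * g x w" "AE w in M. h (ae_class M u \<odot> x) w = u w * h x w"
      using g that by (simp_all add: dual_fun_def)
    then show ?thesis by eventually_elim (simp add: distrib_left)
  qed
  moreover have "(\<lambda>w. \<bar>\<xi> w\<bar> + \<bar>\<xi>' w\<bar>) \<in> borel_measurable M" by measurable
  moreover have "(\<lambda>w. g x w + h x w) \<in> borel_measurable M" if "x \<in> carrier E" for x
    using measurable_dual_fun[OF g(1) that] measurable_dual_fun[OF g(2) that] by measurable
  moreover have "finite (Q \<union> Q')" "Q \<union> Q' \<subseteq> P" using Q Q' by auto
  ultimately show ?thesis
    unfolding dual_fun_def by (intro conjI ballI exI[of _ "Q \<union> Q'"] exI[of _ "\<lambda>w. \<bar>\<xi> w\<bar> + \<bar>\<xi>' w\<bar>"])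
qed

end

section \<open>The two inequalities between a function and its biconjugate\<close>

context lsc_convex_function
begin

text \<open>The lattice supremum in terms of almost sure inequalities. \<open>h\<close> is any
  choice of representatives for \<open>g\<close>, so that both abstract elements of the dual and
  explicitly constructed affine minorants can be inserted.\<close>

lemma conjugate_family:
  assumes g: "\<And>x. x \<in> carrier E \<Longrightarrow> h x \<in> borel_measurable M"
    and eq: "\<And>x. x \<in> carrier E \<Longrightarrow> g x = ae_class M (h x)"
  shows "conjugate M E f g \<in> carrier (Lbar M)"
    "x \<in> carrier E \<Longrightarrow> AE w in M. ereal (h x w) - F x w \<le> rep (conjugate M E f g) w"
    "u \<in> borel_measurable M \<Longrightarrow> (\<And>x. x \<in> carrier E \<Longrightarrow> AE w in M. ereal (h x w) - F x w \<le> u w) \<Longrightarrow>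
      AE w in M. rep (conjugate M E f g) w \<le> u w"
proof -
  let ?X = "\<lambda>x. lift2 M (-) (ext_class M (g x)) (f x)"
  have fc: "f x \<in> carrier (Lbar M)" if "x \<in> carrier E" for x using f_carrier that by auto
  have X: "?X x \<in> carrier (Lbar M)" "AE w in M. rep (?X x) w = ereal (h x w) - F x w"
    if "x \<in> carrier E" for x
    unfolding eq[OF that] by (rule lift2_minus_ext_class[OF g[OF that] fc[OF that]])+
  have sub: "?X ` carrier E \<subseteq> carrier (Lbar M)" using X(1) by blast
  note S = Lbar_sup[OF prob_space_axioms sub, folded conjugate_def]
  show "conjugate M E f g \<in> carrier (Lbar M)" by (rule S(1))
  show "AE w in M. ereal (h x w) - F x w \<le> rep (conjugate M E f g) w" if "x \<in> carrier E"
    using S(2)[OF imageI[OF that]] X(2)[OF that] by eventually_elim simp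
  assume u: "u \<in> borel_measurable M" and le: "\<And>x. x \<in> carrier E \<Longrightarrow> AE w in M. ereal (h x w) - F x w \<le> u w"
  show "AE w in M. rep (conjugate M E f g) w \<le> u w"
  proof (rule S(3)[OF u])
    fix Y assume "Y \<in> ?X ` carrier E"
    then obtain x where x: "x \<in> carrier E" "Y = ?X x" by blast
    show "AE w in M. rep Y w \<le> u w"
      unfolding x(2) using X(2)[OF x(1)] le[OF x(1)] by eventually_elim simp
  qed
qed

lemma el_dual_rep:
  assumes "g \<in> el_dual M E P" "x \<in> carrier E"
  shows "rep (g x) \<in> borel_measurable M" "g x = ae_class M (rep (g x))"
  using assms rep_in_class[of "g x" M] by (auto simp: el_dual_def PiE_def)

lemma biconjugate_family:
  assumes x0: "x0 \<in> carrier E"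
  shows "biconjugate M E P f x0 \<in> carrier (Lbar M)"
    "g \<in> el_dual M E P \<Longrightarrow>
      AE w in M. ereal (rep (g x0) w) - rep (conjugate M E f g) w \<le> rep (biconjugate M E P f x0) w"
    "u \<in> borel_measurable M \<Longrightarrow> (\<And>g. g \<in> el_dual M E P \<Longrightarrow>
        AE w in M. ereal (rep (g x0) w) - rep (conjugate M E f g) w \<le> u w) \<Longrightarrow>
      AE w in M. rep (biconjugate M E P f x0) w \<le> u w"
proof -
  let ?X = "\<lambda>g. lift2 M (-) (ext_class M (g x0)) (conjugate M E f g)"
  have X: "?X g \<in> carrier (Lbar M)" "AE w in M. rep (?X g) w = ereal (rep (g x0) w) - rep (conjugate M E f g) w"
    if g: "g \<in> el_dual M E P" for g
  proof -
    note r = el_dual_rep[OF g]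
    have "conjugate M E f g \<in> carrier (Lbar M)" by (rule conjugate_family(1)[OF r])
    from lift2_minus_ext_class[OF r(1)[OF x0] this, folded r(2)[OF x0]]
    show "?X g \<in> carrier (Lbar M)" "AE w in M. rep (?X g) w = ereal (rep (g x0) w) - rep (conjugate M E f g) w" .
  qed
  have sub: "?X ` el_dual M E P \<subseteq> carrier (Lbar M)" using X(1) by blast
  note S = Lbar_sup[OF prob_space_axioms sub, folded biconjugate_def]
  show "biconjugate M E P f x0 \<in> carrier (Lbar M)" by (rule S(1))
  show "AE w in M. ereal (rep (g x0) w) - rep (conjugate M E f g) w \<le> rep (biconjugate M E P f x0) w"
    if "g \<in> el_dual M E P"
    using S(2)[OF imageI[OF that]] X(2)[OF that] by eventually_elim simp
  assume u: "u \<in> borel_measurable M" and le: "\<And>g. g \<in> el_dual M E P \<Longrightarrow>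
        AE w in M. ereal (rep (g x0) w) - rep (conjugate M E f g) w \<le> u w"
  show "AE w in M. rep (biconjugate M E P f x0) w \<le> u w"
  proof (rule S(3)[OF u])
    fix Y assume "Y \<in> ?X ` el_dual M E P"
    then obtain g where g: "g \<in> el_dual M E P" "Y = ?X g" by blast
    show "AE w in M. rep Y w \<le> u w"
      unfolding g(2) using X(2)[OF g(1)] le[OF g(1)] by eventually_elim simp
  qed
qed

text \<open>This is Young's inequality rearranged. Where \<open>F x0\<close> is finite, the
  conjugate is not \<open>-\<infinity>\<close>, so the rearrangement is legitimate; where it is
  \<open>\<infinity>\<close>, there is nothing to prove.\<close>

lemma biconjugate_le:
  assumes x0: "x0 \<in> carrier E"
  shows "AE w in M. rep (biconjugate M E P f x0) w \<le> F x0 w"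
proof (rule biconjugate_family(3)[OF x0 measurable_F[OF x0]])
  fix g assume g: "g \<in> el_dual M E P"
  have conj: "AE w in M. ereal (rep (g x0) w) - F x0 w \<le> rep (conjugate M E f g) w"
    by (rule conjugate_family(2)[OF el_dual_rep[OF g] x0])
  show "AE w in M. ereal (rep (g x0) w) - rep (conjugate M E f g) w \<le> F x0 w"
    using conj F_not_MInf[OF x0]
  proof eventually_elim
    case (elim w)
    then show ?case
      by (cases "F x0 w"; cases "rep (conjugate M E f g) w") auto
  qed
qed

text \<open>The minorant is controlled on \<open>D\<close> only. Off \<open>D\<close> the conjugate
  is merely bounded by \<open>\<infinity>\<close>, which leaves the estimate on \<open>D\<close>
  untouched.\<close>

lemma affine_minorant_le_biconjugate:
  assumes h: "dual_fun h" and D [measurable]: "D \<in> events" and c [measurable]: "c \<in> borel_measurable M"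
    and minor: "\<And>x. x \<in> carrier E \<Longrightarrow>
      AE w in M. w \<in> D \<longrightarrow> F x w < \<infinity> \<longrightarrow> h x w - real_of_ereal (F x w) \<le> c w"
    and x0: "x0 \<in> carrier E"
  shows "AE w in M. w \<in> D \<longrightarrow> ereal (h x0 w - c w) \<le> rep (biconjugate M E P f x0) w"
proof -
  define g where "g = (\<lambda>x\<in>carrier E. ae_class M (h x))"
  have g: "g \<in> el_dual M E P" unfolding g_def by (rule dual_fun_el_dual[OF h])
  have g_eq: "g x = ae_class M (h x)" if "x \<in> carrier E" for x using that by (simp add: g_def)
  have "AE w in M. rep (conjugate M E f g) w \<le> (if w \<in> D then ereal (c w) else \<infinity>)"
  proof (rule conjugate_family(3)[OF measurable_dual_fun[OF h] g_eq])
    show "(\<lambda>w. if w \<in> D then ereal (c w) else \<infinity>) \<in> borel_measurable M" by measurable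
    fix x assume x: "x \<in> carrier E"
    show "AE w in M. ereal (h x w) - F x w \<le> (if w \<in> D then ereal (c w) else \<infinity>)"
      using minor[OF x] F_not_MInf[OF x]
    proof eventually_elim
      case (elim w)
      then show ?case by (cases "F x w") auto
    qed
  qed
  moreover have "AE w in M. rep (g x0) w = h x0 w"
    unfolding g_eq[OF x0] by (rule rep_ae_class[OF measurable_dual_fun[OF h x0]])
  ultimately show ?thesis
    using biconjugate_family(2)[OF x0 g]
  proof eventually_elim
    case (elim w)
    show ?case
    proof
      assume "w \<in> D"
      then have "rep (conjugate M E f g) w \<le> ereal (c w)" using elim(1) by simp
      then have "ereal (h x0 w) - ereal (c w) \<le> ereal (h x0 w) - rep (conjugate M E f g) w"
        by (intro ereal_minus_mono) auto
      with elim(2,3) show "ereal (h x0 w - c w) \<le> rep (biconjugate M E P f x0) w" by simp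
    qed
  qed
qed

lemma le_biconjugate:
  assumes x0: "x0 \<in> carrier E"
  shows "AE w in M. F x0 w \<le> rep (biconjugate M E P f x0) w"
proof (rule ccontr)
  let ?b = "rep (biconjugate M E P f x0)"
  assume neg: "\<not> (AE w in M. F x0 w \<le> ?b w)"
  have [measurable]: "?b \<in> borel_measurable M" "F x0 \<in> borel_measurable M"
    using rep_in_class(2) biconjugate_family(1)[OF x0] measurable_F[OF x0] by auto
  \<comment> \<open>Rational levels suffice: if every one of them separated the two values only on a
    null set, the countable union of these sets would be null, and \<open>F x0 w \<le> ?b w\<close>
    holds off it.\<close>
  have "\<exists>q::rat. \<not> (AE w in M. \<not> (?b w < ereal (of_rat q) \<and> ereal (of_rat q) < F x0 w))"
  proof (rule ccontr)
    assume "\<not> ?thesis"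
    then have "AE w in M. \<forall>q::rat. \<not> (?b w < ereal (of_rat q) \<and> ereal (of_rat q) < F x0 w)"
      by (simp add: AE_all_countable)
    then have "AE w in M. F x0 w \<le> ?b w"
    proof eventually_elim
      case (elim w)
      show ?case
      proof (rule ccontr)
        assume "\<not> F x0 w \<le> ?b w"
        then obtain a where a: "?b w < ereal a" "ereal a < F x0 w"
          using ereal_dense2[of "?b w" "F x0 w"] by (auto simp: not_le)
        obtain a' where a': "ereal a < ereal a'" "ereal a' < F x0 w" using ereal_dense2[OF a(2)] by blast
        then obtain q where q: "a < of_rat q" "of_rat q < a'" using of_rat_dense[of a a'] by auto
        have "?b w < ereal (of_rat q)" using a(1) q(1) less_trans[of "?b w" "ereal a"] by simp
        moreover have "ereal (of_rat q) < F x0 w" using a'(2) q(2) less_trans[of _ "ereal a'"] by simp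
        ultimately show False using elim by blast
      qed
    qed
    with neg show False by simp
  qed
  then obtain q :: real where q: "\<not> (AE w in M. \<not> (?b w < ereal q \<and> ereal q < F x0 w))" by blast
  define A where "A = {w \<in> space M. ?b w < ereal q \<and> ereal q < F x0 w}"
  have A [measurable]: "A \<in> events" unfolding A_def by measurable
  have "\<not> (AE w in M. w \<notin> A)"
  proof
    assume "AE w in M. w \<notin> A"
    then have "AE w in M. \<not> (?b w < ereal q \<and> ereal q < F x0 w)"
      using AE_space by eventually_elim (auto simp: A_def)
    with q show False by simp
  qed
  then have "A \<notin> null_sets M" using AE_iff_null_sets[OF A] by simp
  then have A_pos: "0 < prob A"
    using A measure_nonneg[of M A] by (auto simp: null_sets_def emeasure_eq_measure less_le)
  have "AE w in M. w \<in> A \<longrightarrow> ereal q < F x0 w" by (simp add: A_def)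
  from epi_separation[OF x0 borel_measurable_const A A_pos this]
  obtain Q g s d where Q: "finite Q" "Q \<subseteq> P"
    and g: "\<And>x. x \<in> carrier E \<Longrightarrow> g x \<in> borel_measurable M"
      "\<And>x y. x \<in> carrier E \<Longrightarrow> y \<in> carrier E \<Longrightarrow> AE w in M. g (x \<oplus> y) w = g x w + g y w"
      "\<And>u x. u \<in> borel_measurable M \<Longrightarrow> x \<in> carrier E \<Longrightarrow> AE w in M. g (ae_class M u \<odot> x) w = u w * g x w"
      "\<And>x. x \<in> carrier E \<Longrightarrow> AE w in M. \<bar>g x w\<bar> \<le> sum_norm Q x w"
    and s [measurable]: "s \<in> borel_measurable M" and s0: "AE w in M. s w \<le> 0"
    and d [measurable]: "d \<in> borel_measurable M" and d_pos: "0 < prob {w \<in> A. 0 < d w}"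
    and sep: "\<And>x. x \<in> carrier E \<Longrightarrow> AE w in M. F x w < \<infinity> \<longrightarrow>
      g x w + s w * real_of_ereal (F x w) + d w \<le> g x0 w + s w * q"
    by blast
  have g_dual: "dual_fun g"
    unfolding dual_fun_def using g Q
    by (intro conjI ballI exI[of _ Q] exI[of _ "\<lambda>_. 1"]) auto
  have D_eq: "{w \<in> A. 0 < d w} = A \<inter> {w \<in> space M. 0 < d w}"
    using sets.sets_into_space[OF A] by auto
  define D where "D = {w \<in> A. 0 < d w}"
  have D [measurable]: "D \<in> events" unfolding D_def D_eq by measurable
  have D_pos: "0 < prob D" using d_pos by (simp add: D_def)
  \<comment> \<open>Dividing the separation by \<open>- s\<close> turns it into an affine minorant
    where \<open>s\<close> is negative. The gap \<open>d\<close> then reappears as the surplus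
    \<open>- d / s\<close> over the level \<open>r\<close> at \<open>y\<close>. The statement is
    general because it is used for both separations.\<close>
  have slope: "\<exists>h c. dual_fun h \<and> c \<in> borel_measurable M \<and>
      (\<forall>x\<in>carrier E. AE w in M. s w < 0 \<longrightarrow> F x w < \<infinity> \<longrightarrow> h x w - real_of_ereal (F x w) \<le> c w) \<and>
      (AE w in M. s w < 0 \<longrightarrow> h y w - c w = r w - d w / s w)"
    if g: "dual_fun g" and [measurable]: "s \<in> borel_measurable M" "d \<in> borel_measurable M" "r \<in> borel_measurable M"
      and y: "y \<in> carrier E"
      and sep: "\<And>x. x \<in> carrier E \<Longrightarrow> AE w in M. F x w < \<infinity> \<longrightarrow>
        g x w + s w * real_of_ereal (F x w) + d w \<le> g y w + s w * r w"
    for g s d r y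
  proof -
    define \<zeta> where "\<zeta> w = - (1 / s w)" for w
    have \<zeta> [measurable]: "\<zeta> \<in> borel_measurable M" unfolding \<zeta>_def by measurable
    note [measurable] = measurable_dual_fun[OF g y]
    have "AE w in M. s w < 0 \<longrightarrow> F x w < \<infinity> \<longrightarrow>
        \<zeta> w * g x w - real_of_ereal (F x w) \<le> \<zeta> w * g y w - r w + d w / s w" if x: "x \<in> carrier E" for x
      using sep[OF x]
    proof eventually_elim
      case (elim w)
      show ?case
      proof (intro impI)
        assume s: "s w < 0" "F x w < \<infinity>"
        then have \<zeta>s: "0 < \<zeta> w" "\<zeta> w * s w = -1" "d w / s w = - (\<zeta> w * d w)"
          by (auto simp: \<zeta>_def)
        have "\<zeta> w * (g x w + s w * real_of_ereal (F x w) + d w) \<le> \<zeta> w * (g y w + s w * r w)"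
          using elim s \<zeta>s(1) by (intro mult_left_mono) auto
        then have "\<zeta> w * g x w + (\<zeta> w * s w) * real_of_ereal (F x w) + \<zeta> w * d w \<le>
            \<zeta> w * g y w + (\<zeta> w * s w) * r w"
          by (simp only: distrib_left mult.assoc)
        then show "\<zeta> w * g x w - real_of_ereal (F x w) \<le> \<zeta> w * g y w - r w + d w / s w"
          unfolding \<zeta>s(2,3) by simp
      qed
    qed
    then show ?thesis
      by (intro exI[of _ "\<lambda>x w. \<zeta> w * g x w"] exI[of _ "\<lambda>w. \<zeta> w * g y w - r w + d w / s w"])
        (auto intro: dual_fun_scale[OF g \<zeta>])
  qed
  have "AE w in M. \<not> (w \<in> D \<and> s w < 0)"
  proof -
    obtain h c where h: "dual_fun h" and c: "c \<in> borel_measurable M"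
      and minor: "\<And>x. x \<in> carrier E \<Longrightarrow>
        AE w in M. s w < 0 \<longrightarrow> F x w < \<infinity> \<longrightarrow> h x w - real_of_ereal (F x w) \<le> c w"
      and val: "AE w in M. s w < 0 \<longrightarrow> h x0 w - c w = q - d w / s w"
      using slope[OF g_dual s d borel_measurable_const x0 sep] by blast
    define D' where "D' = D \<inter> {w \<in> space M. s w < 0}"
    have D': "D' \<in> events" unfolding D'_def by measurable
    have "AE w in M. w \<in> D' \<longrightarrow> F x w < \<infinity> \<longrightarrow> h x w - real_of_ereal (F x w) \<le> c w"
      if "x \<in> carrier E" for x
      using minor[OF that] by eventually_elim (auto simp: D'_def)
    then have "AE w in M. w \<in> D' \<longrightarrow> ereal (h x0 w - c w) \<le> ?b w"
      by (rule affine_minorant_le_biconjugate[OF h D' c _ x0])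
    then show ?thesis
      using val AE_space
    proof eventually_elim
      case (elim w)
      show ?case
      proof
        assume w: "w \<in> D \<and> s w < 0"
        then have "ereal (q - d w / s w) \<le> ?b w" using elim by (simp add: D'_def)
        moreover have "?b w < ereal q" using w by (auto simp: D_def A_def)
        ultimately have "ereal (q - d w / s w) < ereal q" by (rule le_less_trans)
        moreover have "d w / s w < 0" using w by (auto simp: D_def intro: divide_pos_neg)
        ultimately show False by simp
      qed
    qed
  qed
  then have s_D: "AE w in M. w \<in> D \<longrightarrow> s w = 0" using s0 by eventually_elim auto
  obtain x1 r1 where x1: "x1 \<in> carrier E" and r1 [measurable]: "r1 \<in> borel_measurable M"
    and F1: "AE w in M. F x1 w = ereal (r1 w)" by (rule dom_point)
  \<comment> \<open>The graph over \<open>x1\<close> is lowered by one, so a separation from below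
    is available on all of \<open>D\<close>, where the first one turned out to be vertical.\<close>
  define r where "r w = r1 w - 1" for w
  have r [measurable]: "r \<in> borel_measurable M" unfolding r_def by measurable
  have "AE w in M. w \<in> D \<longrightarrow> ereal (r w) < F x1 w" using F1 by eventually_elim (simp add: r_def)
  from epi_separation[OF x1 r D D_pos this]
  obtain Q1 g1 s1 d1 where Q1: "finite Q1" "Q1 \<subseteq> P"
    and g1: "\<And>x. x \<in> carrier E \<Longrightarrow> g1 x \<in> borel_measurable M"
      "\<And>x y. x \<in> carrier E \<Longrightarrow> y \<in> carrier E \<Longrightarrow> AE w in M. g1 (x \<oplus> y) w = g1 x w + g1 y w"
      "\<And>u x. u \<in> borel_measurable M \<Longrightarrow> x \<in> carrier E \<Longrightarrow> AE w in M. g1 (ae_class M u \<odot> x) w = u w * g1 x w"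
      "\<And>x. x \<in> carrier E \<Longrightarrow> AE w in M. \<bar>g1 x w\<bar> \<le> sum_norm Q1 x w"
    and s1 [measurable]: "s1 \<in> borel_measurable M" and "AE w in M. s1 w \<le> 0"
    and d1 [measurable]: "d1 \<in> borel_measurable M" and d1_pos: "0 < prob {w \<in> D. 0 < d1 w}"
    and sep1: "\<And>x. x \<in> carrier E \<Longrightarrow> AE w in M. F x w < \<infinity> \<longrightarrow>
      g1 x w + s1 w * real_of_ereal (F x w) + d1 w \<le> g1 x1 w + s1 w * r w"
    by blast
  have g1_dual: "dual_fun g1"
    unfolding dual_fun_def using g1 Q1
    by (intro conjI ballI exI[of _ Q1] exI[of _ "\<lambda>_. 1"]) auto
  have D1_eq: "{w \<in> D. 0 < d1 w} = D \<inter> {w \<in> space M. 0 < d1 w}"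
    using sets.sets_into_space[OF D] by auto
  define D1 where "D1 = {w \<in> D. 0 < d1 w}"
  have D1 [measurable]: "D1 \<in> events" unfolding D1_def D1_eq by measurable
  \<comment> \<open>Evaluating the second separation at \<open>x1\<close> itself cancels
    \<open>g1\<close> and leaves \<open>d1 \<le> - s1\<close>, so it cannot be vertical where its
    gap is positive.\<close>
  have s1_neg: "AE w in M. w \<in> D1 \<longrightarrow> s1 w < 0"
    using sep1[OF x1] F1
  proof eventually_elim
    case (elim w)
    then have "d1 w \<le> - s1 w" by (simp add: r_def algebra_simps)
    then show ?case by (auto simp: D1_def)
  qed
  obtain h c where h: "dual_fun h" and c [measurable]: "c \<in> borel_measurable M"
    and minor: "\<And>x. x \<in> carrier E \<Longrightarrow>
      AE w in M. s1 w < 0 \<longrightarrow> F x w < \<infinity> \<longrightarrow> h x w - real_of_ereal (F x w) \<le> c w"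
    using slope[OF g1_dual s1 d1 r x1 sep1] by blast
  note [measurable] = measurable_dual_fun[OF g_dual x0]
  \<comment> \<open>On \<open>D1\<close> the first separation has \<open>s = 0\<close> and reads
    \<open>g x + d \<le> g x0\<close> wherever \<open>F x\<close> is finite. Adding \<open>n\<close>
    times it to the minorant keeps it below \<open>f\<close> on \<open>D1\<close> and raises its
    value at \<open>x0\<close> by \<open>n * d\<close>.\<close>
  have "AE w in M. w \<in> D1 \<longrightarrow> ereal (h x0 w - c w + real n * d w) \<le> ?b w" for n :: nat
  proof -
    have "AE w in M. w \<in> D1 \<longrightarrow> F x w < \<infinity> \<longrightarrow>
        (h x w + real n * g x w) - real_of_ereal (F x w) \<le> c w + real n * (g x0 w - d w)"
      if x: "x \<in> carrier E" for x
      using minor[OF x] s1_neg s_D sep[OF x]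
    proof eventually_elim
      case (elim w)
      show ?case
      proof (intro impI)
        assume w: "w \<in> D1" "F x w < \<infinity>"
        then have "w \<in> D" by (simp add: D1_def)
        then have "g x w \<le> g x0 w - d w" using elim w by simp
        then have "real n * g x w \<le> real n * (g x0 w - d w)" by (intro mult_left_mono) auto
        then show "(h x w + real n * g x w) - real_of_ereal (F x w) \<le> c w + real n * (g x0 w - d w)"
          using elim(1,2) w by simp
      qed
    qed
    moreover have "dual_fun (\<lambda>x w. h x w + real n * g x w)"
      by (intro dual_fun_add[OF h] dual_fun_scale[OF g_dual]) simp
    moreover have "(\<lambda>w. c w + real n * (g x0 w - d w)) \<in> borel_measurable M" by measurable
    ultimately have "AE w in M. w \<in> D1 \<longrightarrow>
        ereal ((h x0 w + real n * g x0 w) - (c w + real n * (g x0 w - d w))) \<le> ?b w"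
      by (intro affine_minorant_le_biconjugate[OF _ D1 _ _ x0])
    then show ?thesis by eventually_elim (simp add: algebra_simps)
  qed
  \<comment> \<open>One null set serves all \<open>n\<close>, so \<open>n\<close> may afterwards be
    chosen separately at each point.\<close>
  then have "AE w in M. \<forall>n::nat. w \<in> D1 \<longrightarrow> ereal (h x0 w - c w + real n * d w) \<le> ?b w"
    unfolding AE_all_countable by blast
  then have "AE w in M. w \<notin> D1"
  proof eventually_elim
    case (elim w)
    show ?case
    proof
      assume w: "w \<in> D1"
      then have b: "?b w < ereal q" and "0 < d w" by (auto simp: D1_def D_def A_def)
      then obtain n where n: "q - h x0 w + c w < real n * d w" using reals_Archimedean3[of "d w"] by auto
      have "ereal (h x0 w - c w + real n * d w) < ereal q"
        using elim w by (intro le_less_trans[OF _ b]) blast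
      with n show False by simp
    qed
  qed
  then have "prob D1 = 0" using AE_iff_null_sets[OF D1] by (simp add: measure_eq_0_null_sets)
  with d1_pos show False by (simp add: D1_def)
qed

end

theorem theorem4p5:
  fixes M :: "'w measure"
    and E :: "(('w \<Rightarrow> real) set, 'e, 'm) module_scheme"
    and P :: "('e \<Rightarrow> ('w \<Rightarrow> real) set) set"
    and f :: "'e \<Rightarrow> ('w \<Rightarrow> ereal) set"
  assumes "random_locally_convex_module M E P"
    and "f \<in> carrier E \<rightarrow> carrier (Lbar M)"
    and "proper M E f"
    and "el_lsc M E P f"
    and "L0_convex M E f"
  shows "\<forall>x\<in>carrier E. biconjugate M E P f x = f x"
proof
  interpret lsc_convex_function M E P f
    using assms by (intro lsc_convex_function.intro lsc_convex_function_axioms.intro)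
  interpret L: partial_order "Lbar M" by (rule Lbar_partial_order)
  fix x assume x: "x \<in> carrier E"
  show "biconjugate M E P f x = f x"
  proof (rule L.le_antisym[simplified])
    show "as_le M (biconjugate M E P f x) (f x)" "as_le M (f x) (biconjugate M E P f x)"
      unfolding as_le_def by (fact biconjugate_le[OF x] le_biconjugate[OF x])+
    show "biconjugate M E P f x \<in> borel_measurable M // ae_rel M" "f x \<in> borel_measurable M // ae_rel M"
      using biconjugate_family(1)[OF x] f_carrier x by auto
  qed
qed

end
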